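(* Let $\epsilon\in(0,\frac13)$ and let $C\in\mathbb{S}^n$ be a diagonally dominant matrix (symmetric, with positive diagonal entries). Consider the problem $$\max_X\ \langle C,X\rangle-\beta\,\phi_M(\mathrm{diag}(X)-\mathbb{1})\quad\text{subject to } \mathrm{Tr}(X)\le n,\ X\succeq0,\qquad (\ast)$$ with $M=4\frac{\log(2n)}{\epsilon}$ and $\beta=4\mathrm{Tr}(C)$. Suppose $(\ast)$ is solved to $\epsilon\mathrm{Tr}(C)$-optimality using the Frank-Wolfe algorithm with Gaussian sampling (described in the context), with $\eta=1$ and $p=\frac{\epsilon}{T(n,\epsilon)}$, where $T(n,\epsilon)=64\frac{\log(2n)n^2}{\epsilon^2}$, and that its output is then passed to the rounding procedure GenerateSample (described in the context). This procedure generates a binary vector $w$ that satisfies $$\alpha_{GW}(1-3\epsilon)\,\mathrm{opt}\ \le\ \mathbb{E}[w^TCw]\ \le\ \mathrm{opt},$$ where $\mathrm{opt}$ is the maximum of $x^TCx$ over $x\in\{-1,1\}^n$. The Frank-Wolfe algorithm with Gaussian sampling terminates after at most $T(n,\epsilon)$ iterations, where at each iteration at most $240\frac{n}{\epsilon}\log\left(\frac{4n}{\epsilon}\right)$ matrix-vector multiplications are performed. The working memory required is at most $3n$ numbers.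
   Context: $\mathbb{S}^n$: real symmetric $n\times n$ matrices; $\langle A,B\rangle=\mathrm{Tr}(A^TB)$; $\mathbb{1}$: all-ones vector; $\mathrm{diag}(X)$: vector of diagonal entries of $X$; $\mathrm{diag}^*(x)$: diagonal matrix with diagonal $x$. A symmetric $C$ is diagonally dominant if $|C_{ii}|\ge\sum_{j\neq i}|C_{ij}|$ for all $i$. $\alpha_{GW}=\min_{0<\theta\le\pi}\frac2\pi\frac{\theta}{1-\cos\theta}\approx0.878$. For $M>0$ and $v\in\mathbb{R}^d$, $\phi_M(v)=\frac1M\log\left(\sum_{i=1}^d e^{Mv_i}+\sum_{i=1}^d e^{-Mv_i}\right)$. Here $d=n$. Working memory: total memory used (counted in stored numbers) apart from that required to represent the problem instance. A feasible point is $\delta$-optimal for a maximization problem if its value is at least the maximum minus $\delta$. Frank-Wolfe algorithm with Gaussian sampling, applied to $(\ast)$: write $\mathcal{B}(X)=(\langle C,X\rangle,\mathrm{diag}(X))$ and $g(u,v)=u-\beta\phi_M(v-\mathbb{1})$, so the objective is $g(\mathcal{B}(X))$, and let $C_g^u=16\frac{\mathrm{Tr}(C)\log(2n)n^2}{\epsilon}$ (used as an upper bound on the curvature constant). The trace bound is $\alpha=n$. Start with $X_0=I$, $V_0=\mathcal{B}(X_0)$ and $z_0\sim\mathcal{N}(0,X_0)$. At iteration $t=0,1,2,\dots$, with $\gamma_t=\frac{2}{t+2}$ and $J_t=\mathcal{B}^*(\nabla g(V_t))$ (where $\mathcal{B}^*$ is the adjoint of $\mathcal{B}$): the subroutine LMO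 computes, by the power method with random start, a unit vector $w_t$ such that with probability at least $1-p$, $\alpha w_t^TJ_tw_t\ge\alpha\lambda_{\max}(J_t)-\frac12\eta\gamma_tC_g^u$, with randomness independent across calls; if $w_t^TJ_tw_t\ge0$ set $q_t=\mathcal{B}(\alpha w_tw_t^T)$ and use the sampling direction $\sqrt{\alpha}\,w_t$, otherwise set $q_t=0$ and use the sampling direction $0$. If $\langle q_t-V_t,\nabla g(V_t)\rangle\le\epsilon\mathrm{Tr}(C)$, stop and output $(z_t,V_t)$. Otherwise set $z_{t+1}=\sqrt{1-\gamma_t}\,z_t+\sqrt{\gamma_t}\,\zeta_t\cdot(\text{sampling direction})$ with $\zeta_t\sim\mathcal{N}(0,1)$ independent, and $V_{t+1}=(1-\gamma_t)V_t+\gamma_tq_t$. Thus $z_t\sim\mathcal{N}(0,X_t)$ and $V_t=\mathcal{B}(X_t)$ for the implicitly defined (never stored) matrices $X_{t+1}=(1-\gamma_t)X_t+\gamma_tH_t$, with $H_t=\alpha w_tw_t^T$ or $0$. The output covariance is denoted $\widehat X_\epsilon$. Power method guarantee used: for $J\in\mathbb{S}^n$ with largest absolute eigenvalue $\lambda$, the power method with random start computes a unit vector $w$ with $\alpha w^TJw\ge\alpha\lambda_{\max}(J)-\delta$ with probability at least $1-p$ after $k\ge\frac{\lambda\alpha}{\delta}\log\left(\frac{n}{p^2}\right)$ iterations, each consisting of one matrix-vector multiplication with $J$, using working memory of $n$ numbers. Rounding procedure GenerateSample: given $\widehat z_\epsilon\sim\mathcal{N}(0,\widehat X_\epsilon)$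 and $\mathrm{diag}(\widehat X_\epsilon)$, let $m=\max(\mathrm{diag}(\widehat X_\epsilon))$, generate $\zeta\sim\mathcal{N}\left(0,I-\mathrm{diag}^*\left(\mathrm{diag}(\widehat X_\epsilon)/m\right)\right)$ independently of $\widehat z_\epsilon$, set $\overline w=\widehat z_\epsilon/\sqrt m+\zeta$, and return $w=\mathrm{sign}(\overline w)$ (entrywise). The expectation $\mathbb{E}[w^TCw]$ is over all randomness (the Gaussian vectors and the random starts of the power method).
   Formalization: Termination within T iterations is claimed when all LMO calls meet their tolerance (probability at least 1-ε), eventual termination always; the power method runs on J shifted by its largest absolute eigenvalue; the 3n memory bound counts vector entries, not the O(1) scalars. *)

theory Defs
  imports "HOL-Probability.Probability"
begin

section \<open>Matrices and the optimization problem\<close>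

text \<open>
  Matrices have type \<open>real^'n^'n\<close> and \<open>n = CARD('n)\<close>. The library inner product
  \<open>A \<bullet> B\<close> on this type is the entrywise one, i.e. the trace of \<open>transpose A ** B\<close>.
\<close>

definition symmetric_matrix :: "real^'n^'n \<Rightarrow> bool" where
  "symmetric_matrix A \<longleftrightarrow> transpose A = A"

definition psd :: "real^'n^'n \<Rightarrow> bool" where
  "psd A \<longleftrightarrow> symmetric_matrix A \<and> (\<forall>x. 0 \<le> x \<bullet> (A *v x))"

definition diagonally_dominant :: "real^'n^'n \<Rightarrow> bool" where
  "diagonally_dominant A \<longleftrightarrow> (\<forall>i. \<bar>A $ i $ i\<bar> \<ge> (\<Sum>j\<in>UNIV - {i}. \<bar>A $ i $ j\<bar>))"

definition eigenvalues :: "real^'n^'n \<Rightarrow> real set" where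
  "eigenvalues A = {l. \<exists>x. x \<noteq> 0 \<and> A *v x = l *\<^sub>R x}"

definition lambda_max :: "real^'n^'n \<Rightarrow> real" where
  "lambda_max A = Max (eigenvalues A)"

definition abs_eigenvalue_max :: "real^'n^'n \<Rightarrow> real" where
  "abs_eigenvalue_max A = Max (abs ` eigenvalues A)"

definition diag_vec :: "real^'n^'n \<Rightarrow> real^'n" where
  "diag_vec X = (\<chi> i. X $ i $ i)"

definition rank_one :: "real^'n \<Rightarrow> real^'n^'n" where
  "rank_one w = (\<chi> i j. w $ i * w $ j)"

definition phi :: "real \<Rightarrow> real^'n \<Rightarrow> real" where
  "phi M v = 1 / M * ln ((\<Sum>i\<in>UNIV. exp (M * v $ i)) + (\<Sum>i\<in>UNIV. exp (- (M * v $ i))))"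

definition B_op :: "real^'n^'n \<Rightarrow> real^'n^'n \<Rightarrow> real \<times> (real^'n)" where
  "B_op C X = (C \<bullet> X, diag_vec X)"

definition g_fun :: "real \<Rightarrow> real \<Rightarrow> real \<times> (real^'n) \<Rightarrow> real" where
  "g_fun \<beta> M = (\<lambda>(u, v). u - \<beta> * phi M (v - 1))"  \<comment> \<open>\<open>1 :: real^'n\<close> is the all-ones vector\<close>

definition grad :: "('a::real_inner \<Rightarrow> real) \<Rightarrow> 'a \<Rightarrow> 'a" where
  "grad f x = (THE D. GDERIV f x :> D)"

definition feasible :: "(real^'n^'n) set" where
  "feasible = {X. psd X \<and> trace X \<le> real CARD('n)}"

definition delta_optimal :: "('a \<Rightarrow> real) \<Rightarrow> 'a set \<Rightarrow> real \<Rightarrow> 'a \<Rightarrow> bool" where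
  "delta_optimal f K \<delta> X \<longleftrightarrow> X \<in> K \<and> (\<forall>Y\<in>K. f Y - \<delta> \<le> f X)"

definition binary_vectors :: "(real^'n) set" where
  "binary_vectors = {x. \<forall>i. x $ i \<in> {-1, 1}}"

definition binary_opt :: "real^'n^'n \<Rightarrow> real" where
  "binary_opt C = Max ((\<lambda>x. x \<bullet> (C *v x)) ` binary_vectors)"

definition alpha_GW :: real where
  "alpha_GW = (INF \<theta>\<in>{0<..pi}. 2 / pi * (\<theta> / (1 - cos \<theta>)))"


section \<open>Frank-Wolfe with Gaussian sampling, followed by rounding\<close>

text \<open>
  Parameters of a run: the cost matrix \<open>C\<close>, \<open>\<beta>\<close> and \<open>M\<close> of the objective, the
  bound \<open>C_g^u\<close> on the curvature constant, the threshold of the stopping test, and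
  \<open>\<eta>\<close>, \<open>p\<close> of the subroutine LMO. The guarantee for the power method prescribes a
  least number of iterations; a call of LMO in iteration \<open>t\<close> performs \<open>fw_extra t\<close>
  iterations more than that (\<open>\<lambda>t. 0\<close> being the least choice).
\<close>

record ('n::finite) fw_param =
  fw_cost :: "real^'n^'n"
  fw_beta :: real
  fw_M :: real
  fw_curv :: real
  fw_tol :: real
  fw_eta :: real
  fw_p :: real
  fw_extra :: "nat \<Rightarrow> nat"

text \<open>
  All randomness comes from a family of independent standard normal variables with the
  following index type: the entries of \<open>z_0\<close>, of the random starts of the power method
  (the start of call \<open>t\<close> is \<open>N(0, I)\<close>, normalized), the \<open>\<zeta>_t\<close>, and the entries of the
  Gaussian vector used for rounding.
\<close>

datatype 'n source = Init 'n | Seed nat 'n | Zeta nat | Round 'n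

definition fw_objective :: "('n::finite) fw_param \<Rightarrow> real^'n^'n \<Rightarrow> real" where
  "fw_objective S X = g_fun (fw_beta S) (fw_M S) (B_op (fw_cost S) X)"

definition fw_grad :: "('n::finite) fw_param \<Rightarrow> real \<times> (real^'n) \<Rightarrow> real \<times> (real^'n)" where
  "fw_grad S V = grad (g_fun (fw_beta S) (fw_M S)) V"

definition fw_J :: "('n::finite) fw_param \<Rightarrow> real \<times> (real^'n) \<Rightarrow> real^'n^'n" where
  "fw_J S V = adjoint (B_op (fw_cost S)) (fw_grad S V)"

definition fw_gamma :: "nat \<Rightarrow> real" where
  "fw_gamma t = 2 / (real t + 2)"

definition lmo_error :: "('n::finite) fw_param \<Rightarrow> nat \<Rightarrow> real" where
  "lmo_error S t = 1 / 2 * fw_eta S * fw_gamma t * fw_curv S"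

definition power_count :: "('n::finite) fw_param \<Rightarrow> nat \<Rightarrow> real^'n^'n \<Rightarrow> nat" where
  "power_count S t J =
     nat \<lceil>abs_eigenvalue_max J * real CARD('n) / lmo_error S t
           * ln (real CARD('n) / (fw_p S)\<^sup>2)\<rceil> + fw_extra S t"

text \<open>
  One iteration of the power method. The multiple of the identity makes the matrix
  positive semidefinite, so that the dominant eigenvalue is the one belonging to
  \<open>lambda_max J\<close>; without it the iteration could converge to an eigenvector of a
  dominant negative eigenvalue and the guarantee would fail.
  One multiplication with \<open>J\<close> is needed.
\<close>

definition power_step :: "real^'n^'n \<Rightarrow> real^'n \<Rightarrow> real^'n" where
  "power_step J x = sgn (J *v x + abs_eigenvalue_max J *\<^sub>R x)"

definition fw_H :: "real^'n^'n \<Rightarrow> real^'n \<Rightarrow> real^'n^'n" where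
  "fw_H J w = (if w \<bullet> (J *v w) \<ge> 0 then real CARD('n) *\<^sub>R rank_one w else 0)"

definition fw_direction :: "real^'n^'n \<Rightarrow> real^'n \<Rightarrow> real^'n" where
  "fw_direction J w = (if w \<bullet> (J *v w) \<ge> 0 then sqrt (real CARD('n)) *\<^sub>R w else 0)"

text \<open>
  GenerateSample; \<open>v\<close> is the diagonal of the covariance of \<open>z\<close>. For \<open>\<xi>\<close> with
  independent standard normal entries, the vector with entries \<open>sqrt (1 - v_i/m) * \<xi>_i\<close>
  has distribution \<open>N(0, I - diag*(v/m))\<close>.
\<close>

definition generate_sample :: "real^'n \<Rightarrow> real^'n \<Rightarrow> real^'n \<Rightarrow> real^'n" where
  "generate_sample z v \<xi> =
     (let m = Max (range (\<lambda>i. v $ i))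
      in \<chi> i. sgn (z $ i / sqrt m + sqrt (1 - v $ i / m) * \<xi> $ i))"

text \<open>
  The procedure is a transition system, and a configuration is everything it stores apart
  from the problem instance:
  \<^item> \<open>Start t z V\<close>: beginning of iteration \<open>t\<close>;
  \<^item> \<open>Power t z V k x\<close>: iteration \<open>t\<close>, inside LMO, with current vector \<open>x\<close> of the power
    method and \<open>k\<close> of its iterations still to be done;
  \<^item> \<open>Stop t z V\<close>: Frank-Wolfe has stopped in iteration \<open>t\<close> with output \<open>(z, V)\<close>;
  \<^item> \<open>Output w\<close>: GenerateSample has returned \<open>w\<close>.
\<close>

datatype ('n::finite) config =
    Start nat "real^'n" "real \<times> (real^'n)"
  | Power nat "real^'n" "real \<times> (real^'n)" nat "real^'n"
  | Stop nat "real^'n" "real \<times> (real^'n)"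
  | Output "real^'n"

fun fw_step :: "('n::finite) fw_param \<Rightarrow> ('n source \<Rightarrow> real) \<Rightarrow> 'n config \<Rightarrow> 'n config" where
  "fw_step S r (Start t z V) =
     Power t z V (power_count S t (fw_J S V)) (sgn (\<chi> i. r (Seed t i)))"
| "fw_step S r (Power t z V (Suc k) x) = Power t z V k (power_step (fw_J S V) x)"
| "fw_step S r (Power t z V 0 x) =
     (let \<gamma> = fw_gamma t; J = fw_J S V; q = B_op (fw_cost S) (fw_H J x)
      in if (q - V) \<bullet> fw_grad S V \<le> fw_tol S then Stop t z V
         else Start (Suc t)
                (sqrt (1 - \<gamma>) *\<^sub>R z + (sqrt \<gamma> * r (Zeta t)) *\<^sub>R fw_direction J x)
                ((1 - \<gamma>) *\<^sub>R V + \<gamma> *\<^sub>R q))"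
| "fw_step S r (Stop t z V) = Output (generate_sample z (snd V) (\<chi> i. r (Round i)))"
| "fw_step S r (Output w) = Output w"

text \<open>
  The implicitly defined matrices \<open>X_t\<close> are not part of the configuration. They are
  carried along next to it and never influence it.
\<close>

definition fw_cov_step ::
  "('n::finite) fw_param \<Rightarrow> ('n source \<Rightarrow> real) \<Rightarrow> 'n config \<Rightarrow> real^'n^'n \<Rightarrow> real^'n^'n" where
  "fw_cov_step S r c X =
     (case (c, fw_step S r c) of
        (Power t z V k x, Start t' z' V') \<Rightarrow>
          (1 - fw_gamma t) *\<^sub>R X + fw_gamma t *\<^sub>R fw_H (fw_J S V) x
      | _ \<Rightarrow> X)"

definition fw_run ::
  "('n::finite) fw_param \<Rightarrow> ('n source \<Rightarrow> real) \<Rightarrow> nat \<Rightarrow> 'n config \<times> (real^'n^'n)" where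
  "fw_run S r k =
     ((\<lambda>(c, X). (fw_step S r c, fw_cov_step S r c X)) ^^ k)
       (Start 0 (\<chi> i. r (Init i)) (B_op (fw_cost S) (mat 1)), mat 1)"

definition fw_stops :: "('n::finite) fw_param \<Rightarrow> ('n source \<Rightarrow> real) \<Rightarrow> nat \<Rightarrow> real^'n^'n \<Rightarrow> bool" where
  "fw_stops S r t X \<longleftrightarrow> (\<exists>k z V. fw_run S r k = (Stop t z V, X))"

definition fw_output :: "('n::finite) fw_param \<Rightarrow> ('n source \<Rightarrow> real) \<Rightarrow> real^'n" where
  "fw_output S r = (THE w. \<exists>k X. fw_run S r k = (Output w, X))"

definition lmo_success :: "('n::finite) fw_param \<Rightarrow> ('n source \<Rightarrow> real) \<Rightarrow> bool" where
  "lmo_success S r \<longleftrightarrow>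
     (\<forall>k t z V w X. fw_run S r k = (Power t z V 0 w, X) \<longrightarrow>
        norm w = 1 \<and>
        real CARD('n) * (w \<bullet> (fw_J S V *v w))
          \<ge> real CARD('n) * lambda_max (fw_J S V) - lmo_error S t)"

text \<open>
  The number of matrix-vector multiplications performed in iteration \<open>t\<close> during the first
  \<open>k\<close> steps of the run. Every step out of a \<open>Power\<close> configuration performs one: either
  an iteration of the power method, or the final multiplication with \<open>w\<close> that yields the
  quadratic forms of \<open>J\<close> and \<open>C\<close>. No other step performs any.
\<close>

definition fw_matvecs ::
  "('n::finite) fw_param \<Rightarrow> ('n source \<Rightarrow> real) \<Rightarrow> nat \<Rightarrow> nat \<Rightarrow> nat" where
  "fw_matvecs S r t k =
     card {l. l < k \<and> (\<exists>z V j x X. fw_run S r l = (Power t z V j x, X))}"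

text \<open>
  Working memory counts the entries of the stored vectors. The fixed number of scalars
  (the counters and the first component of \<open>V\<close>) is not counted, just as the \<open>n\<close> numbers
  attributed to the power method do not include its norms and counters.
\<close>

fun stored_vectors :: "('n::finite) config \<Rightarrow> (real^'n) list" where
  "stored_vectors (Start t z V) = [z, snd V]"
| "stored_vectors (Power t z V k x) = [z, snd V, x]"
| "stored_vectors (Stop t z V) = [z, snd V]"
| "stored_vectors (Output w) = [w]"

definition working_memory :: "('n::finite) config \<Rightarrow> nat" where
  "working_memory c = (\<Sum>x\<leftarrow>stored_vectors c. CARD('n))"

end

theory Submission
  imports Defs
begin

text \<open>
  The second derivative of \<open>phi M\<close> along a segment is \<open>M\<close> times a variance under the Gibbs
  distribution on signed indices. Bounding it by \<open>n^2\<close> only gives the constant of the generic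
  Frank-Wolfe analysis, which does not reach the gap \<open>tol = 4 Cg / T\<close> within \<open>T\<close> iterations.
  Along a Frank-Wolfe step the variance is at most \<open>0.28 n^2 / (1 - s)^2\<close>, since a variable
  with mass \<open>n\<close> on one index has variance at most \<open>n^2 / 4\<close> and the contribution of the current
  point is controlled by an entropy bound. With this, \<open>h_t \<le> 2.56 Cg / (t + 1)\<close> for the primal
  error, and summing the decrease from about \<open>0.39 T\<close> to \<open>T\<close> contradicts gaps above \<open>tol\<close>.

  A call of the power method succeeds if its start has a component along a top eigenvector that is
  not too small, which fails with probability at most \<open>p\<close> by anti-concentration of a Gaussian;
  a start is independent of the earlier ones, so a union bound over \<open>T\<close> calls loses
  \<open>T p = \<epsilon>\<close>.

  Conditionally on the random starts, the rounded vector is the sign of a Gaussian vector with unit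
  variances, so Sheppard's formula and diagonal dominance give the factor \<open>alpha_GW\<close> against
  \<open>C \<bullet> X / max (diag X)\<close>. Near-optimality in the penalized problem bounds that ratio below by
  \<open>(1 - 2 \<epsilon>) opt\<close>; the failure event costs another factor \<open>1 - \<epsilon>\<close> because \<open>C\<close> is positive
  semidefinite.
\<close>

text \<open>The constant 2.56 is 2 * (1 + 0.28): with \<open>fw_eta = 1\<close> the error allowed to
  a call of LMO, \<open>Cg * fw_gamma t / 2\<close>, is as large as the generic curvature term, so
  only the second summand can be improved. If the decrease is summed from \<open>x * T\<close> on,
  the leading terms are \<open>Cg / T\<close> times \<open>3.12 / x - 0.56 - 8 * ln (1 / x)\<close>,
  smallest at \<open>x = 3.12 / 8 = 0.39\<close>, where the value lies between -0.1 and 0. This thin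
  margin dictates the numerical care below. A single index is settled by hand, since there the
  direction towards the zero matrix can have variance \<open>n^2\<close>.

  A stop in iteration \<open>t\<close> after a successful call bounds the primal error here only by
  \<open>tol + Cg / (t + 2)\<close>, which is why near-optimality stands in the theorem as a premise
  of the lower bound on the expectation.

  Conditioning on the starts is possible because \<open>z_t\<close> never influences the directions:
  the points \<open>V_t\<close>, the stopping time and the covariance are functions of the starts
  alone.\<close>

section \<open>Variances under the signed Gibbs distribution\<close>

text \<open>
  The covariance of \<open>\<plusminus> a_i\<close> and \<open>\<plusminus> b_i\<close> for a signed index \<open>(\<plusminus>, i)\<close> drawn with probability
  proportional to \<open>exp (\<plusminus> \<theta> i)\<close>.
\<close>

definition gibbs_cov :: "('n::finite \<Rightarrow> real) \<Rightarrow> ('n \<Rightarrow> real) \<Rightarrow> ('n \<Rightarrow> real) \<Rightarrow> real" where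
  "gibbs_cov \<theta> a b = (\<Sum>i\<in>UNIV. cosh (\<theta> i) * (a i * b i)) / (\<Sum>i\<in>UNIV. cosh (\<theta> i))
     - (\<Sum>i\<in>UNIV. sinh (\<theta> i) * a i) / (\<Sum>i\<in>UNIV. cosh (\<theta> i))
       * ((\<Sum>i\<in>UNIV. sinh (\<theta> i) * b i) / (\<Sum>i\<in>UNIV. cosh (\<theta> i)))"

lemma sum_cosh_pos: "0 < (\<Sum>i\<in>UNIV. cosh (\<theta> (i::'n::finite)) :: real)"
  by (intro sum_pos) auto

lemma gibbs_cov_commute: "gibbs_cov \<theta> a b = gibbs_cov \<theta> b a"
  by (simp add: gibbs_cov_def mult.commute)

lemma gibbs_cov_add: "gibbs_cov \<theta> (\<lambda>i. a i + b i) c = gibbs_cov \<theta> a c + gibbs_cov \<theta> b c"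
  unfolding gibbs_cov_def by (simp add: algebra_simps sum.distrib add_divide_distrib)

lemma gibbs_cov_scale: "gibbs_cov \<theta> (\<lambda>i. k * a i) c = k * gibbs_cov \<theta> a c"
proof -
  have "(\<Sum>i\<in>UNIV. cosh (\<theta> i) * (k * a i * c i)) = k * (\<Sum>i\<in>UNIV. cosh (\<theta> i) * (a i * c i))"
    "(\<Sum>i\<in>UNIV. sinh (\<theta> i) * (k * a i)) = k * (\<Sum>i\<in>UNIV. sinh (\<theta> i) * a i)"
    by (simp_all add: sum_distrib_left algebra_simps)
  then show ?thesis unfolding gibbs_cov_def by (simp add: algebra_simps)
qed

lemma gibbs_cov_sum:
  "finite K \<Longrightarrow> gibbs_cov \<theta> (\<lambda>i. \<Sum>k\<in>K. f k i) c = (\<Sum>k\<in>K. gibbs_cov \<theta> (f k) c)"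
proof (induction K rule: finite_induct)
  case empty
  then show ?case by (simp add: gibbs_cov_def)
next
  case (insert x F)
  then show ?case by (simp add: gibbs_cov_add)
qed

lemma gibbs_cov_add2: "gibbs_cov \<theta> c (\<lambda>i. a i + b i) = gibbs_cov \<theta> c a + gibbs_cov \<theta> c b"
  and gibbs_cov_scale2: "gibbs_cov \<theta> c (\<lambda>i. k * a i) = k * gibbs_cov \<theta> c a"
  by (simp_all add: gibbs_cov_commute[of _ c] gibbs_cov_add gibbs_cov_scale)

text \<open>Cauchy-Schwarz with weights \<open>cosh\<close>, after
  \<open>\<bar>sinh x\<bar> \<le> cosh x\<close>. It yields nonnegative variances without
  introducing the distribution as an object.\<close>

lemma sum_sinh_sq_le:
  fixes \<theta> a :: "'n::finite \<Rightarrow> real"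
  shows "(\<Sum>i\<in>UNIV. sinh (\<theta> i) * a i)\<^sup>2
     \<le> (\<Sum>i\<in>UNIV. cosh (\<theta> i)) * (\<Sum>i\<in>UNIV. cosh (\<theta> i) * (a i)\<^sup>2)"
proof -
  have "\<bar>\<Sum>i\<in>UNIV. sinh (\<theta> i) * a i\<bar> \<le> (\<Sum>i\<in>UNIV. sqrt (cosh (\<theta> i)) * (sqrt (cosh (\<theta> i)) * \<bar>a i\<bar>))"
  proof (rule order_trans[OF sum_abs sum_mono])
    fix i
    have "\<bar>sinh (\<theta> i)\<bar> \<le> cosh (\<theta> i)"
      using sinh_le_cosh_real[of "\<theta> i"] sinh_le_cosh_real[of "- \<theta> i"] by (simp add: abs_le_iff)
    then have "\<bar>sinh (\<theta> i)\<bar> * \<bar>a i\<bar> \<le> cosh (\<theta> i) * \<bar>a i\<bar>" by (intro mult_right_mono) auto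
    then show "\<bar>sinh (\<theta> i) * a i\<bar> \<le> sqrt (cosh (\<theta> i)) * (sqrt (cosh (\<theta> i)) * \<bar>a i\<bar>)"
      by (simp add: abs_mult flip: mult.assoc)
  qed
  then have "(\<Sum>i\<in>UNIV. sinh (\<theta> i) * a i)\<^sup>2 \<le> (\<Sum>i\<in>UNIV. sqrt (cosh (\<theta> i)) * (sqrt (cosh (\<theta> i)) * \<bar>a i\<bar>))\<^sup>2"
    by (metis abs_ge_zero power2_abs power_mono)
  also have "\<dots> \<le> (\<Sum>i\<in>UNIV. (sqrt (cosh (\<theta> i)))\<^sup>2) * (\<Sum>i\<in>UNIV. (sqrt (cosh (\<theta> i)) * \<bar>a i\<bar>)\<^sup>2)"
    by (rule Cauchy_Schwarz_ineq_sum)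
  finally show ?thesis by (simp add: power_mult_distrib)
qed

lemma gibbs_var_nonneg: "0 \<le> gibbs_cov \<theta> a a"
proof -
  have "((\<Sum>i\<in>UNIV. sinh (\<theta> i) * a i) / (\<Sum>i\<in>UNIV. cosh (\<theta> i)))\<^sup>2
     \<le> (\<Sum>i\<in>UNIV. cosh (\<theta> i) * (a i)\<^sup>2) / (\<Sum>i\<in>UNIV. cosh (\<theta> i))"
    using sum_sinh_sq_le[of \<theta> a] sum_cosh_pos[of \<theta>]
    by (simp add: power_divide power2_eq_square divide_simps mult_ac)
  then show ?thesis by (simp add: gibbs_cov_def power2_eq_square)
qed

lemma gibbs_var_le_sup:
  assumes "\<And>i. \<bar>a i\<bar> \<le> b"
  shows "gibbs_cov \<theta> a a \<le> b\<^sup>2"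
proof -
  have "(\<Sum>i\<in>UNIV. cosh (\<theta> i) * (a i * a i)) \<le> (\<Sum>i\<in>UNIV. cosh (\<theta> i) * b\<^sup>2)"
  proof (intro sum_mono mult_left_mono)
    fix i
    have "\<bar>a i\<bar> \<le> \<bar>b\<bar>" using assms[of i] by linarith
    then show "a i * a i \<le> b\<^sup>2" by (simp add: abs_le_square_iff power2_eq_square)
  qed auto
  then have "(\<Sum>i\<in>UNIV. cosh (\<theta> i) * (a i * a i)) / (\<Sum>i\<in>UNIV. cosh (\<theta> i)) \<le> b\<^sup>2"
    using sum_cosh_pos[of \<theta>] by (simp add: pos_divide_le_eq mult.commute[of "b\<^sup>2"] flip: sum_distrib_right)
  moreover have "0 \<le> (\<Sum>i\<in>UNIV. sinh (\<theta> i) * a i) / (\<Sum>i\<in>UNIV. cosh (\<theta> i)) * ((\<Sum>i\<in>UNIV. sinh (\<theta> i) * a i) / (\<Sum>i\<in>UNIV. cosh (\<theta> i)))"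
    by simp
  ultimately show ?thesis unfolding gibbs_cov_def by linarith
qed

text \<open>Young's inequality for variances: expand the nonnegative variance of
  \<open>\<tau> * a + b\<close> and divide by \<open>\<tau>\<close>. The free parameter allows a
  large variance to be combined with a tiny one at little cost.\<close>

lemma gibbs_var_diff_le:
  assumes "0 < \<tau>"
  shows "gibbs_cov \<theta> (\<lambda>i. a i - b i) (\<lambda>i. a i - b i) \<le> (1 + \<tau>) * gibbs_cov \<theta> a a + (1 + 1 / \<tau>) * gibbs_cov \<theta> b b"
proof -
  have "0 \<le> gibbs_cov \<theta> (\<lambda>i. \<tau> * a i + b i) (\<lambda>i. \<tau> * a i + b i) / \<tau>"
    using gibbs_var_nonneg[of \<theta> "\<lambda>i. \<tau> * a i + b i"] assms by (intro divide_nonneg_pos)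
  moreover have "gibbs_cov \<theta> (\<lambda>i. a i - b i) (\<lambda>i. a i - b i) = gibbs_cov \<theta> (\<lambda>i. a i + (-1) * b i) (\<lambda>i. a i + (-1) * b i)"
    by simp
  ultimately show ?thesis
    using assms by (simp only: gibbs_cov_add gibbs_cov_scale gibbs_cov_add2 gibbs_cov_scale2)
      (simp add: field_simps power2_eq_square gibbs_cov_commute[of \<theta> b a])
qed

text \<open>Jensen: the average variance of the deviations of the \<open>u k\<close> from their mean
  \<open>m\<close> is nonnegative, and its cross term collapses to the variance of
  \<open>m\<close>.\<close>

lemma gibbs_var_convex_comb:
  assumes "finite K" "\<And>k. k \<in> K \<Longrightarrow> 0 \<le> l k" "(\<Sum>k\<in>K. l k) = 1"
  shows "gibbs_cov \<theta> (\<lambda>i. \<Sum>k\<in>K. l k * u k i) (\<lambda>i. \<Sum>k\<in>K. l k * u k i) \<le> (\<Sum>k\<in>K. l k * gibbs_cov \<theta> (u k) (u k))"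
proof -
  define m where "m = (\<lambda>i. \<Sum>k\<in>K. l k * u k i)"
  have 1: "gibbs_cov \<theta> m c = (\<Sum>k\<in>K. l k * gibbs_cov \<theta> (u k) c)" for c
    unfolding m_def by (simp add: gibbs_cov_sum[OF assms(1)] gibbs_cov_scale)
  have 2: "gibbs_cov \<theta> (\<lambda>i. u k i + (-1) * m i) (\<lambda>i. u k i + (-1) * m i)
      = gibbs_cov \<theta> (u k) (u k) - 2 * gibbs_cov \<theta> (u k) m + gibbs_cov \<theta> m m" for k
    by (simp only: gibbs_cov_add gibbs_cov_scale gibbs_cov_add2 gibbs_cov_scale2) (simp add: gibbs_cov_commute[of \<theta> m "u k"])
  have "0 \<le> (\<Sum>k\<in>K. l k * gibbs_cov \<theta> (\<lambda>i. u k i + (-1) * m i) (\<lambda>i. u k i + (-1) * m i))"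
    using assms(2) gibbs_var_nonneg by (intro sum_nonneg mult_nonneg_nonneg) auto
  also have "\<dots> = (\<Sum>k\<in>K. l k * gibbs_cov \<theta> (u k) (u k)) - 2 * (\<Sum>k\<in>K. l k * gibbs_cov \<theta> (u k) m) + (\<Sum>k\<in>K. l k) * gibbs_cov \<theta> m m"
    unfolding 2 by (simp add: algebra_simps sum.distrib sum_subtractf sum_distrib_left sum_distrib_right)
  also have "\<dots> = (\<Sum>k\<in>K. l k * gibbs_cov \<theta> (u k) (u k)) - gibbs_cov \<theta> m m"
    using 1[of m] assms(3) by simp
  finally show ?thesis by (simp add: m_def)
qed

text \<open>Here \<open>C\<close> and \<open>s\<close> are \<open>cosh\<close> and
  \<open>sinh\<close> at the vertex, \<open>R\<close> and \<open>t\<close> the sums of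
  \<open>cosh\<close> and \<open>sinh\<close> over the other \<open>Q\<close> indices. The split
  asks whether \<open>t\<close> can be large enough to cancel the contribution \<open>s * Q\<close>
  to the mean. If so, the second moment alone is at most \<open>Q\<close>; if not, the mean is
  bounded away from 0 and its square has to be subtracted.\<close>

lemma gibbs_var_vertex_aux:
  fixes C s R t Q :: real
  assumes C: "1 \<le> C" "s\<^sup>2 = C\<^sup>2 - 1" and Q: "1 \<le> Q" and R: "Q \<le> R" "t\<^sup>2 \<le> R\<^sup>2 - Q\<^sup>2"
  shows "(C * Q\<^sup>2 + R) / (C + R) - ((s * Q - t) / (C + R))\<^sup>2 \<le> ((Q + 1) / 2)\<^sup>2"
proof (cases "Q * \<bar>s\<bar> \<le> sqrt (R\<^sup>2 - Q\<^sup>2)")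
  case True
  have "0 \<le> R\<^sup>2 - Q\<^sup>2" using R(2) zero_le_power2[of t] by linarith
  then have "(Q * \<bar>s\<bar>)\<^sup>2 \<le> R\<^sup>2 - Q\<^sup>2" using power_mono[OF True, of 2] Q by simp
  then have "(Q * C)\<^sup>2 \<le> R\<^sup>2" using C by (simp add: power_mult_distrib algebra_simps)
  then have QC: "Q * C \<le> R" by (rule power2_le_imp_le) (use Q R in auto)
  have "C * Q\<^sup>2 + R \<le> Q * (C + R)"
  proof -
    have "0 \<le> (Q - 1) * (R - Q * C)" using Q QC by simp
    then show ?thesis by (simp add: power2_eq_square algebra_simps)
  qed
  then have "(C * Q\<^sup>2 + R) / (C + R) \<le> Q" using C Q R by (simp add: divide_simps)
  also have "Q \<le> ((Q + 1) / 2)\<^sup>2"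
    using zero_le_power2[of "Q - 1"] by (simp add: power2_eq_square field_simps)
  finally show ?thesis by (smt (verit) zero_le_power2)
next
  case False
  define m where "m = sqrt (R\<^sup>2 - Q\<^sup>2)"
  have m0: "0 \<le> m" "m\<^sup>2 = R\<^sup>2 - Q\<^sup>2" using R Q by (auto simp: m_def)
  have mt: "\<bar>t\<bar> \<le> m" unfolding m_def using R by (metis real_sqrt_abs real_sqrt_le_iff)
  have ms: "m < Q * \<bar>s\<bar>" using False by (simp add: m_def)
  have "Q * \<bar>s\<bar> - m \<le> \<bar>s * Q - t\<bar>"
  proof -
    have "Q * \<bar>s\<bar> = \<bar>s * Q\<bar>" using Q by (simp add: abs_mult)
    then show ?thesis using mt by linarith
  qed
  then have 1: "(Q * \<bar>s\<bar> - m)\<^sup>2 \<le> (s * Q - t)\<^sup>2" using ms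
    by (metis abs_ge_zero diff_ge_0_iff_ge less_imp_le power2_abs power_mono)
  have 2: "\<bar>s\<bar> * m \<le> C * R - Q"
  proof (rule power2_le_imp_le)
    have "(C * R - Q)\<^sup>2 - (\<bar>s\<bar> * m)\<^sup>2 = (R - Q * C)\<^sup>2"
      by (simp add: power_mult_distrib m0 C) (simp add: power2_eq_square algebra_simps)
    then show "(\<bar>s\<bar> * m)\<^sup>2 \<le> (C * R - Q)\<^sup>2" by (smt (verit) zero_le_power2)
    show "0 \<le> C * R - Q" using C Q R by (smt (verit) mult_le_cancel_right1)
  qed
  \<comment> \<open>With the mixed term bounded by \<open>2\<close>, everything factors through
    \<open>C * R\<close>, and the inequality of arithmetic and geometric means finishes.\<close>
  have "(C * Q\<^sup>2 + R) * (C + R) - (Q * \<bar>s\<bar> - m)\<^sup>2 = 2 * Q\<^sup>2 + C * R * (Q\<^sup>2 + 1) + 2 * Q * (\<bar>s\<bar> * m)"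
    using m0 C by (simp add: power2_diff power_mult_distrib) (simp add: power2_eq_square algebra_simps)
  also have "\<dots> \<le> 2 * Q\<^sup>2 + C * R * (Q\<^sup>2 + 1) + 2 * Q * (C * R - Q)"
    using 2 Q by (intro add_left_mono mult_left_mono) auto
  also have "\<dots> = (Q + 1)\<^sup>2 * (C * R)" by (simp add: power2_eq_square algebra_simps)
  also have "\<dots> \<le> (Q + 1)\<^sup>2 * ((C + R)\<^sup>2 / 4)"
  proof (rule mult_left_mono[OF _ zero_le_power2])
    show "C * R \<le> (C + R)\<^sup>2 / 4"
      using zero_le_power2[of "C - R"] by (simp add: power2_eq_square algebra_simps)
  qed
  finally have "(C * Q\<^sup>2 + R) * (C + R) - (s * Q - t)\<^sup>2 \<le> ((Q + 1) / 2)\<^sup>2 * (C + R)\<^sup>2"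
    using 1 by (simp add: power_divide)
  moreover have "(C * Q\<^sup>2 + R) / (C + R) - ((s * Q - t) / (C + R))\<^sup>2
     = ((C * Q\<^sup>2 + R) * (C + R) - (s * Q - t)\<^sup>2) / (C + R)\<^sup>2"
  proof -
    have "C + R \<noteq> 0" using C Q R by simp
    then show ?thesis by (simp only: power_divide power2_eq_square[of "C + R"]) (simp add: diff_divide_distrib)
  qed
  moreover have "0 < (C + R)\<^sup>2" using C Q R by simp
  ultimately show ?thesis by (simp only: pos_divide_le_eq)
qed

lemma gibbs_var_vertex:
  fixes \<theta> :: "'n::finite \<Rightarrow> real" and k :: 'n
  assumes "2 \<le> CARD('n)"
  defines "u \<equiv> (\<lambda>i. (if i = k then real CARD('n) else 0) - 1)"
  shows "gibbs_cov \<theta> u u \<le> (real CARD('n))\<^sup>2 / 4"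
proof -
  let ?A = "UNIV - {k}"
  define Q where "Q = real CARD('n) - 1"
  define R where "R = (\<Sum>i\<in>?A. cosh (\<theta> i))"
  define t where "t = (\<Sum>i\<in>?A. sinh (\<theta> i))"
  have cA: "real (card ?A) = Q" using assms by (simp add: Q_def of_nat_diff)
  have sumk: "(\<Sum>i\<in>UNIV. f i) = f k + (\<Sum>i\<in>?A. f i)" for f :: "'n \<Rightarrow> real"
    by (simp add: sum.remove)
  have a: "(\<Sum>i\<in>UNIV. cosh (\<theta> i) * (u i * u i)) = cosh (\<theta> k) * Q\<^sup>2 + R"
    by (simp add: sumk u_def Q_def R_def power2_eq_square)
  have b: "(\<Sum>i\<in>UNIV. cosh (\<theta> i)) = cosh (\<theta> k) + R" by (simp add: sumk R_def)
  have c: "(\<Sum>i\<in>UNIV. sinh (\<theta> i) * u i) = sinh (\<theta> k) * Q - t"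
    by (simp add: sumk u_def Q_def t_def sum_negf)
  have "Q \<le> R"
    using sum_mono[of ?A "\<lambda>_. 1" "\<lambda>i. cosh (\<theta> i)"] cosh_real_ge_1 cA by (auto simp: R_def)
  \<comment> \<open>Cauchy-Schwarz for \<open>exp (\<theta> i / 2)\<close> and
    \<open>exp (- \<theta> i / 2)\<close>: the products are 1 and the sums of squares are
    \<open>R + t\<close> and \<open>R - t\<close>.\<close>
  moreover have "t\<^sup>2 \<le> R\<^sup>2 - Q\<^sup>2"
  proof -
    have "Q\<^sup>2 = (\<Sum>i\<in>?A. exp (\<theta> i / 2) * exp (- \<theta> i / 2))\<^sup>2"
      using assms(1) by (simp add: Q_def of_nat_diff flip: exp_add)
    also have "\<dots> \<le> (\<Sum>i\<in>?A. (exp (\<theta> i / 2))\<^sup>2) * (\<Sum>i\<in>?A. (exp (- \<theta> i / 2))\<^sup>2)"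
      by (rule Cauchy_Schwarz_ineq_sum)
    also have "(\<Sum>i\<in>?A. (exp (\<theta> i / 2))\<^sup>2) = R + t"
      by (simp add: R_def t_def cosh_plus_sinh exp_double[symmetric] flip: sum.distrib)
    also have "(\<Sum>i\<in>?A. (exp (- \<theta> i / 2))\<^sup>2) = R - t"
      by (simp add: R_def t_def cosh_minus_sinh exp_double[symmetric] flip: sum_subtractf)
    finally show ?thesis by (simp add: power2_eq_square algebra_simps)
  qed
  moreover have "(sinh (\<theta> k))\<^sup>2 = (cosh (\<theta> k))\<^sup>2 - 1" by (simp add: cosh_square_eq)
  moreover have "1 \<le> Q" using assms by (simp add: Q_def)
  ultimately have "(cosh (\<theta> k) * Q\<^sup>2 + R) / (cosh (\<theta> k) + R) - ((sinh (\<theta> k) * Q - t) / (cosh (\<theta> k) + R))\<^sup>2 \<le> ((Q + 1) / 2)\<^sup>2"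
    by (intro gibbs_var_vertex_aux) (auto simp: cosh_real_ge_1)
  then show ?thesis
    unfolding gibbs_cov_def a b c by (simp add: power2_eq_square Q_def)
qed

text \<open>The variance is convex in \<open>q\<close>, so its maximum over the simplex is attained at a vertex.\<close>

lemma gibbs_var_simplex:
  fixes q :: "'n::finite \<Rightarrow> real"
  assumes n: "2 \<le> CARD('n)" and q: "\<And>i. 0 \<le> q i" "(\<Sum>i\<in>UNIV. q i) = real CARD('n) \<or> (\<forall>i. q i = 0)"
  shows "gibbs_cov \<theta> (\<lambda>i. q i - 1) (\<lambda>i. q i - 1) \<le> (real CARD('n))\<^sup>2 / 4"
proof (cases "\<forall>i. q i = 0")
  case True
  have "gibbs_cov \<theta> (\<lambda>i. q i - 1) (\<lambda>i. q i - 1) \<le> 1\<^sup>2" by (rule gibbs_var_le_sup) (simp add: True)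
  also have "\<dots> \<le> (real CARD('n))\<^sup>2 / 4" using n power_mono[of 2 "real CARD('n)" 2] by simp
  finally show ?thesis .
next
  case False
  define N where "N = real CARD('n)"
  have N: "N > 0" by (simp add: N_def)
  define u where "u = (\<lambda>k (i::'n). (if i = k then N else 0) - (1::real))"
  have s: "(\<Sum>i\<in>UNIV. q i / N) = 1"
    using False q(2) N by (auto simp: N_def simp flip: sum_divide_distrib)
  have 1: "(\<lambda>i. q i - 1) = (\<lambda>i. \<Sum>k\<in>UNIV. q k / N * u k i)"
  proof
    fix i
    have "q k / N * u k i = (if i = k then q k else 0) - q k / N" for k
      using N by (simp add: u_def field_simps)
    then have "(\<Sum>k\<in>UNIV. q k / N * u k i) = (\<Sum>k\<in>UNIV. (if i = k then q k else 0)) - (\<Sum>k\<in>UNIV. q k / N)"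
      by (simp add: sum_subtractf)
    then show "q i - 1 = (\<Sum>k\<in>UNIV. q k / N * u k i)" using s by simp
  qed
  have "gibbs_cov \<theta> (\<lambda>i. q i - 1) (\<lambda>i. q i - 1) \<le> (\<Sum>k\<in>UNIV. q k / N * gibbs_cov \<theta> (u k) (u k))"
    unfolding 1 by (rule gibbs_var_convex_comb) (use q N s in auto)
  also have "\<dots> \<le> (\<Sum>k\<in>UNIV. q k / N * (N\<^sup>2 / 4))"
  proof (intro sum_mono mult_left_mono)
    show "gibbs_cov \<theta> (u k) (u k) \<le> N\<^sup>2 / 4" for k
      using gibbs_var_vertex[OF n, of \<theta> k] unfolding u_def N_def .
  qed (use q N in auto)
  also have "\<dots> = N\<^sup>2 / 4" using s by (simp only: sum_distrib_right[symmetric])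
  finally show ?thesis by (simp add: N_def)
qed

text \<open>In terms of \<open>z = w - L\<close> the claim is
  \<open>z^2 \<le> 2 * L * (exp z - 1 - z) + L^2 / 10\<close>. For \<open>z \<ge> 0\<close> Taylor's
  formula suffices; the loss of ten percent pays for \<open>- L \<le> z < 0\<close>. The bound 1.79
  on \<open>L\<close> is just below \<open>ln 6\<close>, the value for three indices.\<close>

lemma exp_shift_tangent:
  fixes w L :: real
  assumes w: "0 \<le> w" and L: "179 / 100 \<le> L"
  shows "w\<^sup>2 \<le> 11 / 10 * L\<^sup>2 + 2 * L * (exp (w - L) - 1)"
proof -
  define z where "z = w - L"
  have "z\<^sup>2 \<le> 2 * L * (exp z - 1 - z) + L\<^sup>2 / 10"
  proof (cases "0 \<le> z")
    case True
    define B where "B = exp z - 1 - z"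
    have "z\<^sup>2 \<le> 2 * B" using exp_lower_Taylor_quadratic[OF True] by (simp add: B_def)
    moreover have "1 * B \<le> L * B" using L exp_ge_add_one_self[of z] unfolding B_def by (intro mult_right_mono) linarith+
    moreover have "0 \<le> L\<^sup>2" by simp
    ultimately show ?thesis unfolding B_def[symmetric] mult.assoc by linarith
  next
    case False
    define a where "a = - z"
    have a: "0 < a" "a \<le> L" using False w by (auto simp: a_def z_def)
    have "a\<^sup>2 \<le> 2 * L * (exp (- a) - 1 + a) + L\<^sup>2 / 10"
    proof (cases "a \<le> 3")
      case True
      have "(1 - a / 3) ^ 3 \<le> exp (- a / 3) ^ 3"
        using exp_ge_add_one_self[of "- a / 3"] True by (intro power_mono) auto
      also have "exp (- a / 3) ^ 3 = exp (- a)" by (simp flip: exp_of_nat_mult)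
      finally have e: "a\<^sup>2 * (1 / 3 - a / 27) \<le> exp (- a) - 1 + a"
        by (simp add: power2_eq_square power3_eq_cube field_simps)
      have b0: "0 \<le> a\<^sup>2 * (1 / 3 - a / 27)" using True by simp
      \<comment> \<open>The right-hand side grows with \<open>L\<close>, so it is enough to treat
        the smallest admissible value \<open>K\<close> of \<open>L\<close>.\<close>
      define K where "K = max a (179 / 100)"
      have K: "K \<le> L" "0 < K" using a L by (auto simp: K_def)
      have "a\<^sup>2 \<le> 2 * K * (a\<^sup>2 * (1 / 3 - a / 27)) + K\<^sup>2 / 10"
      proof (cases "a \<le> 179 / 100")
        case True
        have "0 \<le> (179 / 50 * (1 / 3 - a / 27) - 1) * a\<^sup>2 + (179 / 100)\<^sup>2 / 10"
        proof -
          have "179 / 50 * (1 / 3 - (179/100) / 27) - 1 \<le> 179 / 50 * (1 / 3 - a / 27) - 1"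
            using True by (simp add: field_simps)
          then have "(- (5 / 100)) * a\<^sup>2 \<le> (179 / 50 * (1 / 3 - a / 27) - 1) * a\<^sup>2"
            by (intro mult_right_mono) auto
          moreover have "a\<^sup>2 \<le> (179 / 100)\<^sup>2" using True a by (intro power_mono) auto
          ultimately show ?thesis by (simp add: power2_eq_square)
        qed
        then show ?thesis using True
          by (simp add: K_def max_def algebra_simps add_divide_distrib diff_divide_distrib)
      next
        case False
        have "0 \<le> 2 * a / 3 - 2 * a\<^sup>2 / 27 - 9 / 10"
        proof -
          have "0 \<le> (a - 179 / 100) * (3 - a)" using False True by simp
          then have "a\<^sup>2 \<le> 479 / 100 * a - 537 / 100"
            by (simp add: power2_eq_square algebra_simps diff_divide_distrib)
          then show ?thesis using False by simp
        qed
        then have "0 \<le> a\<^sup>2 * (2 * a / 3 - 2 * a\<^sup>2 / 27 - 9 / 10)" by simp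
        then show ?thesis using False by (simp add: K_def max_def power2_eq_square algebra_simps)
      qed
      also have "\<dots> \<le> 2 * L * (exp (- a) - 1 + a) + L\<^sup>2 / 10"
      proof (rule add_mono)
        show "2 * K * (a\<^sup>2 * (1 / 3 - a / 27)) \<le> 2 * L * (exp (- a) - 1 + a)"
          using mult_mono[of "2 * K" "2 * L", OF _ e _ b0] K by simp
        show "K\<^sup>2 / 10 \<le> L\<^sup>2 / 10" using power_mono[of K L 2] K by simp
      qed
      finally show ?thesis .
    next
      case False
      have "a\<^sup>2 \<le> 2 * a * (a - 1)" using False by (simp add: power2_eq_square algebra_simps)
      also have "\<dots> \<le> 2 * L * (exp (- a) - 1 + a)"
        using mult_mono[of "2 * a" "2 * L" "a - 1" "exp (- a) - 1 + a"] a False by simp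
      finally show ?thesis by (rule order_trans) simp
    qed
    then show ?thesis by (simp add: a_def algebra_simps)
  qed
  then show ?thesis by (simp add: z_def power2_eq_square algebra_simps)
qed

text \<open>\<open>\<theta>\<close> is the logarithm of the Gibbs weights up to a constant, and \<open>exp_shift_tangent\<close> is a tangent bound
  for \<open>w^2\<close> at \<open>L\<close>; its expectation is exact because \<open>w = - ln (weight)\<close> averages \<open>exp w\<close> to the number of signed indices.\<close>

lemma gibbs_var_entropy:
  fixes \<theta> :: "'n::finite \<Rightarrow> real"
  assumes L: "179 / 100 \<le> ln (2 * real CARD('n))"
  shows "gibbs_cov \<theta> \<theta> \<theta> \<le> 11 / 10 * (ln (2 * real CARD('n)))\<^sup>2"
proof -
  define S where "S = (\<Sum>i\<in>UNIV. cosh (\<theta> i))"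
  define l where "l = ln (2 * S)"
  define K where "K = ln (2 * real CARD('n))"
  define m where "m = (\<Sum>i\<in>UNIV. sinh (\<theta> i) * \<theta> i) / S"
  have S: "0 < S" unfolding S_def by (rule sum_cosh_pos)
  have el: "exp l = 2 * S" using S by (simp add: l_def)
  have eK: "exp K = 2 * real CARD('n)" by (simp add: K_def)
  have le: "\<bar>\<theta> i\<bar> \<le> l" for i
  proof -
    have "exp \<bar>\<theta> i\<bar> \<le> 2 * cosh (\<theta> i)" by (simp add: cosh_field_def abs_if)
    also have "\<dots> \<le> 2 * S" unfolding S_def using member_le_sum[of i UNIV "\<lambda>i. cosh (\<theta> i)"] by simp
    finally have "exp \<bar>\<theta> i\<bar> \<le> exp l" by (simp add: el)
    then show ?thesis by simp
  qed
  \<comment> \<open>The tangent bound times the Gibbs weight \<open>exp (t - l)\<close>: in the last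
    term the weight cancels and a constant is left.\<close>
  have key: "exp (t - l) * (l - t)\<^sup>2 \<le> exp (t - l) * (11 / 10 * K\<^sup>2 - 2 * K) + 2 * K * exp (- K)"
    if "t \<le> l" for t
  proof -
    have "exp (t - l) * (l - t)\<^sup>2 \<le> exp (t - l) * (11 / 10 * K\<^sup>2 + 2 * K * (exp (l - t - K) - 1))"
      using exp_shift_tangent[of "l - t" K] that L by (intro mult_left_mono) (auto simp: K_def)
    also have "\<dots> = exp (t - l) * (11 / 10 * K\<^sup>2 - 2 * K) + 2 * K * (exp (t - l) * exp (l - t - K))"
      by (simp add: algebra_simps)
    also have "exp (t - l) * exp (l - t - K) = exp (- K)" by (simp flip: exp_add)
    finally show ?thesis .
  qed
  have e1: "exp (t - l) + exp (- t - l) = cosh t / S" for t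
    using S by (simp add: exp_diff el cosh_field_def exp_minus field_simps)
  have e2: "exp (t - l) - exp (- t - l) = sinh t / S" for t
    using S by (simp add: exp_diff el sinh_field_def exp_minus field_simps)
  have pt: "cosh t * t\<^sup>2 / S - 2 * l * (sinh t * t / S) + l\<^sup>2 * (cosh t / S)
      \<le> (cosh t / S) * (11 / 10 * K\<^sup>2 - 2 * K) + 4 * K * exp (- K)" if "\<bar>t\<bar> \<le> l" for t
  proof -
    have "exp (t - l) * (l - t)\<^sup>2 + exp (- t - l) * (l + t)\<^sup>2
       = (exp (t - l) + exp (- t - l)) * t\<^sup>2 - 2 * l * ((exp (t - l) - exp (- t - l)) * t) + l\<^sup>2 * (exp (t - l) + exp (- t - l))"
      by (simp add: power2_eq_square algebra_simps)
    also have "\<dots> = cosh t * t\<^sup>2 / S - 2 * l * (sinh t * t / S) + l\<^sup>2 * (cosh t / S)"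
      unfolding e1 e2 by simp
    finally have 1: "\<dots> = exp (t - l) * (l - t)\<^sup>2 + exp (- t - l) * (l + t)\<^sup>2" by simp
    have "\<dots> \<le> (exp (t - l) + exp (- t - l)) * (11 / 10 * K\<^sup>2 - 2 * K) + 4 * K * exp (- K)"
    proof -
      have "t \<le> l" "- t \<le> l" using that by auto
      from add_mono[OF key[OF this(1)] key[OF this(2)]] show ?thesis
        by (simp add: ring_distribs add_divide_distrib)
    qed
    then show ?thesis unfolding 1 e1 .
  qed
  have sumc: "(\<Sum>i\<in>UNIV. cosh (\<theta> i) / S) = 1" using S by (simp add: S_def flip: sum_divide_distrib)
  have "(\<Sum>i\<in>UNIV. cosh (\<theta> i) * (\<theta> i)\<^sup>2 / S - 2 * l * (sinh (\<theta> i) * \<theta> i / S) + l\<^sup>2 * (cosh (\<theta> i) / S))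
     \<le> (\<Sum>i\<in>UNIV. (cosh (\<theta> i) / S) * (11 / 10 * K\<^sup>2 - 2 * K) + 4 * K * exp (- K))"
    using le pt by (intro sum_mono) auto
  also have "\<dots> = (11 / 10 * K\<^sup>2 - 2 * K) + real CARD('n) * (4 * K * exp (- K))"
    using sumc by (simp add: sum.distrib sum_distrib_right[symmetric] del: times_divide_eq_left)
  \<comment> \<open>Since \<open>exp (- K)\<close> is the reciprocal of the number of signed
    indices, both terms linear in \<open>K\<close> cancel.\<close>
  also have "\<dots> = 11 / 10 * K\<^sup>2" by (simp add: exp_minus eK field_simps)
  finally have 2: "(\<Sum>i\<in>UNIV. cosh (\<theta> i) * (\<theta> i)\<^sup>2 / S - 2 * l * (sinh (\<theta> i) * \<theta> i / S) + l\<^sup>2 * (cosh (\<theta> i) / S))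
     \<le> 11 / 10 * K\<^sup>2" .
  have 3: "(\<Sum>i\<in>UNIV. cosh (\<theta> i) * (\<theta> i)\<^sup>2 / S - 2 * l * (sinh (\<theta> i) * \<theta> i / S) + l\<^sup>2 * (cosh (\<theta> i) / S))
     = (\<Sum>i\<in>UNIV. cosh (\<theta> i) * (\<theta> i)\<^sup>2) / S - 2 * l * m + l\<^sup>2"
    using sumc by (simp add: m_def sum.distrib sum_subtractf sum_divide_distrib sum_distrib_left[symmetric] del: times_divide_eq_right)
  have 4: "gibbs_cov \<theta> \<theta> \<theta> = (\<Sum>i\<in>UNIV. cosh (\<theta> i) * (\<theta> i)\<^sup>2) / S - m\<^sup>2"
    by (simp add: gibbs_cov_def S_def m_def power2_eq_square)
  \<comment> \<open>The sum just bounded is the second moment about \<open>l\<close>; the variance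
    is the second moment about the mean \<open>m\<close>, hence no larger.\<close>
  have "0 \<le> (m - l)\<^sup>2" by simp
  then show ?thesis using 2 unfolding 3 4 K_def by (simp add: power2_eq_square algebra_simps)
qed

text \<open>\<open>cosh^2\<close> is replaced by the start \<open>1 + z + z^2 / 3\<close> of its
  series in \<open>z = x^2\<close>. The quotient \<open>z / (1 + z + z^2 / 3)\<close> peaks at
  \<open>z = sqrt 3\<close>, with a value just below 0.465.\<close>

lemma sq_le_cosh_sq: "x\<^sup>2 \<le> 465 / 1000 * (cosh x)\<^sup>2" for x :: real
proof -
  define z where "z = x\<^sup>2"
  have "1 + z + z\<^sup>2 / 3 \<le> (cosh x)\<^sup>2"
  proof -
    have s: "1 + (2*x)\<^sup>2 / 2 + (2*x)^4 / 24 \<le> cosh (2 * x)"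
    proof -
      have "(\<lambda>n. if even n then (2*x) ^ n /\<^sub>R fact n else 0) sums cosh (2 * x)"
        by (rule cosh_converges)
      then have "(\<Sum>n\<in>{0,1,2,3,4}. if even n then (2*x) ^ n /\<^sub>R fact n else 0) \<le> cosh (2 * x)"
        using sum_le_suminf[of "\<lambda>n. if even n then (2*x) ^ n /\<^sub>R fact n else 0" "{0,1,2,3,4}"]
        by (auto simp: sums_iff zero_le_even_power)
      moreover have "fact 2 = (2::real)" "fact 4 = (24::real)" by (simp_all add: fact_numeral)
      moreover have "(\<Sum>n\<in>{0,1,2,3,4}. if even n then (2*x) ^ n /\<^sub>R fact n else 0)
          = 1 + (2*x) ^ 2 /\<^sub>R fact 2 + (2*x) ^ 4 /\<^sub>R fact 4" by simp
      ultimately show ?thesis by (simp only: real_scaleR_def divide_inverse mult.commute)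
    qed
    have "cosh (2 * x) = 2 * (cosh x)\<^sup>2 - 1" by (simp add: cosh_double_cosh)
    then show ?thesis using s by (simp add: z_def power_mult_distrib field_simps)
  qed
  moreover have "z \<le> 465 / 1000 * (1 + z + z\<^sup>2 / 3)"
  proof -
    \<comment> \<open>The vertex of the remaining quadratic in \<open>z\<close> is close to
      1.726.\<close>
    have "0 \<le> (z - 1726 / 1000)\<^sup>2" by simp
    moreover have "0 \<le> z" by (simp add: z_def)
    ultimately show ?thesis by (simp add: power2_eq_square algebra_simps)
  qed
  ultimately show ?thesis by (simp add: z_def)
qed

text \<open>For two indices \<open>ln 4\<close> is too small for \<open>gibbs_var_entropy\<close>.
  The four values \<open>\<plusminus> (x + y)\<close>, \<open>\<plusminus> (x - y)\<close> are
  \<open>x\<close> and \<open>y\<close> with independent random signs, because the Gibbs weights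
  factor; so the variance is a sum of two terms \<open>z^2 / (cosh z)^2\<close>.\<close>

lemma gibbs_var_two:
  fixes \<theta> :: "'n::finite \<Rightarrow> real"
  assumes "CARD('n) = 2"
  shows "gibbs_cov \<theta> \<theta> \<theta> \<le> 93 / 100"
proof -
  obtain i j where ij: "(UNIV::'n set) = {i, j}" "i \<noteq> j" using assms by (auto simp: card_2_iff)
  define x y where "x = (\<theta> i + \<theta> j) / 2" and "y = (\<theta> i - \<theta> j) / 2"
  have t: "\<theta> i = x + y" "\<theta> j = x - y" by (simp_all add: x_def y_def field_simps)
  have c: "0 < cosh x" "0 < cosh y" by simp_all
  have "gibbs_cov \<theta> \<theta> \<theta> = x\<^sup>2 * (1 - (sinh x / cosh x)\<^sup>2) + y\<^sup>2 * (1 - (sinh y / cosh y)\<^sup>2)"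
  proof -
    have 1: "(\<Sum>k\<in>UNIV. cosh (\<theta> k)) = 2 * (cosh x * cosh y)"
      using ij(2) by (simp add: ij(1) t cosh_add cosh_diff)
    have 2: "(\<Sum>k\<in>UNIV. cosh (\<theta> k) * (\<theta> k * \<theta> k)) = 2 * (cosh x * cosh y) * (x\<^sup>2 + y\<^sup>2) + 4 * x * y * (sinh x * sinh y)"
      using ij(2) by (simp add: ij(1) t cosh_add cosh_diff power2_eq_square algebra_simps)
    have 3: "(\<Sum>k\<in>UNIV. sinh (\<theta> k) * \<theta> k) = 2 * (sinh x * cosh y * x + cosh x * sinh y * y)"
      using ij(2) by (simp add: ij(1) t sinh_add sinh_diff algebra_simps)
    have e2: "(2 * (cosh x * cosh y) * (x\<^sup>2 + y\<^sup>2) + 4 * x * y * (sinh x * sinh y)) / (2 * (cosh x * cosh y))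
        = x\<^sup>2 + y\<^sup>2 + 2 * x * y * (sinh x / cosh x) * (sinh y / cosh y)"
      using c by (simp add: add_divide_distrib)
    have e3: "2 * (sinh x * cosh y * x + cosh x * sinh y * y) / (2 * (cosh x * cosh y))
        = x * (sinh x / cosh x) + y * (sinh y / cosh y)"
      using c by (simp add: add_divide_distrib mult.commute)
    show ?thesis unfolding gibbs_cov_def 1 2 3 e2 e3 by (simp add: power2_eq_square algebra_simps)
  qed
  also have "\<dots> \<le> 465 / 1000 + 465 / 1000"
  proof (rule add_mono)
    have "z\<^sup>2 * (1 - (sinh z / cosh z)\<^sup>2) \<le> 465 / 1000" for z :: real
    proof -
      have "1 - (sinh z / cosh z)\<^sup>2 = 1 / (cosh z)\<^sup>2"
        by (simp add: power_divide sinh_square_eq diff_divide_distrib)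
      then show ?thesis using sq_le_cosh_sq[of z] by (simp add: pos_divide_le_eq)
    qed
    then show "x\<^sup>2 * (1 - (sinh x / cosh x)\<^sup>2) \<le> 465 / 1000" "y\<^sup>2 * (1 - (sinh y / cosh y)\<^sup>2) \<le> 465 / 1000"
      by blast+
  qed
  finally show ?thesis by simp
qed

lemma ln2_lower: "693 / 1000 \<le> ln (2::real)"
  using ln_approx_bounds[of 2 3] by (simp add: eval_nat_numeral)

lemma ln6_lower: "179 / 100 \<le> ln (6::real)"
proof -
  have "1098 / 1000 \<le> ln (3::real)"
    using ln_approx_bounds[of 3 6] by (simp add: eval_nat_numeral)
  moreover have "ln (6::real) = ln 2 + ln 3" using ln_mult_pos[of 2 "3::real"] by simp
  ultimately show ?thesis using ln2_lower by linarith
qed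

text \<open>The target part \<open>q - 1\<close> has variance at most \<open>n^2 / 4\<close>. The
  current part is \<open>v = \<theta> / M\<close>, whose variance is divided by \<open>M^2\<close>:
  the entropy bound leaves \<open>11 / 1440\<close>, at most \<open>0.000849 * n^2\<close> for
  \<open>n \<ge> 3\<close>, and \<open>gibbs_var_two\<close> gives the same for
  \<open>n = 2\<close>. Young's inequality with parameter 0.06 combines them to just under
  0.28.\<close>

lemma gibbs_var_direction:
  fixes v q :: "'n::finite \<Rightarrow> real"
  assumes n: "2 \<le> CARD('n)" and M: "12 * ln (2 * real CARD('n)) \<le> M"
    and q: "\<And>i. 0 \<le> q i" "(\<Sum>i\<in>UNIV. q i) = real CARD('n) \<or> (\<forall>i. q i = 0)"
  shows "gibbs_cov (\<lambda>i. M * v i) (\<lambda>i. q i - 1 - v i) (\<lambda>i. q i - 1 - v i) \<le> 28 / 100 * (real CARD('n))\<^sup>2"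
proof -
  let ?n = "real CARD('n)"
  let ?\<theta> = "\<lambda>i. M * v i"
  have l4: "ln 4 = 2 * ln (2::real)" using ln_realpow[of 2 2] by simp
  have "ln 4 \<le> ln (2 * ?n)" using n by (subst ln_le_cancel_iff) auto
  then have M0: "16632 / 1000 \<le> M" using M ln2_lower l4 by linarith
  have W: "gibbs_cov ?\<theta> ?\<theta> ?\<theta> = M\<^sup>2 * gibbs_cov ?\<theta> v v"
    by (simp only: gibbs_cov_scale gibbs_cov_scale2) (simp add: power2_eq_square)
  have "gibbs_cov ?\<theta> ?\<theta> ?\<theta> \<le> M\<^sup>2 * (849 / 1000000 * ?n\<^sup>2)"
  proof (cases "CARD('n) = 2")
    case True
    have "(16632 / 1000)\<^sup>2 \<le> M\<^sup>2" using M0 by (intro power_mono) auto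
    then show ?thesis using gibbs_var_two[OF True, of ?\<theta>] True by (simp add: power2_eq_square)
  next
    case False
    then have n3: "3 \<le> CARD('n)" using n by simp
    have "ln 6 \<le> ln (2 * ?n)" using n3 by (subst ln_le_cancel_iff) auto
    then have l: "179 / 100 \<le> ln (2 * ?n)" using ln6_lower by linarith
    have "(12 * ln (2 * ?n))\<^sup>2 \<le> M\<^sup>2" using M l by (intro power_mono) linarith+
    then have "11 / 10 * (ln (2 * ?n))\<^sup>2 \<le> 11 / 1440 * M\<^sup>2" by (simp add: power_mult_distrib)
    also have "\<dots> \<le> M\<^sup>2 * (849 / 1000000 * ?n\<^sup>2)"
    proof -
      have "M\<^sup>2 * 9 \<le> M\<^sup>2 * ?n\<^sup>2" using power_mono[of 3 ?n 2] n3 by (intro mult_left_mono) auto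
      moreover have "M\<^sup>2 * (849 / 1000000 * ?n\<^sup>2) = 849 / 1000000 * (M\<^sup>2 * ?n\<^sup>2)" by simp
      ultimately show ?thesis using zero_le_power2[of M] by linarith
    qed
    finally show ?thesis using gibbs_var_entropy[OF l, of ?\<theta>] by linarith
  qed
  then have 1: "gibbs_cov ?\<theta> v v \<le> 849 / 1000000 * ?n\<^sup>2"
    using W M0 by simp
  have "gibbs_cov ?\<theta> (\<lambda>i. (q i - 1) - v i) (\<lambda>i. (q i - 1) - v i)
     \<le> (1 + 6 / 100) * gibbs_cov ?\<theta> (\<lambda>i. q i - 1) (\<lambda>i. q i - 1) + (1 + 1 / (6 / 100)) * gibbs_cov ?\<theta> v v"
    by (rule gibbs_var_diff_le) simp
  also have "\<dots> \<le> (1 + 6 / 100) * (?n\<^sup>2 / 4) + (1 + 1 / (6 / 100)) * (849 / 1000000 * ?n\<^sup>2)"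
    using gibbs_var_simplex[OF n q, of ?\<theta>] 1 by (intro add_mono mult_left_mono) auto
  also have "\<dots> \<le> 28 / 100 * ?n\<^sup>2" by simp
  finally show ?thesis by simp
qed

section \<open>Spectral theory of symmetric matrices\<close>

lemma inner_matrix_def: "(A::real^'n^'m) \<bullet> B = (\<Sum>i\<in>UNIV. \<Sum>j\<in>UNIV. A $ i $ j * B $ i $ j)"
  by (simp add: inner_vec_def)

lemma inner_matrix_vector: "x \<bullet> (A *v y) = (\<Sum>i\<in>UNIV. \<Sum>j\<in>UNIV. A $ i $ j * (x $ i * y $ j))"
  for A :: "real^'n^'m"
  by (simp add: inner_vec_def matrix_vector_mult_def sum_distrib_left mult_ac)

lemma inner_rank_one: "(A::real^'n^'n) \<bullet> rank_one w = w \<bullet> (A *v w)"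
  by (simp add: inner_matrix_def inner_matrix_vector rank_one_def)

lemma symmetric_matrix_nth: "symmetric_matrix A \<longleftrightarrow> (\<forall>i j. A $ i $ j = A $ j $ i)"
  unfolding symmetric_matrix_def transpose_def by (auto simp: vec_eq_iff)

lemma symmetric_matrix_inner: "symmetric_matrix A \<Longrightarrow> x \<bullet> (A *v y) = y \<bullet> (A *v x)"
  unfolding inner_matrix_vector symmetric_matrix_nth
  by (subst sum.swap) (simp add: mult.commute)

lemma symmetric_matrix_add: "symmetric_matrix A \<Longrightarrow> symmetric_matrix B \<Longrightarrow> symmetric_matrix (A + B)"
  and symmetric_matrix_scale: "symmetric_matrix A \<Longrightarrow> symmetric_matrix (c *\<^sub>R A)"
  and symmetric_matrix_rank_one: "symmetric_matrix (rank_one w)"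
  by (simp_all add: symmetric_matrix_nth rank_one_def mult.commute)

lemma norm_rank_one: "norm (rank_one w) = w \<bullet> w"
proof -
  have "rank_one w \<bullet> rank_one w = (w \<bullet> w)\<^sup>2"
    by (simp add: inner_matrix_def rank_one_def inner_vec_def power2_eq_square sum_product mult_ac)
  then show ?thesis by (simp add: norm_eq_sqrt_inner)
qed

lemma abs_quadratic_form_le_norm: "\<bar>w \<bullet> (A *v w)\<bar> \<le> norm A * (w \<bullet> w)"
  for A :: "real^'n^'n"
  using Cauchy_Schwarz_ineq2[of A "rank_one w"] by (simp add: inner_rank_one norm_rank_one)

lemma matrix_vector_mult_sum_left: "(\<Sum>b\<in>K. f b) *v x = (\<Sum>b\<in>K. f b *v x)" for f :: "'b \<Rightarrow> real^'n^'m"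
  by (induction K rule: infinite_finite_induct) (auto simp: matrix_vector_mult_add_rdistrib)

text \<open>A maximizer \<open>b\<close> of the quadratic form on the unit sphere of
  \<open>S\<close> is an eigenvector: the residual \<open>u\<close> lies in \<open>S\<close> by
  invariance, and comparing \<open>b\<close> with \<open>b + t *\<^sub>R u\<close> for small
  \<open>t > 0\<close> would contradict maximality unless \<open>u = 0\<close>.\<close>

lemma invariant_subspace_eigenvector:
  fixes A :: "real^'n^'n"
  assumes A: "symmetric_matrix A" and S: "subspace S" "S \<noteq> {0}" and inv: "\<And>x. x \<in> S \<Longrightarrow> A *v x \<in> S"
  shows "\<exists>b\<in>S. norm b = 1 \<and> (\<exists>l. A *v b = l *\<^sub>R b)"
proof -
  define K where "K = S \<inter> sphere 0 1"
  have "compact K" unfolding K_def using S closed_subspace by (intro closed_Int_compact) auto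
  moreover have "K \<noteq> {}"
  proof -
    obtain x where "x \<in> S" "x \<noteq> 0" using S subspace_0 by blast
    then have "sgn x \<in> K" unfolding K_def using S(1) by (auto simp: sgn_div_norm norm_sgn subspace_scale)
    then show ?thesis by auto
  qed
  moreover have "continuous_on K (\<lambda>x. x \<bullet> (A *v x))"
    by (intro continuous_intros linear_continuous_on matrix_vector_mul_bounded_linear)
  ultimately obtain b where b: "b \<in> K" and bmax: "\<And>x. x \<in> K \<Longrightarrow> x \<bullet> (A *v x) \<le> b \<bullet> (A *v b)"
    using continuous_attains_sup[of K "\<lambda>x. x \<bullet> (A *v x)"] by blast
  define l where "l = b \<bullet> (A *v b)"
  have bS: "b \<in> S" and nb: "norm b = 1" using b by (auto simp: K_def)
  have q: "x \<bullet> (A *v x) \<le> l * (x \<bullet> x)" if "x \<in> S" for x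
  proof (cases "x = 0")
    case False
    define y where "y = inverse (norm x) *\<^sub>R x"
    have "y \<in> K" unfolding K_def y_def using that S(1) False by (auto simp: subspace_scale)
    then have "y \<bullet> (A *v y) \<le> l" using bmax by (simp add: l_def)
    moreover have "y \<bullet> (A *v y) = (x \<bullet> (A *v x)) / (norm x)\<^sup>2"
      by (simp add: y_def matrix_vector_mult_scaleR power2_eq_square divide_inverse)
    ultimately show ?thesis using False by (simp add: pos_divide_le_eq power2_norm_eq_inner)
  qed simp
  define u where "u = A *v b - l *\<^sub>R b"
  have uS: "u \<in> S" unfolding u_def using inv bS S(1) by (intro subspace_diff subspace_scale)
  define c where "c = l * (u \<bullet> u) - u \<bullet> (A *v u)"
  have pos: "0 \<le> - 2 * t * (u \<bullet> u) + t\<^sup>2 * c" for t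
  proof -
    have "b + t *\<^sub>R u \<in> S" using bS uS S(1) by (intro subspace_add subspace_scale)
    from q[OF this] have "0 \<le> l * ((b + t *\<^sub>R u) \<bullet> (b + t *\<^sub>R u)) - (b + t *\<^sub>R u) \<bullet> (A *v (b + t *\<^sub>R u))" by simp
    also have "\<dots> = l * (b \<bullet> b) - b \<bullet> (A *v b) + 2 * t * (l * (b \<bullet> u) - u \<bullet> (A *v b)) + t\<^sup>2 * c"
      using symmetric_matrix_inner[OF A, of b u]
      by (simp add: c_def inner_simps matrix_vector_right_distrib matrix_vector_mult_scaleR inner_commute[of u b] power2_eq_square algebra_simps)
    also have "l * (b \<bullet> u) - u \<bullet> (A *v b) = - (u \<bullet> u)"
      by (subst (3) u_def) (simp add: inner_simps inner_commute)
    also have "l * (b \<bullet> b) - b \<bullet> (A *v b) = 0" using nb by (simp add: l_def dot_square_norm)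
    finally show ?thesis by simp
  qed
  have "u \<bullet> u = 0"
  proof (rule ccontr)
    assume "u \<bullet> u \<noteq> 0"
    then have uu: "0 < u \<bullet> u" using inner_ge_zero[of u] by linarith
    \<comment> \<open>Small enough for the quadratic term in \<open>t\<close> to be at most half of
      the linear one.\<close>
    define t where "t = (u \<bullet> u) / (\<bar>c\<bar> + 1)"
    have t: "0 < t" using uu by (simp add: t_def)
    have "t * c \<le> t * (\<bar>c\<bar> + 1)" using t by (intro mult_left_mono) auto
    also have "\<dots> = u \<bullet> u" by (simp add: t_def)
    finally have "t * c \<le> u \<bullet> u" .
    then have "t * (t * c) \<le> t * (u \<bullet> u)" using t by (intro mult_left_mono) auto
    then have "- 2 * t * (u \<bullet> u) + t\<^sup>2 * c \<le> - (t * (u \<bullet> u))" by (simp add: power2_eq_square)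
    moreover have "0 < t * (u \<bullet> u)" using t uu by simp
    ultimately show False using pos[of t] by linarith
  qed
  then have "A *v b = l *\<^sub>R b" by (simp add: u_def)
  then show ?thesis using bS nb by auto
qed

text \<open>The expansion clause stands for both independence and spanning. A set labelled by
  \<open>l\<close> avoids any ordering of the eigenvalues, and equal eigenvalues cause no
  trouble.\<close>

definition eigenbasis :: "real^'n^'n \<Rightarrow> (real^'n) set \<Rightarrow> (real^'n \<Rightarrow> real) \<Rightarrow> bool" where
  "eigenbasis A B l \<longleftrightarrow> finite B \<and> (\<forall>b\<in>B. norm b = 1 \<and> A *v b = l b *\<^sub>R b)
     \<and> (\<forall>b\<in>B. \<forall>c\<in>B. b \<noteq> c \<longrightarrow> b \<bullet> c = 0) \<and> (\<forall>x. (\<Sum>b\<in>B. (x \<bullet> b) *\<^sub>R b) = x)"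

text \<open>Induction on the dimension: split off one eigenvector \<open>b\<close>; by symmetry its
  orthogonal complement inside \<open>S\<close> is again invariant.\<close>

lemma orthonormal_eigenvectors:
  fixes A :: "real^'n^'n"
  assumes A: "symmetric_matrix A"
  shows "subspace S \<Longrightarrow> (\<And>x. x \<in> S \<Longrightarrow> A *v x \<in> S) \<Longrightarrow>
    \<exists>B l. finite B \<and> (\<forall>b\<in>B. norm b = 1 \<and> A *v b = l b *\<^sub>R b)
      \<and> (\<forall>b\<in>B. \<forall>c\<in>B. b \<noteq> c \<longrightarrow> b \<bullet> c = 0) \<and> B \<subseteq> S \<and> (\<forall>x\<in>S. (\<Sum>b\<in>B. (x \<bullet> b) *\<^sub>R b) = x)"
proof (induction "dim S" arbitrary: S rule: less_induct)
  case (less S)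
  show ?case
  proof (cases "S = {0}")
    case True
    then show ?thesis by (intro exI[of _ "{}"]) auto
  next
    case False
    obtain b m where b: "b \<in> S" "norm b = 1" "A *v b = m *\<^sub>R b"
      using invariant_subspace_eigenvector[OF A less.prems(1) False less.prems(2)] by auto
    define S' where "S' = {x \<in> S. x \<bullet> b = 0}"
    have S': "subspace S'"
      using less.prems(1) by (auto simp: subspace_def S'_def inner_simps)
    have inv: "A *v x \<in> S'" if "x \<in> S'" for x
    proof -
      have "(A *v x) \<bullet> b = x \<bullet> (A *v b)" using symmetric_matrix_inner[OF A] by (metis inner_commute)
      then show ?thesis using that less.prems(2) b(3) by (simp add: S'_def)
    qed
    have bb: "b \<bullet> b = 1" using b by (simp add: dot_square_norm)
    then have "b \<notin> S'" by (auto simp: S'_def)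
    moreover have "S' \<subseteq> S" by (auto simp: S'_def)
    ultimately have "S' \<subset> S" using b(1) by blast
    then have "span S' \<subset> span S"
      by (simp only: span_eq_iff[THEN iffD2, OF S'] span_eq_iff[THEN iffD2, OF less.prems(1)])
    then have "dim S' < dim S" by (rule dim_psubset)
    have "\<exists>B l. finite B \<and> (\<forall>c\<in>B. norm c = 1 \<and> A *v c = l c *\<^sub>R c)
      \<and> (\<forall>c\<in>B. \<forall>d\<in>B. c \<noteq> d \<longrightarrow> c \<bullet> d = 0) \<and> B \<subseteq> S' \<and> (\<forall>x\<in>S'. (\<Sum>c\<in>B. (x \<bullet> c) *\<^sub>R c) = x)"
      by (rule less.hyps[OF \<open>dim S' < dim S\<close> S']) (rule inv)
    then obtain B l where B0: "finite B" "\<forall>c\<in>B. norm c = 1 \<and> A *v c = l c *\<^sub>R c"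
      "\<forall>c\<in>B. \<forall>d\<in>B. c \<noteq> d \<longrightarrow> c \<bullet> d = 0" "B \<subseteq> S'" "\<forall>x\<in>S'. (\<Sum>c\<in>B. (x \<bullet> c) *\<^sub>R c) = x"
      by (elim exE conjE) (rule that)
    note B = B0(1) B0(2)[rule_format] B0(3)[rule_format] B0(4) B0(5)[rule_format]
    have bB: "b \<notin> B" using B(4) bb by (auto simp: S'_def)
    have orth: "c \<bullet> b = 0" if "c \<in> B" for c using that B(4) by (auto simp: S'_def)
    show ?thesis
    proof (intro exI[of _ "insert b B"] exI[of _ "l(b := m)"] conjI ballI impI)
      show "finite (insert b B)" using B by simp
      show "insert b B \<subseteq> S" using B(4) b by (auto simp: S'_def)
      show "norm c = 1" if "c \<in> insert b B" for c using that B(2) b by auto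
      show "A *v c = (l(b := m)) c *\<^sub>R c" if "c \<in> insert b B" for c using that B(2) b bB by auto
      show "c \<bullet> d = 0" if "c \<in> insert b B" "d \<in> insert b B" "c \<noteq> d" for c d
        using that B(3) orth by (auto simp: inner_commute[of b])
      fix x assume x: "x \<in> S"
      define y where "y = x - (x \<bullet> b) *\<^sub>R b"
      have "y \<in> S'" using x b less.prems(1)
        by (auto simp: y_def S'_def inner_simps dot_square_norm intro!: subspace_diff subspace_scale)
      then have e1: "(\<Sum>c\<in>B. (y \<bullet> c) *\<^sub>R c) = y" by (rule B(5))
      have e2: "(\<Sum>c\<in>B. (y \<bullet> c) *\<^sub>R c) = (\<Sum>c\<in>B. (x \<bullet> c) *\<^sub>R c)"
        using orth by (intro sum.cong) (auto simp: y_def inner_simps inner_commute[of b])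
      show "(\<Sum>c\<in>insert b B. (x \<bullet> c) *\<^sub>R c) = x"
        unfolding sum.insert[OF B(1) bB] e2[symmetric] e1 by (simp add: y_def)
    qed
  qed
qed

lemma eigenbasis_exists:
  assumes "symmetric_matrix A"
  shows "\<exists>B l. eigenbasis A B l"
proof -
  have "\<exists>B l. finite B \<and> (\<forall>b\<in>B. norm b = 1 \<and> A *v b = l b *\<^sub>R b)
      \<and> (\<forall>b\<in>B. \<forall>c\<in>B. b \<noteq> c \<longrightarrow> b \<bullet> c = 0) \<and> B \<subseteq> UNIV \<and> (\<forall>x\<in>UNIV. (\<Sum>b\<in>B. (x \<bullet> b) *\<^sub>R b) = x)"
    by (rule orthonormal_eigenvectors[OF assms subspace_UNIV]) (rule UNIV_I)
  then show ?thesis unfolding eigenbasis_def by (simp only: subset_UNIV simp_thms ball_UNIV)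
qed

context
  fixes A :: "real^'n^'n" and B l
  assumes eb: "eigenbasis A B l"
begin

lemma
  shows eb_finite: "finite B" and eb_norm: "b \<in> B \<Longrightarrow> norm b = 1" and eb_eigen: "b \<in> B \<Longrightarrow> A *v b = l b *\<^sub>R b"
    and eb_orth: "b \<in> B \<Longrightarrow> c \<in> B \<Longrightarrow> b \<noteq> c \<Longrightarrow> b \<bullet> c = 0" and eb_sum: "(\<Sum>b\<in>B. (x \<bullet> b) *\<^sub>R b) = x"
  using eb by (auto simp: eigenbasis_def)

lemma eb_nonempty: "B \<noteq> {}"
proof
  assume "B = {}"
  then have "(axis undefined 1 :: real^'n) = 0" using eb_sum[of "axis undefined 1 :: real^'n"] by simp
  then show False by (simp add: axis_eq_0_iff)
qed

lemma eb_inner: "x \<bullet> y = (\<Sum>b\<in>B. (x \<bullet> b) * (y \<bullet> b))"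
proof -
  have "x \<bullet> y = (\<Sum>b\<in>B. (x \<bullet> b) *\<^sub>R b) \<bullet> y" by (simp add: eb_sum)
  then show ?thesis by (simp add: inner_sum_left inner_commute[of y])
qed

lemma eb_mult: "A *v x = (\<Sum>b\<in>B. (l b * (x \<bullet> b)) *\<^sub>R b)"
proof -
  have "A *v x = A *v (\<Sum>b\<in>B. (x \<bullet> b) *\<^sub>R b)" by (simp add: eb_sum)
  also have "\<dots> = (\<Sum>b\<in>B. A *v ((x \<bullet> b) *\<^sub>R b))" by (simp add: linear_sum[OF matrix_vector_mul_linear])
  also have "\<dots> = (\<Sum>b\<in>B. (l b * (x \<bullet> b)) *\<^sub>R b)"
    by (intro sum.cong) (auto simp: matrix_vector_mult_scaleR eb_eigen)
  finally show ?thesis .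
qed

lemma eb_mult_inner: "c \<in> B \<Longrightarrow> (A *v x) \<bullet> c = l c * (x \<bullet> c)"
proof -
  assume c: "c \<in> B"
  have "(A *v x) \<bullet> c = (\<Sum>b\<in>B. if b = c then l c * (x \<bullet> c) else 0)"
    unfolding eb_mult inner_sum_left
    using c eb_orth eb_norm by (intro sum.cong) (auto simp: dot_square_norm)
  then show ?thesis using c eb_finite by simp
qed

lemma eb_quadratic: "x \<bullet> (A *v x) = (\<Sum>b\<in>B. l b * (x \<bullet> b)\<^sup>2)"
  unfolding eb_inner[of x "A *v x"] using eb_mult_inner by (intro sum.cong) (auto simp: power2_eq_square)

lemma eb_eigenvalues: "eigenvalues A = l ` B"
proof (intro set_eqI iffI)
  fix m show "m \<in> l ` B \<Longrightarrow> m \<in> eigenvalues A"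
  proof -
    assume "m \<in> l ` B"
    then obtain b where b: "b \<in> B" "m = l b" by blast
    then have "b \<noteq> 0" "A *v b = m *\<^sub>R b" using eb_norm[OF b(1)] eb_eigen[OF b(1)] by auto
    then show ?thesis unfolding eigenvalues_def by blast
  qed
next
  fix m assume "m \<in> eigenvalues A"
  then obtain x where x: "x \<noteq> 0" "A *v x = m *\<^sub>R x" by (auto simp: eigenvalues_def)
  obtain b where b: "b \<in> B" "x \<bullet> b \<noteq> 0"
  proof -
    have "\<exists>b\<in>B. x \<bullet> b \<noteq> 0"
    proof (rule ccontr)
      assume "\<not> (\<exists>b\<in>B. x \<bullet> b \<noteq> 0)"
      then have "(\<Sum>b\<in>B. (x \<bullet> b) *\<^sub>R b) = 0" by (intro sum.neutral) auto
      then show False using x(1) eb_sum[of x] by simp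
    qed
    then show ?thesis using that by blast
  qed
  have "l b * (x \<bullet> b) = m * (x \<bullet> b)" using eb_mult_inner[OF b(1), of x] x(2) by auto
  then have "l b = m" using b(2) by simp
  then show "m \<in> l ` B" using b(1) by auto
qed

lemma eb_lambda_max: "lambda_max A = Max (l ` B)"
  by (simp add: lambda_max_def eb_eigenvalues)

lemma eb_abs_eigenvalue_max: "abs_eigenvalue_max A = Max ((\<lambda>b. \<bar>l b\<bar>) ` B)"
  by (simp add: abs_eigenvalue_max_def eb_eigenvalues image_image)

lemma eb_le_lambda_max: "b \<in> B \<Longrightarrow> l b \<le> lambda_max A"
  and eb_abs_le: "b \<in> B \<Longrightarrow> \<bar>l b\<bar> \<le> abs_eigenvalue_max A"
  unfolding eb_lambda_max eb_abs_eigenvalue_max using eb_finite by auto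

lemma eb_lambda_max_attained: "\<exists>b\<in>B. l b = lambda_max A"
  and eb_abs_attained: "\<exists>b\<in>B. \<bar>l b\<bar> = abs_eigenvalue_max A"
  unfolding eb_lambda_max eb_abs_eigenvalue_max
proof -
  have "Max (l ` B) \<in> l ` B" "Max ((\<lambda>b. \<bar>l b\<bar>) ` B) \<in> (\<lambda>b. \<bar>l b\<bar>) ` B"
    using eb_finite eb_nonempty by (auto intro!: Max_in)
  then show "\<exists>b\<in>B. l b = Max (l ` B)" "\<exists>b\<in>B. \<bar>l b\<bar> = Max ((\<lambda>b. \<bar>l b\<bar>) ` B)" by force+
qed

lemma eb_spectral: "A = (\<Sum>b\<in>B. l b *\<^sub>R rank_one b)"
proof -
  have "A *v x = (\<Sum>b\<in>B. l b *\<^sub>R rank_one b) *v x" for x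
  proof -
    have "rank_one b *v x = (x \<bullet> b) *\<^sub>R b" for b
      by (simp add: vec_eq_iff matrix_vector_mult_def rank_one_def inner_vec_def sum_distrib_left mult_ac)
    then have "(\<Sum>b\<in>B. l b *\<^sub>R rank_one b) *v x = (\<Sum>b\<in>B. (l b * (x \<bullet> b)) *\<^sub>R b)"
      by (simp add: matrix_vector_mult_sum_left scaleR_matrix_vector_assoc[symmetric])
    then show ?thesis by (simp add: eb_mult)
  qed
  then show ?thesis by (simp add: matrix_eq)
qed

lemma eb_matrix_inner: "A \<bullet> Y = (\<Sum>b\<in>B. l b * (b \<bullet> (Y *v b)))"
proof -
  have "(\<Sum>b\<in>B. l b *\<^sub>R rank_one b) \<bullet> Y = (\<Sum>b\<in>B. l b * (b \<bullet> (Y *v b)))"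
    by (simp add: inner_sum_left inner_commute[of "rank_one _"] inner_rank_one)
  then show ?thesis by (simp flip: eb_spectral)
qed

lemma eb_trace: "trace Y = (\<Sum>b\<in>B. b \<bullet> (Y *v b))"
proof -
  \<comment> \<open>Completeness of the basis, read off from Parseval's identity for two axis
    vectors.\<close>
  have 1: "(\<Sum>b\<in>B. b $ i * b $ j) = (if i = j then 1 else 0)" for i j
  proof -
    have "(axis i 1 :: real^'n) \<bullet> axis j 1 = (\<Sum>b\<in>B. b $ i * b $ j)"
      by (subst eb_inner) (simp add: inner_axis')
    moreover have "(axis i 1 :: real^'n) \<bullet> axis j 1 = (if i = j then 1 else 0)"
      by (simp add: inner_axis_axis)
    ultimately show ?thesis by simp
  qed
  have "(\<Sum>b\<in>B. b \<bullet> (Y *v b)) = (\<Sum>i\<in>UNIV. \<Sum>j\<in>UNIV. Y $ i $ j * (\<Sum>b\<in>B. b $ i * b $ j))"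
    unfolding inner_matrix_vector sum_distrib_left
    by (subst sum.swap, intro sum.cong refl, subst sum.swap, simp)
  also have "\<dots> = trace Y" by (simp add: 1 trace_def if_distrib cong: if_cong)
  finally show ?thesis by simp
qed

lemma eb_quadratic_le: "x \<bullet> (A *v x) \<le> lambda_max A * (x \<bullet> x)"
  unfolding eb_quadratic eb_inner[of x x] sum_distrib_left
  using eb_le_lambda_max by (intro sum_mono) (auto simp: power2_eq_square intro!: mult_right_mono)

lemma eb_abs_quadratic_le: "\<bar>x \<bullet> (A *v x)\<bar> \<le> abs_eigenvalue_max A * (x \<bullet> x)"
proof -
  have "\<bar>x \<bullet> (A *v x)\<bar> \<le> (\<Sum>b\<in>B. \<bar>l b * (x \<bullet> b)\<^sup>2\<bar>)" unfolding eb_quadratic by (rule sum_abs)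
  also have "\<dots> \<le> abs_eigenvalue_max A * (x \<bullet> x)"
    unfolding eb_inner[of x x] sum_distrib_left
    using eb_abs_le by (intro sum_mono) (auto simp: power2_eq_square abs_mult intro!: mult_right_mono)
  finally show ?thesis .
qed

text \<open>This is the optimum of the linear subproblem. The trace of \<open>Y\<close> is only
  bounded above, so a negative \<open>lambda_max\<close> would make the zero matrix optimal; hence
  the maximum with 0.\<close>

lemma eb_inner_psd_le:
  assumes "psd Y" "trace Y \<le> c"
  shows "A \<bullet> Y \<le> max 0 (c * lambda_max A)"
proof -
  have "A \<bullet> Y \<le> (\<Sum>b\<in>B. lambda_max A * (b \<bullet> (Y *v b)))"
    unfolding eb_matrix_inner using eb_le_lambda_max assms(1) by (intro sum_mono mult_right_mono) (auto simp: psd_def)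
  also have "\<dots> = lambda_max A * trace Y" by (simp add: eb_trace sum_distrib_left)
  also have "\<dots> \<le> max 0 (c * lambda_max A)"
  proof -
    have "0 \<le> trace Y" using assms(1) unfolding eb_trace by (intro sum_nonneg) (auto simp: psd_def)
    moreover have "lambda_max A * trace Y \<le> c * lambda_max A" if "0 \<le> lambda_max A"
      using mult_left_mono[OF assms(2) that] by (simp add: mult.commute)
    moreover have "lambda_max A * trace Y \<le> 0" if "\<not> 0 \<le> lambda_max A"
      using that calculation(1) by (simp add: mult_nonpos_nonneg)
    ultimately show ?thesis by (meson max.coboundedI1 max.coboundedI2)
  qed
  finally show ?thesis .
qed

end

section \<open>Extremal eigenvalues as extrema of the quadratic form\<close>

lemma lambda_max_attained:
  assumes "symmetric_matrix A"
  obtains b where "norm b = 1" "A *v b = lambda_max A *\<^sub>R b"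
proof -
  obtain B l where e: "eigenbasis A B l" using eigenbasis_exists[OF assms] by blast
  obtain b where b: "b \<in> B" "l b = lambda_max A" using eb_lambda_max_attained[OF e] by blast
  show ?thesis
  proof (rule that)
    show "norm b = 1" by (rule eb_norm[OF e b(1)])
    show "A *v b = lambda_max A *\<^sub>R b" using eb_eigen[OF e b(1)] unfolding b(2) .
  qed
qed

lemma quadratic_le_lambda_max:
  assumes "symmetric_matrix A"
  shows "x \<bullet> (A *v x) \<le> lambda_max A * (x \<bullet> x)"
proof -
  obtain B l where e: "eigenbasis A B l" using eigenbasis_exists[OF assms(1)] by blast
  show ?thesis by (rule eb_quadratic_le[OF e])
qed

lemma abs_quadratic_le_abs_eigenvalue_max:
  assumes "symmetric_matrix A"
  shows "\<bar>x \<bullet> (A *v x)\<bar> \<le> abs_eigenvalue_max A * (x \<bullet> x)"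
proof -
  obtain B l where e: "eigenbasis A B l" using eigenbasis_exists[OF assms(1)] by blast
  show ?thesis by (rule eb_abs_quadratic_le[OF e])
qed

lemma inner_psd_le:
  assumes "symmetric_matrix A" "psd Y" "trace Y \<le> c"
  shows "A \<bullet> Y \<le> max 0 (c * lambda_max A)"
proof -
  obtain B l where e: "eigenbasis A B l" using eigenbasis_exists[OF assms(1)] by blast
  show ?thesis by (rule eb_inner_psd_le[OF e assms(2,3)])
qed

lemma abs_eigenvalue_max_attained:
  assumes "symmetric_matrix A"
  obtains b where "norm b = 1" "\<bar>b \<bullet> (A *v b)\<bar> = abs_eigenvalue_max A"
proof -
  obtain B l where e: "eigenbasis A B l" using eigenbasis_exists[OF assms] by blast
  obtain b where b: "b \<in> B" "\<bar>l b\<bar> = abs_eigenvalue_max A" using eb_abs_attained[OF e] by blast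
  have "b \<bullet> (A *v b) = l b" using eb_eigen[OF e b(1)] eb_norm[OF e b(1)] by (simp add: dot_square_norm)
  then have "\<bar>b \<bullet> (A *v b)\<bar> = abs_eigenvalue_max A" using b(2) by simp
  then show ?thesis by (rule that[OF eb_norm[OF e b(1)]])
qed

text \<open>A perturbation bound of Weyl type: test \<open>B\<close> with a top eigenvector of
  \<open>A\<close>. It makes the extremal eigenvalues Lipschitz, hence measurable along a
  run.\<close>

lemma lambda_max_le_diff:
  assumes "symmetric_matrix A" "symmetric_matrix B"
  shows "lambda_max A \<le> lambda_max B + norm (A - B)"
proof -
  obtain b where b: "norm b = 1" "A *v b = lambda_max A *\<^sub>R b" using lambda_max_attained[OF assms(1)] .
  have bb: "b \<bullet> b = 1" using b by (simp add: dot_square_norm)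
  have "lambda_max A = b \<bullet> (B *v b) + b \<bullet> ((A - B) *v b)"
    using b bb by (simp add: matrix_vector_mult_diff_rdistrib inner_diff_right)
  also have "\<dots> \<le> lambda_max B + norm (A - B)"
    using quadratic_le_lambda_max[OF assms(2), of b] abs_quadratic_form_le_norm[of b "A - B"] bb by simp
  finally show ?thesis .
qed

lemma abs_eigenvalue_max_le_diff:
  assumes "symmetric_matrix A" "symmetric_matrix B"
  shows "abs_eigenvalue_max A \<le> abs_eigenvalue_max B + norm (A - B)"
proof -
  obtain b where b: "norm b = 1" "\<bar>b \<bullet> (A *v b)\<bar> = abs_eigenvalue_max A" using abs_eigenvalue_max_attained[OF assms(1)] .
  have bb: "b \<bullet> b = 1" using b by (simp add: dot_square_norm)
  have "b \<bullet> (A *v b) = b \<bullet> (B *v b) + b \<bullet> ((A - B) *v b)"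
    by (simp add: matrix_vector_mult_diff_rdistrib inner_diff_right)
  then show ?thesis
    using abs_quadratic_le_abs_eigenvalue_max[OF assms(2), of b] abs_quadratic_form_le_norm[of b "A - B"] bb b(2) by simp
qed

lemma abs_eigenvalue_max_le:
  assumes "symmetric_matrix A" "\<And>x. \<bar>x \<bullet> (A *v x)\<bar> \<le> K * (x \<bullet> x)"
  shows "abs_eigenvalue_max A \<le> K"
proof -
  obtain b where b: "norm b = 1" "\<bar>b \<bullet> (A *v b)\<bar> = abs_eigenvalue_max A" using abs_eigenvalue_max_attained[OF assms(1)] .
  show ?thesis using assms(2)[of b] b by (simp add: dot_square_norm)
qed

lemma abs_eigenvalue_max_nonneg: "symmetric_matrix A \<Longrightarrow> 0 \<le> abs_eigenvalue_max A"
  by (rule abs_eigenvalue_max_attained[of A]) auto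

lemma lambda_max_continuous:
  fixes F :: "'a::topological_space \<Rightarrow> real^'n^'n"
  assumes F: "continuous_on UNIV F" and sym: "\<And>x. symmetric_matrix (F x)"
  shows "continuous_on UNIV (\<lambda>x. lambda_max (F x))" "continuous_on UNIV (\<lambda>x. abs_eigenvalue_max (F x))"
proof -
  have "((\<lambda>y. f (F y)) \<longlongrightarrow> f (F x)) (at x)"
    if f: "\<And>A B. symmetric_matrix A \<Longrightarrow> symmetric_matrix B \<Longrightarrow> f A \<le> f B + norm (A - B)" for f :: "real^'n^'n \<Rightarrow> real" and x
  proof (rule Lim_null_comparison[THEN Lim_null[THEN iffD2]])
    show "\<forall>\<^sub>F y in at x. norm (f (F y) - f (F x)) \<le> norm (F y - F x)"
    proof (intro always_eventually allI)
      fix y show "norm (f (F y) - f (F x)) \<le> norm (F y - F x)"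
        using f[OF sym sym, of y x] f[OF sym sym, of x y] by (simp add: norm_minus_commute abs_le_iff)
    qed
    have "(F \<longlongrightarrow> F x) (at x)" using F by (simp add: continuous_on_def)
    then show "((\<lambda>y. norm (F y - F x)) \<longlongrightarrow> 0) (at x)" using LIM_zero tendsto_norm_zero by blast
  qed
  then show "continuous_on UNIV (\<lambda>x. lambda_max (F x))" "continuous_on UNIV (\<lambda>x. abs_eigenvalue_max (F x))"
    using lambda_max_le_diff abs_eigenvalue_max_le_diff by (auto simp: continuous_on_def)
qed

section \<open>The Frank-Wolfe recursion\<close>

text \<open>The difference of the two sides has derivative \<open>(1 - 1 / x)^2 / 2\<close>. It is
  used at \<open>y = (t + 2) / t\<close>, which is \<open>1 / (1 - fw_gamma t)\<close>.\<close>

lemma ln_le_half_diff_inverse: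
  fixes y :: real
  assumes "1 \<le> y"
  shows "ln y \<le> (y - 1 / y) / 2"
proof -
  define f where "f = (\<lambda>y::real. (y - 1 / y) / 2 - ln y)"
  have "f 1 \<le> f y"
  proof (rule DERIV_nonneg_imp_nondecreasing[OF assms])
    fix x :: real assume x: "1 \<le> x" "x \<le> y"
    have "(f has_real_derivative ((1 - 1 / x)\<^sup>2 / 2)) (at x)"
      unfolding f_def using x
      by (auto intro!: derivative_eq_intros simp: power2_eq_square field_simps)
    then show "\<exists>D. (f has_real_derivative D) (at x) \<and> 0 \<le> D" by (intro exI conjI) auto
  qed
  then show ?thesis by (simp add: f_def)
qed

text \<open>\<open>h\<close> is the primal error and \<open>G\<close> the gap. The first step has
  step size 1, beyond the refined estimate, and uses the generic curvature term; this still gives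
  \<open>h 1 \<le> C\<close>, below the claimed \<open>1.28 * C\<close>. In the later steps the
  refined error decays like \<open>1 / (t * (t + 2))\<close>, and the induction closes because
  \<open>2 / (t + 2) + 0.56 / t \<le> 2.56 / (t + 1)\<close>.\<close>

lemma frank_wolfe_primal_rate:
  fixes h G :: "nat \<Rightarrow> real" and C :: real
  assumes C: "0 < C"
    and step0: "h 1 \<le> h 0 - G 0 + C / 2"
    and step: "\<And>t. 1 \<le> t \<Longrightarrow> t < b \<Longrightarrow>
      h (Suc t) \<le> h t - 2 / (real t + 2) * G t + 28 / 100 * C * (2 / (real t * (real t + 2)))"
    and gap: "\<And>t. t < b \<Longrightarrow> h t - C / (real t + 2) \<le> G t"
    and t: "1 \<le> t" "t \<le> b"
  shows "h t \<le> 256 / 100 * C / (real t + 1)"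
  using t
proof (induction t rule: dec_induct)
  case base
  have "h 1 \<le> C" using step0 gap[of 0] base by simp
  also have "C \<le> 256 / 100 * C / (real 1 + 1)" using C by simp
  finally show ?case by simp
next
  case (step t)
  let ?t = "real t"
  have t1: "1 \<le> ?t" using step by simp
  have 1: "2 / (?t + 2) * (h t - C / (?t + 2)) \<le> 2 / (?t + 2) * G t"
    using gap[of t] step by (intro mult_left_mono) auto
  have "h (Suc t) \<le> h t - 2 / (?t + 2) * (h t - C / (?t + 2)) + 28 / 100 * C * (2 / (?t * (?t + 2)))"
    using assms(3)[of t] step 1 by linarith
  also have "\<dots> = h t * (?t / (?t + 2)) + C / (?t + 2) * (2 / (?t + 2) + 56 / 100 / ?t)"
    using t1 by (simp add: divide_simps) (simp add: algebra_simps)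
  also have "\<dots> \<le> 256 / 100 * C / (?t + 1) * (?t / (?t + 2)) + C / (?t + 2) * (256 / 100 / (?t + 1))"
  proof (intro add_mono mult_right_mono mult_left_mono)
    show "h t \<le> 256 / 100 * C / (?t + 1)" using step by simp
    show "2 / (?t + 2) + 56 / 100 / ?t \<le> 256 / 100 / (?t + 1)"
    proof -
      have "2 * ?t * (?t + 1) + 56 / 100 * (?t + 1) * (?t + 2) \<le> 256 / 100 * ?t * (?t + 2)"
        using t1 by (simp add: algebra_simps)
      then show ?thesis using t1 by (simp add: divide_simps) (simp add: algebra_simps)
    qed
  qed (use t1 C in auto)
  also have "\<dots> = 256 / 100 * C / (real (Suc t) + 1)"
    using t1 by (simp add: divide_simps) (simp add: algebra_simps)
  finally show ?case .
qed

lemma ln_ratio_lower: "465 / 500 + 1 / 2000 \<le> ln (256 / 100 :: real)"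
proof -
  have "ln (256 / 100 :: real) = 2 * ln (8 / 5)"
    using ln_realpow[of "8 / 5" 2] by (simp add: power2_eq_square)
  then show ?thesis using ln_approx_bounds[of "8 / 5" 2] by (simp add: eval_nat_numeral)
qed

text \<open>Gaps above \<open>4 * C / T\<close> force a decrease of at least
  \<open>8 * C / (T * (t + 2))\<close> per step, up to the variance term. The decreases add up to a
  logarithm, and the variance terms telescope after \<open>t + 2\<close> is weakened to
  \<open>t + 1\<close>.\<close>

lemma frank_wolfe_gap_contradiction:
  fixes h G :: "nat \<Rightarrow> real" and C T :: real
  assumes C: "0 < C" and T: "3000 \<le> T" and b: "b = nat \<lfloor>T\<rfloor>"
    and step0: "h 1 \<le> h 0 - G 0 + C / 2"
    and step: "\<And>t. 1 \<le> t \<Longrightarrow> t < b \<Longrightarrow>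
      h (Suc t) \<le> h t - 2 / (real t + 2) * G t + 28 / 100 * C * (2 / (real t * (real t + 2)))"
    and gap: "\<And>t. t < b \<Longrightarrow> h t - C / (real t + 2) \<le> G t"
    and tol: "\<And>t. t < b \<Longrightarrow> 4 * C / T < G t"
    and nonneg: "0 \<le> h b"
  shows False
proof -
  define a where "a = nat \<lfloor>39 / 100 * T\<rfloor>"
  have a: "39 / 100 * T - 1 < real a" "real a \<le> 39 / 100 * T"
    using T unfolding a_def by linarith+
  have bT: "T - 1 < real b" "real b \<le> T" using T unfolding b by linarith+
  have a0: "1 \<le> a" and ab: "a \<le> b" and a1: "1 \<le> real a"
    using a bT T by linarith+
  have descent: "h t \<le> h a - 8 * C / T * (ln (real t + 2) - ln (real a + 2)) + 56 / 100 * C * (1 / real a - 1 / real t)"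
    if "a \<le> t" "t \<le> b" for t
    using that
  proof (induction t rule: dec_induct)
    case base
    then show ?case by simp
  next
    case (step t)
    let ?t = "real t"
    have t1: "1 \<le> ?t" using step a0 by simp
    have "ln (real (Suc t) + 2) - ln (?t + 2) = ln (1 + 1 / (?t + 2))"
    proof -
      have "1 + 1 / (?t + 2) = (real (Suc t) + 2) / (?t + 2)" by (simp add: field_simps)
      then show ?thesis by (simp add: ln_div)
    qed
    also have "\<dots> \<le> 1 / (?t + 2)" by (rule ln_add_one_self_le_self) simp
    finally have "8 * C / T * (ln (real (Suc t) + 2) - ln (?t + 2)) \<le> 8 * C / T * (1 / (?t + 2))"
      using C T by (intro mult_left_mono) auto
    also have "\<dots> = 2 / (?t + 2) * (4 * C / T)" by simp
    also have "\<dots> \<le> 2 / (?t + 2) * G t"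
      using tol[of t] step by (intro mult_left_mono) auto
    finally have 1: "8 * C / T * (ln (real (Suc t) + 2) - ln (?t + 2)) \<le> 2 / (?t + 2) * G t" .
    have 2: "28 / 100 * C * (2 / (?t * (?t + 2))) \<le> 56 / 100 * C * (1 / ?t - 1 / real (Suc t))"
    proof -
      have "28 / 100 * C * (2 / (?t * (?t + 2))) = 56 / 100 * C * (1 / (?t * (?t + 2)))" by simp
      also have "1 / (?t * (?t + 2)) \<le> 1 / (?t * (?t + 1))"
        using t1 by (intro divide_left_mono mult_left_mono) auto
      also have "1 / (?t * (?t + 1)) = 1 / ?t - 1 / real (Suc t)"
        using t1 by (simp add: divide_simps)
      finally show ?thesis using C by simp
    qed
    have "h (Suc t) \<le> h t - 2 / (?t + 2) * G t + 28 / 100 * C * (2 / (?t * (?t + 2)))"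
      using assms(5)[of t] step t1 by simp
    also have "\<dots> \<le> h t - 8 * C / T * (ln (real (Suc t) + 2) - ln (?t + 2)) + 56 / 100 * C * (1 / ?t - 1 / real (Suc t))"
      using 1 2 by linarith
    also have "\<dots> \<le> h a - 8 * C / T * (ln (?t + 2) - ln (real a + 2)) + 56 / 100 * C * (1 / real a - 1 / ?t)
       - 8 * C / T * (ln (real (Suc t) + 2) - ln (?t + 2)) + 56 / 100 * C * (1 / ?t - 1 / real (Suc t))"
      using step by simp
    also have "\<dots> = h a - 8 * C / T * (ln (real (Suc t) + 2) - ln (real a + 2)) + 56 / 100 * C * (1 / real a - 1 / real (Suc t))"
      by (simp add: right_diff_distrib)
    finally show ?case .
  qed
  have "h b \<le> h a - 8 * C / T * (ln (real b + 2) - ln (real a + 2)) + 56 / 100 * C * (1 / real a - 1 / real b)"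
    using descent[of b] ab by simp
  moreover have "h a \<le> C / T * (256 / 39)"
  proof -
    have "h a \<le> 256 / 100 * C / (real a + 1)"
      by (rule frank_wolfe_primal_rate[OF C step0 step gap]) (use a0 ab in auto)
    also have "\<dots> \<le> 256 / 100 * C / (39 / 100 * T)" using a T C by (intro divide_left_mono) auto
    also have "\<dots> = C / T * (256 / 39)" using T by (simp add: field_simps)
    finally show ?thesis .
  qed
  moreover have "8 * C / T * (465 / 500 + 1 / 2000) \<le> 8 * C / T * (ln (real b + 2) - ln (real a + 2))"
  proof (intro mult_left_mono)
    \<comment> \<open>Here 2.56 is a lower bound for \<open>1 / 0.39\<close>, not the constant of
      the primal rate. The two floors cost a bounded amount, which \<open>0.0016 * T\<close>
      outweighs once \<open>T \<ge> 3000\<close>.\<close>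
    have "256 / 100 * (real a + 2) \<le> real b + 2" using a bT T by simp
    then have "ln (256 / 100 * (real a + 2)) \<le> ln (real b + 2)" by (subst ln_le_cancel_iff) auto
    then show "465 / 500 + 1 / 2000 \<le> ln (real b + 2) - ln (real a + 2)"
      using ln_ratio_lower ln_mult_pos[of "256 / 100" "real a + 2"] by linarith
  qed (use C T in auto)
  \<comment> \<open>1.438 rounds \<open>0.56 / 0.39\<close> up, which leaves room for the floor in
    \<open>a\<close>.\<close>
  moreover have "56 / 100 * C * (1 / real a - 1 / real b) \<le> 56 / 100 * C * (1 / T * (1438 / 1000 / (56 / 100)) - 1 / T)"
  proof (intro mult_left_mono diff_mono)
    have "1 / real a \<le> 1 / (T * (56 / 1438 * 10))"
      using a T by (intro divide_left_mono mult_pos_pos) auto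
    then show "1 / real a \<le> 1 / T * (1438 / 1000 / (56 / 100))" using T by (simp add: field_simps)
    show "1 / T \<le> 1 / real b" using bT T by (intro divide_left_mono) auto
  qed (use C in auto)
  moreover have "C / T * (256 / 39) - 8 * C / T * (465 / 500 + 1 / 2000)
     + 56 / 100 * C * (1 / T * (1438 / 1000 / (56 / 100)) - 1 / T)
     = C / T * (256 / 39 - 8 * (465 / 500 + 1 / 2000) + (1438 / 1000 - 56 / 100))"
    using T by (simp add: field_simps)
  moreover have "C / T * (256 / 39 - 8 * (465 / 500 + 1 / 2000) + (1438 / 1000 - 56 / 100)) < 0"
    using C T by (intro mult_pos_neg) auto
  ultimately show False using nonneg by linarith
qed

section \<open>Smoothness and convexity of the penalty\<close>

definition diag_matrix :: "real^'n \<Rightarrow> real^'n^'n" where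
  "diag_matrix v = (\<chi> i j. if i = j then v $ i else 0)"

lemma inner_diag_matrix: "diag_matrix v \<bullet> X = v \<bullet> diag_vec X"
proof -
  have "(\<Sum>j\<in>UNIV. (if i = j then v $ i else 0) * X $ i $ j) = v $ i * X $ i $ i" for i
    by (simp add: if_distrib[of "\<lambda>x. x * _"] cong: if_cong)
  then show ?thesis by (simp add: diag_matrix_def inner_matrix_def diag_vec_def inner_vec_def)
qed

lemma adjoint_B_op: "adjoint (B_op C) (u, v) = u *\<^sub>R C + diag_matrix v"
proof -
  have "adjoint (B_op C) = (\<lambda>(u, v). u *\<^sub>R C + diag_matrix v)"
    by (rule adjoint_unique)
      (auto simp: B_op_def inner_add_right inner_diag_matrix inner_commute[of _ "diag_matrix _"] inner_commute[of "diag_vec _"] inner_commute[of C])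
  then show ?thesis by simp
qed

lemma B_op_linear_simps: "B_op C (X + Y) = B_op C X + B_op C Y" "B_op C (c *\<^sub>R X) = c *\<^sub>R B_op C X"
  "B_op C (X - Y) = B_op C X - B_op C Y" "B_op C 0 = 0"
  by (auto simp: B_op_def inner_simps diag_vec_def vec_eq_iff zero_prod_def)

text \<open>The gradient of \<open>phi M\<close>: the mean of the signed unit vector
  \<open>\<plusminus> e_i\<close> under the Gibbs distribution.\<close>

definition gibbs :: "real \<Rightarrow> real^'n \<Rightarrow> real^'n" where
  "gibbs M v = (\<chi> i. sinh (M * v $ i) / (\<Sum>j\<in>UNIV. cosh (M * v $ j)))"

lemma phi_cosh: "phi M v = (ln 2 + ln (\<Sum>i\<in>UNIV. cosh (M * v $ i))) / M"
proof -
  have "(\<Sum>i\<in>UNIV. exp (M * v $ i)) + (\<Sum>i\<in>UNIV. exp (- (M * v $ i))) = 2 * (\<Sum>i\<in>UNIV. cosh (M * v $ i))"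
    by (simp add: cosh_field_def sum_distrib_left add_divide_distrib flip: sum.distrib)
  then show ?thesis using sum_cosh_pos[of "\<lambda>i. M * v $ i"]
    by (simp add: phi_def ln_mult_pos)
qed

lemma phi_has_derivative:
  assumes "M \<noteq> 0"
  shows "(phi M has_derivative (\<lambda>h. gibbs M v \<bullet> h)) (at v)"
proof -
  have 1: "((\<lambda>v. cosh (M * v $ i)) has_derivative (\<lambda>h. M * h $ i * sinh (M * v $ i))) (at v)" for i
  proof (rule DERIV_compose_FDERIV[of cosh "sinh (M * v $ i)" "\<lambda>v. M * v $ i"])
    show "(cosh has_real_derivative sinh (M * v $ i)) (at (M * v $ i))"
      by (auto intro!: derivative_eq_intros)
    show "((\<lambda>v. M * v $ i) has_derivative (\<lambda>h. M * h $ i)) (at v)"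
      by (rule has_derivative_mult_right[OF bounded_linear.has_derivative[OF bounded_linear_vec_nth has_derivative_ident]])
  qed
  have 2: "((\<lambda>v. ln (\<Sum>i\<in>UNIV. cosh (M * v $ i))) has_derivative
      (\<lambda>h. (\<Sum>i\<in>UNIV. M * h $ i * sinh (M * v $ i)) * inverse (\<Sum>i\<in>UNIV. cosh (M * v $ i)))) (at v)"
    by (rule DERIV_compose_FDERIV[OF DERIV_ln])
      (use sum_cosh_pos[of "\<lambda>i. M * v $ i"] 1 in \<open>auto intro!: has_derivative_sum\<close>)
  have 3: "phi M = (\<lambda>v. (1 / M) * (ln 2 + ln (\<Sum>i\<in>UNIV. cosh (M * v $ i))))"
    by (auto simp: phi_cosh)
  have "(phi M has_derivative (\<lambda>h. (1 / M) * ((\<Sum>i\<in>UNIV. M * h $ i * sinh (M * v $ i)) * inverse (\<Sum>i\<in>UNIV. cosh (M * v $ i))))) (at v)"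
    unfolding 3 by (rule has_derivative_eq_rhs[OF has_derivative_mult_right[OF has_derivative_add[OF has_derivative_const 2]]]) simp
  moreover have "(1 / M) * ((\<Sum>i\<in>UNIV. M * h $ i * sinh (M * v $ i)) * inverse (\<Sum>i\<in>UNIV. cosh (M * v $ i))) = gibbs M v \<bullet> h" for h
  proof -
    have "(\<Sum>i\<in>UNIV. M * h $ i * sinh (M * v $ i)) = M * (\<Sum>i\<in>UNIV. sinh (M * v $ i) * h $ i)"
      by (simp add: sum_distrib_left mult_ac)
    then show ?thesis using assms by (simp add: gibbs_def inner_vec_def sum_divide_distrib[symmetric] divide_inverse[symmetric])
  qed
  ultimately show ?thesis by simp
qed

lemma grad_unique:
  assumes "GDERIV f x :> D"
  shows "grad f x = D"
  unfolding grad_def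
proof (rule the_equality)
  show "GDERIV f x :> D" by (rule assms)
  fix D' assume "GDERIV f x :> D'"
  then have "(\<lambda>h. h \<bullet> D') = (\<lambda>h. h \<bullet> D)"
    using assms has_derivative_unique unfolding gderiv_def by blast
  then have "h \<bullet> D' = h \<bullet> D" for h by metis
  then show "D' = D" by (metis vector_eq_ldot)
qed

lemma grad_g_fun:
  fixes V :: "real \<times> (real^'n)"
  assumes "M \<noteq> 0"
  shows "grad (g_fun \<beta> M) V = (1, - \<beta> *\<^sub>R gibbs M (snd V - 1))"
proof (rule grad_unique)
  have "((\<lambda>V::real \<times> (real^'n). snd V - 1) has_derivative snd) (at V)"
    by (rule has_derivative_eq_rhs[OF has_derivative_diff[OF has_derivative_snd[OF has_derivative_ident] has_derivative_const]]) simp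
  from has_derivative_compose[OF this phi_has_derivative[OF assms]]
  have "((\<lambda>V. phi M (snd V - 1)) has_derivative (\<lambda>h. gibbs M (snd V - 1) \<bullet> snd h)) (at V)" by simp
  from has_derivative_diff[OF has_derivative_fst[OF has_derivative_ident] has_derivative_mult_right[OF this]]
  have "((\<lambda>V. fst V - \<beta> * phi M (snd V - 1)) has_derivative (\<lambda>h. fst h - \<beta> * (gibbs M (snd V - 1) \<bullet> snd h))) (at V)" .
  moreover have "(g_fun \<beta> M :: real \<times> (real^'n) \<Rightarrow> real) = (\<lambda>V. fst V - \<beta> * phi M (snd V - 1))" by (simp add: g_fun_def fun_eq_iff split_beta)
  moreover have "(\<lambda>h. h \<bullet> (1, - \<beta> *\<^sub>R gibbs M (snd V - 1))) = (\<lambda>h. fst h - \<beta> * (gibbs M (snd V - 1) \<bullet> snd h))"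
    by (simp add: fun_eq_iff inner_prod_def inner_commute)
  ultimately show "GDERIV (g_fun \<beta> M) V :> (1, - \<beta> *\<^sub>R gibbs M (snd V - 1))"
    unfolding gderiv_def by simp
qed

text \<open>A concave function lies below its tangent at 0. Below, \<open>f\<close> is
  \<open>phi\<close> along a segment minus a comparison function with at least the same second
  derivative.\<close>

lemma taylor_upper:
  fixes f :: "real \<Rightarrow> real"
  assumes "0 \<le> g"
    and f: "\<And>s. 0 \<le> s \<Longrightarrow> s \<le> g \<Longrightarrow> (f has_real_derivative f' s) (at s)"
    and f': "\<And>s. 0 \<le> s \<Longrightarrow> s \<le> g \<Longrightarrow> (f' has_real_derivative f'' s) (at s)"
    and f'': "\<And>s. 0 \<le> s \<Longrightarrow> s \<le> g \<Longrightarrow> f'' s \<le> 0"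
  shows "f g \<le> f 0 + g * f' 0"
proof -
  have d: "f' s \<le> f' 0" if "0 \<le> s" "s \<le> g" for s
    by (rule DERIV_nonpos_imp_nonincreasing[OF that(1)]) (use that f' f'' in \<open>meson order_trans\<close>)
  have "(\<lambda>s. f s - s * f' 0) g \<le> (\<lambda>s. f s - s * f' 0) 0"
  proof (rule DERIV_nonpos_imp_nonincreasing[OF assms(1)])
    fix s assume s: "0 \<le> s" "s \<le> g"
    have "((\<lambda>s. f s - s * f' 0) has_real_derivative (f' s - f' 0)) (at s)"
      using f[OF s] by (auto intro!: derivative_eq_intros)
    then show "\<exists>y. ((\<lambda>s. f s - s * f' 0) has_real_derivative y) (at s) \<and> y \<le> 0" using d[OF s] by auto
  qed
  then show ?thesis by simp
qed

context
  fixes M :: real and v d :: "real^'n"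
  assumes M: "0 < M"
begin

lemma segment_derivs:
  defines "S \<equiv> (\<lambda>s. \<Sum>i\<in>UNIV. cosh (M * (v + s *\<^sub>R d) $ i))"
  shows "((\<lambda>s. phi M (v + s *\<^sub>R d)) has_real_derivative (gibbs M (v + s *\<^sub>R d) \<bullet> d)) (at s)"
    and "((\<lambda>s. gibbs M (v + s *\<^sub>R d) \<bullet> d) has_real_derivative
          M * gibbs_cov (\<lambda>i. M * (v + s *\<^sub>R d) $ i) (\<lambda>i. d $ i) (\<lambda>i. d $ i)) (at s)"
proof -
  have Spos: "0 < S s" for s unfolding S_def by (rule sum_cosh_pos)
  have 1: "(S has_real_derivative M * (\<Sum>i\<in>UNIV. sinh (M * (v + s *\<^sub>R d) $ i) * d $ i)) (at s)" for s
    unfolding S_def by (auto intro!: derivative_eq_intros simp: sum_distrib_left mult_ac)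
  have 2: "((\<lambda>s. \<Sum>i\<in>UNIV. sinh (M * (v + s *\<^sub>R d) $ i) * d $ i) has_real_derivative
      M * (\<Sum>i\<in>UNIV. cosh (M * (v + s *\<^sub>R d) $ i) * (d $ i * d $ i))) (at s)" for s
    by (auto intro!: derivative_eq_intros simp: sum_distrib_left mult_ac)
  have gd: "gibbs M (v + s *\<^sub>R d) \<bullet> d = (\<Sum>i\<in>UNIV. sinh (M * (v + s *\<^sub>R d) $ i) * d $ i) / S s" for s
    by (simp add: gibbs_def inner_vec_def S_def sum_divide_distrib)
  have "(phi M has_derivative (\<lambda>h. gibbs M (v + s *\<^sub>R d) \<bullet> h)) (at (v + s *\<^sub>R d))"
    using M by (intro phi_has_derivative) simp
  moreover have "((\<lambda>s. v + s *\<^sub>R d) has_derivative (\<lambda>h. h *\<^sub>R d)) (at s)"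
    by (rule has_derivative_eq_rhs[OF has_derivative_add[OF has_derivative_const has_derivative_scaleR_left[OF has_derivative_ident]]]) simp
  ultimately have "((\<lambda>s. phi M (v + s *\<^sub>R d)) has_derivative (\<lambda>h. gibbs M (v + s *\<^sub>R d) \<bullet> (h *\<^sub>R d))) (at s)"
    by (rule has_derivative_compose[rotated])
  then show "((\<lambda>s. phi M (v + s *\<^sub>R d)) has_real_derivative (gibbs M (v + s *\<^sub>R d) \<bullet> d)) (at s)"
    by (simp add: has_field_derivative_def mult.commute[of "gibbs _ _ \<bullet> _"] mult_commute_abs)
  show "((\<lambda>s. gibbs M (v + s *\<^sub>R d) \<bullet> d) has_real_derivative
          M * gibbs_cov (\<lambda>i. M * (v + s *\<^sub>R d) $ i) (\<lambda>i. d $ i) (\<lambda>i. d $ i)) (at s)"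
    unfolding gd
  proof (rule DERIV_cong[OF DERIV_divide[OF 2 1]])
    show "S s \<noteq> 0" using Spos[of s] by simp
    define a b where "a = (\<Sum>i\<in>UNIV. sinh (M * (v + s *\<^sub>R d) $ i) * d $ i)"
      and "b = (\<Sum>i\<in>UNIV. cosh (M * (v + s *\<^sub>R d) $ i) * (d $ i * d $ i))"
    have h: "gibbs_cov (\<lambda>i. M * (v + s *\<^sub>R d) $ i) (\<lambda>i. d $ i) (\<lambda>i. d $ i) = b / S s - a / S s * (a / S s)"
      unfolding gibbs_cov_def a_def b_def S_def ..
    show "(M * (\<Sum>i\<in>UNIV. cosh (M * (v + s *\<^sub>R d) $ i) * (d $ i * d $ i)) * S s
        - (\<Sum>i\<in>UNIV. sinh (M * (v + s *\<^sub>R d) $ i) * d $ i) * (M * (\<Sum>i\<in>UNIV. sinh (M * (v + s *\<^sub>R d) $ i) * d $ i))) / (S s * S s)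
       = M * gibbs_cov (\<lambda>i. M * (v + s *\<^sub>R d) $ i) (\<lambda>i. d $ i) (\<lambda>i. d $ i)"
      unfolding h a_def[symmetric] b_def[symmetric] using Spos[of s] by (simp add: field_simps)
  qed
qed

lemma phi_segment_le_quadratic:
  assumes "0 \<le> g" and c: "\<And>s. 0 \<le> s \<Longrightarrow> s \<le> g \<Longrightarrow> gibbs_cov (\<lambda>i. M * (v + s *\<^sub>R d) $ i) (\<lambda>i. d $ i) (\<lambda>i. d $ i) \<le> c"
  shows "phi M (v + g *\<^sub>R d) \<le> phi M v + g * (gibbs M v \<bullet> d) + M * c * g\<^sup>2 / 2"
proof -
  let ?h = "\<lambda>s. gibbs_cov (\<lambda>i. M * (v + s *\<^sub>R d) $ i) (\<lambda>i. d $ i) (\<lambda>i. d $ i)"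
  have "(\<lambda>s. phi M (v + s *\<^sub>R d) - M * c * s\<^sup>2 / 2) g
     \<le> (\<lambda>s. phi M (v + s *\<^sub>R d) - M * c * s\<^sup>2 / 2) 0 + g * (\<lambda>s. gibbs M (v + s *\<^sub>R d) \<bullet> d - M * c * s) 0"
  proof (rule taylor_upper[OF assms(1), where f'' = "\<lambda>s. M * ?h s - M * c"])
    fix s assume s: "0 \<le> s" "s \<le> g"
    show "((\<lambda>s. phi M (v + s *\<^sub>R d) - M * c * s\<^sup>2 / 2) has_real_derivative gibbs M (v + s *\<^sub>R d) \<bullet> d - M * c * s) (at s)"
      by (rule DERIV_diff[OF segment_derivs(1)]) (auto intro!: derivative_eq_intros)
    show "((\<lambda>s. gibbs M (v + s *\<^sub>R d) \<bullet> d - M * c * s) has_real_derivative M * ?h s - M * c) (at s)"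
      by (rule DERIV_diff[OF segment_derivs(2)]) (auto intro!: derivative_eq_intros)
    show "M * ?h s - M * c \<le> 0" using c[OF s] M by simp
  qed
  then show ?thesis by simp
qed

text \<open>The comparison function \<open>- ln (1 - s) - s\<close> vanishes to first order at 0 and
  has second derivative \<open>1 / (1 - s)^2\<close>.\<close>

lemma phi_segment_le_log:
  assumes g: "0 \<le> g" "g < 1"
    and c: "\<And>s. 0 \<le> s \<Longrightarrow> s \<le> g \<Longrightarrow> gibbs_cov (\<lambda>i. M * (v + s *\<^sub>R d) $ i) (\<lambda>i. d $ i) (\<lambda>i. d $ i) \<le> c / (1 - s)\<^sup>2"
  shows "phi M (v + g *\<^sub>R d) \<le> phi M v + g * (gibbs M v \<bullet> d) + M * c * (- ln (1 - g) - g)"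
proof -
  let ?h = "\<lambda>s. gibbs_cov (\<lambda>i. M * (v + s *\<^sub>R d) $ i) (\<lambda>i. d $ i) (\<lambda>i. d $ i)"
  have "(\<lambda>s. phi M (v + s *\<^sub>R d) - M * c * (- ln (1 - s) - s)) g
     \<le> (\<lambda>s. phi M (v + s *\<^sub>R d) - M * c * (- ln (1 - s) - s)) 0 + g * (\<lambda>s. gibbs M (v + s *\<^sub>R d) \<bullet> d - M * c * (1 / (1 - s) - 1)) 0"
  proof (rule taylor_upper[OF g(1), where f'' = "\<lambda>s. M * ?h s - M * c * (1 / (1 - s)\<^sup>2)"])
    fix s assume s: "0 \<le> s" "s \<le> g"
    then have s1: "s < 1" using g by simp
    show "((\<lambda>s. phi M (v + s *\<^sub>R d) - M * c * (- ln (1 - s) - s)) has_real_derivative gibbs M (v + s *\<^sub>R d) \<bullet> d - M * c * (1 / (1 - s) - 1)) (at s)"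
      by (rule DERIV_diff[OF segment_derivs(1)]) (use s1 in \<open>auto intro!: derivative_eq_intros simp: divide_simps\<close>)
    show "((\<lambda>s. gibbs M (v + s *\<^sub>R d) \<bullet> d - M * c * (1 / (1 - s) - 1)) has_real_derivative M * ?h s - M * c * (1 / (1 - s)\<^sup>2)) (at s)"
      by (rule DERIV_diff[OF segment_derivs(2)]) (use s1 in \<open>auto intro!: derivative_eq_intros simp: power2_eq_square\<close>)
    show "M * ?h s - M * c * (1 / (1 - s)\<^sup>2) \<le> 0"
      using mult_left_mono[OF c[OF s], of M] M by simp
  qed
  then show ?thesis by simp
qed

lemma phi_convex_lower: "phi M v + gibbs M v \<bullet> d \<le> phi M (v + d)"
proof -
  have "(\<lambda>s. - phi M (v + s *\<^sub>R d)) 1 \<le> (\<lambda>s. - phi M (v + s *\<^sub>R d)) 0 + 1 * (\<lambda>s. - (gibbs M (v + s *\<^sub>R d) \<bullet> d)) 0"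
  proof (rule taylor_upper[where f'' = "\<lambda>s. - (M * gibbs_cov (\<lambda>i. M * (v + s *\<^sub>R d) $ i) (\<lambda>i. d $ i) (\<lambda>i. d $ i))"])
    fix s
    show "((\<lambda>s. - phi M (v + s *\<^sub>R d)) has_real_derivative - (gibbs M (v + s *\<^sub>R d) \<bullet> d)) (at s)"
      by (rule DERIV_minus[OF segment_derivs(1)])
    show "((\<lambda>s. - (gibbs M (v + s *\<^sub>R d) \<bullet> d)) has_real_derivative
        - (M * gibbs_cov (\<lambda>i. M * (v + s *\<^sub>R d) $ i) (\<lambda>i. d $ i) (\<lambda>i. d $ i))) (at s)"
      by (rule DERIV_minus[OF segment_derivs(2)])
    show "- (M * gibbs_cov (\<lambda>i. M * (v + s *\<^sub>R d) $ i) (\<lambda>i. d $ i) (\<lambda>i. d $ i)) \<le> 0"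
      using mult_nonneg_nonneg[OF less_imp_le[OF M] gibbs_var_nonneg] by simp
  qed simp
  then show ?thesis by simp
qed

end

lemma abs_gibbs_le_1: "\<bar>gibbs M v $ i\<bar> \<le> 1"
proof -
  have "\<bar>sinh (M * v $ i)\<bar> \<le> cosh (M * v $ i)"
    using sinh_le_cosh_real[of "M * v $ i"] sinh_le_cosh_real[of "- (M * v $ i)"] by (simp add: abs_le_iff)
  also have "\<dots> \<le> (\<Sum>j\<in>UNIV. cosh (M * v $ j))" using member_le_sum[of i UNIV "\<lambda>i. cosh (M * v $ i)"] by simp
  finally show ?thesis using sum_cosh_pos[of "\<lambda>j. M * v $ j"] by (simp add: gibbs_def)
qed

lemma phi_ge_abs:
  assumes "0 < M"
  shows "\<bar>v $ i\<bar> \<le> phi M v"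
proof -
  have "exp \<bar>M * v $ i\<bar> \<le> 2 * cosh (M * v $ i)" by (simp add: cosh_field_def abs_if)
  also have "\<dots> \<le> 2 * (\<Sum>j\<in>UNIV. cosh (M * v $ j))" using member_le_sum[of i UNIV "\<lambda>i. cosh (M * v $ i)"] by simp
  finally have "\<bar>M * v $ i\<bar> \<le> ln (2 * (\<Sum>j\<in>UNIV. cosh (M * v $ j)))"
    using sum_cosh_pos[of "\<lambda>j. M * v $ j"] by (simp add: ln_ge_iff)
  then show ?thesis using assms sum_cosh_pos[of "\<lambda>j. M * v $ j"]
    by (simp add: phi_cosh ln_mult_pos abs_mult field_simps)
qed

lemma phi_zero: "phi M (0 :: real^'n) = ln (2 * real CARD('n)) / M"
  by (simp add: phi_cosh ln_mult_pos)

section \<open>Diagonal dominance against positive semidefinite matrices\<close>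

lemma psd_diag_nonneg: "psd X \<Longrightarrow> 0 \<le> X $ i $ i"
proof -
  assume "psd X"
  then have "0 \<le> axis i 1 \<bullet> (X *v axis i 1)" by (simp add: psd_def)
  then show ?thesis by (simp add: inner_axis' matrix_vector_mult_basis column_def)
qed

text \<open>Test the quadratic form with \<open>e_i + e_j\<close> and
  \<open>e_i - e_j\<close>.\<close>

lemma psd_offdiag_le:
  assumes "psd X"
  shows "2 * \<bar>X $ i $ j\<bar> \<le> X $ i $ i + X $ j $ j"
proof (cases "i = j")
  case True
  then show ?thesis using psd_diag_nonneg[OF assms, of i] by simp
next
  case False
  have a: "axis k 1 \<bullet> (X *v axis l 1) = X $ k $ l" for k l
    by (simp add: inner_axis' matrix_vector_mult_basis column_def)
  have s: "X $ j $ i = X $ i $ j" using assms by (auto simp: psd_def symmetric_matrix_nth)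
  have "0 \<le> (axis i 1 + c *\<^sub>R axis j 1) \<bullet> (X *v (axis i 1 + c *\<^sub>R axis j 1))" for c
    using assms by (simp add: psd_def)
  then have p: "0 \<le> X $ i $ i + 2 * c * X $ i $ j + c * c * X $ j $ j" for c
    by (simp add: inner_simps matrix_vector_right_distrib matrix_vector_mult_scaleR a s algebra_simps)
  show ?thesis using p[of 1] p[of "-1"] by (simp add: abs_if)
qed

text \<open>The off-diagonal part of \<open>C \<bullet> X\<close> is at most the diagonal part in
  absolute value: bound each \<open>X $ i $ j\<close> by the mean of two diagonal entries, use the
  symmetry of \<open>C\<close> to move all weight to the row index, and apply dominance row by row.
  For rank one \<open>X\<close> this says that \<open>C\<close> is positive semidefinite.\<close>

lemma dd_inner_bounds:
  fixes C :: "real^'n^'n"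
  assumes sym: "symmetric_matrix C" and C: "diagonally_dominant C" "\<And>i. 0 < C $ i $ i" and X: "psd X"
  shows "0 \<le> C \<bullet> X" "C \<bullet> X \<le> 2 * (\<Sum>i\<in>UNIV. C $ i $ i * X $ i $ i)"
proof -
  have row: "(\<Sum>j\<in>UNIV - {i}. \<bar>C $ i $ j\<bar>) \<le> C $ i $ i" for i
    using C(1) C(2)[of i] unfolding diagonally_dominant_def by (metis abs_of_pos)
  have split: "C \<bullet> X = (\<Sum>i\<in>UNIV. C $ i $ i * X $ i $ i) + (\<Sum>i\<in>UNIV. \<Sum>j\<in>UNIV - {i}. C $ i $ j * X $ i $ j)"
  proof -
    have "(\<Sum>j\<in>UNIV. C $ i $ j * X $ i $ j) = C $ i $ i * X $ i $ i + (\<Sum>j\<in>UNIV - {i}. C $ i $ j * X $ i $ j)" for i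
      by (rule sum.remove) auto
    then show ?thesis unfolding inner_matrix_def by (simp only: sum.distrib)
  qed
  \<comment> \<open>Filling the diagonal with zeros turns the punctured sums into full ones, so that
    the order of summation can be exchanged.\<close>
  define D where "D = (\<lambda>i j. if i = j then 0 else \<bar>C $ i $ j\<bar>)"
  have D: "(\<Sum>j\<in>UNIV - {i}. \<bar>C $ i $ j\<bar> * f j) = (\<Sum>j\<in>UNIV. D i j * f j)" for i f
    by (subst sum.remove[of UNIV i]) (auto simp: D_def intro!: sum.cong)
  have Dsym: "D i j = D j i" for i j using sym by (simp add: D_def symmetric_matrix_nth)
  have "\<bar>\<Sum>i\<in>UNIV. \<Sum>j\<in>UNIV - {i}. C $ i $ j * X $ i $ j\<bar> \<le> (\<Sum>i\<in>UNIV. \<Sum>j\<in>UNIV - {i}. \<bar>C $ i $ j\<bar> * ((X $ i $ i + X $ j $ j) / 2))"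
  proof (intro order_trans[OF sum_abs] sum_mono)
    fix i j
    show "\<bar>C $ i $ j * X $ i $ j\<bar> \<le> \<bar>C $ i $ j\<bar> * ((X $ i $ i + X $ j $ j) / 2)"
      using psd_offdiag_le[OF X, of i j] unfolding abs_mult by (intro mult_left_mono) auto
  qed
  also have "\<dots> = (\<Sum>i\<in>UNIV. \<Sum>j\<in>UNIV. D i j * (X $ i $ i / 2)) + (\<Sum>i\<in>UNIV. \<Sum>j\<in>UNIV. D i j * (X $ j $ j / 2))"
    unfolding D by (simp add: add_divide_distrib distrib_left sum.distrib)
  also have "(\<Sum>i\<in>UNIV. \<Sum>j\<in>UNIV. D i j * (X $ j $ j / 2)) = (\<Sum>i\<in>UNIV. \<Sum>j\<in>UNIV. D i j * (X $ i $ i / 2))"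
    by (subst sum.swap) (simp only: Dsym)
  also have "(\<Sum>i\<in>UNIV. \<Sum>j\<in>UNIV. D i j * (X $ i $ i / 2)) + \<dots> = (\<Sum>i\<in>UNIV. (\<Sum>j\<in>UNIV - {i}. \<bar>C $ i $ j\<bar> * 1) * X $ i $ i)"
    unfolding D by (simp add: sum_distrib_right flip: sum.distrib)
  also have "\<dots> \<le> (\<Sum>i\<in>UNIV. C $ i $ i * X $ i $ i)"
    using row psd_diag_nonneg[OF X] by (intro sum_mono mult_right_mono) (simp_all only: mult_1_right)
  finally show "0 \<le> C \<bullet> X" "C \<bullet> X \<le> 2 * (\<Sum>i\<in>UNIV. C $ i $ i * X $ i $ i)"
    unfolding split by linarith+
qed

section \<open>The penalized problem\<close>

definition obj :: "real^'n^'n \<Rightarrow> real \<Rightarrow> real \<Rightarrow> real^'n^'n \<Rightarrow> real" where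
  "obj C \<beta> M X = g_fun \<beta> M (B_op C X)"

definition Jmat :: "real^'n^'n \<Rightarrow> real \<Rightarrow> real \<Rightarrow> real^'n \<Rightarrow> real^'n^'n" where
  "Jmat C \<beta> M v = C - \<beta> *\<^sub>R diag_matrix (gibbs M (v - 1))"

lemma obj_eq: "obj C \<beta> M X = C \<bullet> X - \<beta> * phi M (diag_vec X - 1)"
  by (simp add: obj_def g_fun_def B_op_def)

lemma fw_grad_eq: "fw_M S \<noteq> 0 \<Longrightarrow> fw_grad S V = (1, - fw_beta S *\<^sub>R gibbs (fw_M S) (snd V - 1))"
  by (simp add: fw_grad_def grad_g_fun)

lemma diag_matrix_scale: "diag_matrix (c *\<^sub>R v) = c *\<^sub>R diag_matrix v"
  by (simp add: diag_matrix_def vec_eq_iff)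

lemma fw_J_eq: "fw_M S \<noteq> 0 \<Longrightarrow> fw_J S V = Jmat (fw_cost S) (fw_beta S) (fw_M S) (snd V)"
  by (simp add: fw_J_def fw_grad_eq adjoint_B_op Jmat_def diag_matrix_scale flip: scaleR_minus_left)

lemma fw_gap_eq:
  assumes "fw_M S \<noteq> 0"
  shows "(B_op (fw_cost S) H - B_op (fw_cost S) X) \<bullet> fw_grad S (B_op (fw_cost S) X)
    = Jmat (fw_cost S) (fw_beta S) (fw_M S) (diag_vec X) \<bullet> (H - X)"
  unfolding fw_grad_eq[OF assms] Jmat_def B_op_linear_simps(3)[symmetric]
  by (simp add: B_op_def inner_diff_left inner_diag_matrix) (simp add: inner_commute)

lemma symmetric_Jmat: "symmetric_matrix C \<Longrightarrow> symmetric_matrix (Jmat C \<beta> M v)"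
  by (auto simp: symmetric_matrix_nth Jmat_def diag_matrix_def)

section \<open>The feasible set\<close>

lemma diag_le_trace:
  assumes "psd X"
  shows "X $ i $ i \<le> trace X"
  unfolding trace_def using psd_diag_nonneg[OF assms] by (intro member_le_sum) auto

lemma feasible_diag: "X \<in> feasible \<Longrightarrow> 0 \<le> X $ i $ i" "X \<in> feasible \<Longrightarrow> X $ i $ i \<le> real CARD('n)"
  for X :: "real^'n^'n"
  using psd_diag_nonneg[of X i] diag_le_trace[of X i] by (auto simp: feasible_def)

lemma psd_rank_one: "psd (rank_one w)"
proof -
  have "x \<bullet> (rank_one w *v x) = (w \<bullet> x)\<^sup>2" for x
  proof -
    have "rank_one w *v x = (w \<bullet> x) *\<^sub>R w"
      by (simp add: vec_eq_iff matrix_vector_mult_def rank_one_def inner_vec_def sum_distrib_left mult_ac)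
    then show ?thesis by (simp add: power2_eq_square inner_commute)
  qed
  then show ?thesis by (simp add: psd_def symmetric_matrix_rank_one)
qed

lemma trace_rank_one: "trace (rank_one w) = w \<bullet> w"
  by (simp add: trace_def rank_one_def inner_vec_def)

lemma psd_combine: "psd X \<Longrightarrow> psd Y \<Longrightarrow> 0 \<le> a \<Longrightarrow> 0 \<le> b \<Longrightarrow> psd (a *\<^sub>R X + b *\<^sub>R Y)"
  by (simp add: psd_def symmetric_matrix_add symmetric_matrix_scale matrix_vector_mult_add_rdistrib
      inner_add_right flip: scaleR_matrix_vector_assoc)

lemma trace_combine: "trace (a *\<^sub>R X + b *\<^sub>R Y) = a * trace X + b * trace Y" for X Y :: "real^'n^'n"
  by (simp add: trace_def sum.distrib sum_distrib_left)

lemma feasible_convex: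
  assumes "X \<in> feasible" "Y \<in> feasible" "0 \<le> g" "g \<le> 1"
  shows "(1 - g) *\<^sub>R X + g *\<^sub>R Y \<in> feasible"
proof -
  have "(1 - g) * trace X + g * trace Y \<le> (1 - g) * real CARD('a) + g * real CARD('a)"
    using assms by (intro add_mono mult_left_mono) (auto simp: feasible_def)
  also have "\<dots> = real CARD('a)" by (simp add: algebra_simps)
  finally show ?thesis using assms psd_combine[of X Y "1 - g" g] by (simp add: feasible_def trace_combine)
qed

lemma feasible_zero: "0 \<in> feasible"
  by (simp add: feasible_def psd_def symmetric_matrix_nth trace_def)

lemma feasible_rank_one: "w \<bullet> w \<le> 1 \<Longrightarrow> real CARD('n) *\<^sub>R rank_one w \<in> feasible" for w :: "real^'n"
  using psd_combine[OF psd_rank_one[of w] psd_rank_one[of w], of "real CARD('n)" 0]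
    trace_combine[of "real CARD('n)" "rank_one w" 0 "rank_one w"]
  by (simp add: feasible_def trace_rank_one mult_le_cancel_left2)

lemma feasible_mat_1: "(mat 1 :: real^'n^'n) \<in> feasible"
  by (auto simp: feasible_def psd_def symmetric_matrix_nth trace_def mat_def matrix_vector_mul_lid[unfolded mat_def])

lemma feasible_fw_H: "w \<bullet> w \<le> 1 \<Longrightarrow> fw_H J w \<in> feasible"
  by (simp add: fw_H_def feasible_rank_one feasible_zero)

lemma diag_vec_segment:
  "diag_vec ((1 - g) *\<^sub>R X + g *\<^sub>R H) - 1 = (diag_vec X - 1) + g *\<^sub>R diag_vec (H - X)"
  by (simp add: vec_eq_iff diag_vec_def algebra_simps)

lemma obj_segment:
  "obj C \<beta> M ((1 - g) *\<^sub>R X + g *\<^sub>R H)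
     = C \<bullet> X + g * (C \<bullet> (H - X)) - \<beta> * phi M ((diag_vec X - 1) + g *\<^sub>R diag_vec (H - X))"
  unfolding obj_eq diag_vec_segment by (simp add: inner_simps algebra_simps)

lemma inner_Jmat: "Jmat C \<beta> M v \<bullet> X = C \<bullet> X - \<beta> * (gibbs M (v - 1) \<bullet> diag_vec X)"
  by (simp add: Jmat_def inner_diff_left inner_diag_matrix)

lemma obj_step_quadratic:
  fixes X H :: "real^'n^'n"
  assumes M: "0 < M" and \<beta>: "0 \<le> \<beta>" and X: "X \<in> feasible" and H: "H \<in> feasible" and g: "0 \<le> g"
  shows "obj C \<beta> M X + g * (Jmat C \<beta> M (diag_vec X) \<bullet> (H - X)) - \<beta> * M * (real CARD('n))\<^sup>2 * g\<^sup>2 / 2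
    \<le> obj C \<beta> M ((1 - g) *\<^sub>R X + g *\<^sub>R H)"
proof -
  let ?v = "diag_vec X - 1" and ?d = "diag_vec (H - X)"
  have "\<bar>?d $ i\<bar> \<le> real CARD('n)" for i
    using feasible_diag[OF X, of i] feasible_diag[OF H, of i] by (simp add: diag_vec_def)
  then have "phi M (?v + g *\<^sub>R ?d) \<le> phi M ?v + g * (gibbs M ?v \<bullet> ?d) + M * (real CARD('n))\<^sup>2 * g\<^sup>2 / 2"
    by (intro phi_segment_le_quadratic[OF M g] gibbs_var_le_sup)
  from mult_left_mono[OF this \<beta>] show ?thesis
    unfolding obj_segment unfolding obj_eq inner_Jmat by (simp add: algebra_simps)
qed

text \<open>At the point reached after \<open>s\<close>, the vector to the end point of the segment
  is \<open>1 - s\<close> times the whole direction. \<open>gibbs_var_direction\<close> applies to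
  that remainder, so the variance of the direction itself is bounded after division by
  \<open>(1 - s)^2\<close>. Total mass \<open>n\<close> or 0 of the diagonal of \<open>H\<close> is
  what \<open>gibbs_var_simplex\<close> asks for.\<close>

lemma obj_step_log:
  fixes X H :: "real^'n^'n"
  assumes n: "2 \<le> CARD('n)" and M: "12 * ln (2 * real CARD('n)) \<le> M" and \<beta>: "0 \<le> \<beta>"
    and H: "\<And>i. 0 \<le> H $ i $ i" "trace H = real CARD('n) \<or> H = 0" and g: "0 \<le> g" "g < 1"
  shows "obj C \<beta> M X + g * (Jmat C \<beta> M (diag_vec X) \<bullet> (H - X))
      - \<beta> * M * (28 / 100 * (real CARD('n))\<^sup>2) * (- ln (1 - g) - g)
    \<le> obj C \<beta> M ((1 - g) *\<^sub>R X + g *\<^sub>R H)"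
proof -
  let ?v = "diag_vec X - 1" and ?d = "diag_vec (H - X)"
  have "0 < ln (2 * real CARD('n))" using n by (intro ln_gt_zero) simp
  then have M0: "0 < M" using M by linarith
  have "gibbs_cov (\<lambda>i. M * (?v + s *\<^sub>R ?d) $ i) (\<lambda>i. ?d $ i) (\<lambda>i. ?d $ i) \<le> 28 / 100 * (real CARD('n))\<^sup>2 / (1 - s)\<^sup>2"
    if s: "0 \<le> s" "s \<le> g" for s
  proof -
    have s1: "s < 1" using s g by simp
    have q: "(\<lambda>i. H $ i $ i - 1 - (?v + s *\<^sub>R ?d) $ i) = (\<lambda>i. (1 - s) * ?d $ i)"
      by (auto simp: diag_vec_def algebra_simps)
    have "gibbs_cov (\<lambda>i. M * (?v + s *\<^sub>R ?d) $ i) (\<lambda>i. H $ i $ i - 1 - (?v + s *\<^sub>R ?d) $ i) (\<lambda>i. H $ i $ i - 1 - (?v + s *\<^sub>R ?d) $ i)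
       \<le> 28 / 100 * (real CARD('n))\<^sup>2"
      by (rule gibbs_var_direction[OF n M]) (use H in \<open>auto simp: trace_def\<close>)
    then have "(1 - s)\<^sup>2 * gibbs_cov (\<lambda>i. M * (?v + s *\<^sub>R ?d) $ i) (\<lambda>i. ?d $ i) (\<lambda>i. ?d $ i) \<le> 28 / 100 * (real CARD('n))\<^sup>2"
      unfolding q gibbs_cov_scale gibbs_cov_scale2 by (simp add: power2_eq_square mult.assoc)
    then show ?thesis using s1 by (simp add: pos_le_divide_eq mult.commute)
  qed
  then have "phi M (?v + g *\<^sub>R ?d) \<le> phi M ?v + g * (gibbs M ?v \<bullet> ?d) + M * (28 / 100 * (real CARD('n))\<^sup>2) * (- ln (1 - g) - g)"
    by (intro phi_segment_le_log[OF M0 g])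
  from mult_left_mono[OF this \<beta>] show ?thesis
    unfolding obj_segment unfolding obj_eq inner_Jmat by (simp add: algebra_simps)
qed

lemma obj_concave:
  assumes M: "0 < M" and \<beta>: "0 \<le> \<beta>"
  shows "obj C \<beta> M Y \<le> obj C \<beta> M X + Jmat C \<beta> M (diag_vec X) \<bullet> (Y - X)"
proof -
  have "phi M (diag_vec X - 1) + gibbs M (diag_vec X - 1) \<bullet> diag_vec (Y - X) \<le> phi M ((diag_vec X - 1) + diag_vec (Y - X))"
    by (rule phi_convex_lower[OF M])
  also have "(diag_vec X - 1) + diag_vec (Y - X) = diag_vec Y - 1" by (simp add: vec_eq_iff diag_vec_def)
  finally show ?thesis
    using mult_left_mono[OF _ \<beta>] unfolding obj_eq inner_Jmat by (fastforce simp: inner_simps algebra_simps)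
qed

section \<open>Bounds for a diagonally dominant cost matrix\<close>

context
  fixes C :: "real^'n^'n" and \<beta> M :: real
  assumes sym: "symmetric_matrix C" and dd: "diagonally_dominant C" and pos: "\<And>i. 0 < C $ i $ i"
    and \<beta>: "\<beta> = 4 * trace C" and M: "0 < M"
begin

lemma trace_pos: "0 < trace C"
  unfolding trace_def using pos by (intro sum_pos) auto

lemma diag_le_trace_C: "C $ i $ i \<le> trace C"
  unfolding trace_def using pos by (intro member_le_sum) (auto intro: less_imp_le)

lemma quadratic_bounds: "0 \<le> x \<bullet> (C *v x)" "x \<bullet> (C *v x) \<le> 2 * trace C * (x \<bullet> x)"
proof -
  have "C \<bullet> rank_one x \<le> 2 * (\<Sum>i\<in>UNIV. C $ i $ i * rank_one x $ i $ i)"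
    by (rule dd_inner_bounds[OF sym dd pos psd_rank_one])
  also have "\<dots> \<le> 2 * (\<Sum>i\<in>UNIV. trace C * rank_one x $ i $ i)"
    using diag_le_trace_C by (intro mult_left_mono sum_mono mult_right_mono) (auto simp: rank_one_def)
  also have "\<dots> = 2 * trace C * (x \<bullet> x)" by (simp add: rank_one_def inner_vec_def sum_distrib_left mult.assoc)
  finally show "x \<bullet> (C *v x) \<le> 2 * trace C * (x \<bullet> x)" by (simp add: inner_rank_one)
  show "0 \<le> x \<bullet> (C *v x)" using dd_inner_bounds(1)[OF sym dd pos psd_rank_one, of x] by (simp add: inner_rank_one)
qed

lemma inner_le_diag_bound:
  assumes "psd X" "\<And>i. X $ i $ i \<le> m"
  shows "C \<bullet> X \<le> 2 * m * trace C"
proof -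
  have "C \<bullet> X \<le> 2 * (\<Sum>i\<in>UNIV. C $ i $ i * X $ i $ i)" by (rule dd_inner_bounds[OF sym dd pos assms(1)])
  also have "\<dots> \<le> 2 * (\<Sum>i\<in>UNIV. C $ i $ i * m)"
    using assms(2) pos by (intro mult_left_mono sum_mono) (auto intro: less_imp_le)
  also have "\<dots> = 2 * m * trace C" by (simp add: trace_def sum_distrib_left mult_ac)
  finally show ?thesis .
qed

text \<open>The 6 is 2 from \<open>C\<close> by dominance plus 4 from \<open>\<beta>\<close>, as the
  entries of the Gibbs vector are at most 1 in absolute value.\<close>

lemma abs_eigenvalue_Jmat_le: "abs_eigenvalue_max (Jmat C \<beta> M v) \<le> 6 * trace C"
proof (rule abs_eigenvalue_max_le[OF symmetric_Jmat[OF sym]])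
  fix x :: "real^'n"
  let ?g = "gibbs M (v - 1)"
  have e: "x \<bullet> (Jmat C \<beta> M v *v x) = x \<bullet> (C *v x) - \<beta> * (?g \<bullet> diag_vec (rank_one x))"
    unfolding inner_rank_one[symmetric] inner_Jmat ..
  have "\<bar>?g \<bullet> diag_vec (rank_one x)\<bar> \<le> (\<Sum>i\<in>UNIV. \<bar>?g $ i * (x $ i * x $ i)\<bar>)"
    by (simp add: inner_vec_def diag_vec_def rank_one_def)
  also have "\<dots> \<le> (\<Sum>i\<in>UNIV. 1 * (x $ i * x $ i))"
    using abs_gibbs_le_1[of M "v - 1"] by (intro sum_mono) (auto simp: abs_mult intro!: mult_left_le_one_le)
  also have "\<dots> = x \<bullet> x" by (simp add: inner_vec_def)
  finally have "\<bar>\<beta> * (?g \<bullet> diag_vec (rank_one x))\<bar> \<le> 4 * trace C * (x \<bullet> x)"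
    using trace_pos unfolding abs_mult \<beta> by (intro mult_mono) auto
  then show "\<bar>x \<bullet> (Jmat C \<beta> M v *v x)\<bar> \<le> 6 * trace C * (x \<bullet> x)"
    unfolding e using quadratic_bounds[of x] by (simp add: algebra_simps)
qed

text \<open>A nonpositive \<open>J\<close> would force every diagonal entry of \<open>X\<close> above 1, against the trace bound.\<close>
lemma lambda_max_Jmat_pos:
  assumes X: "X \<in> feasible"
  shows "0 < lambda_max (Jmat C \<beta> M (diag_vec X))"
proof (rule ccontr)
  assume neg: "\<not> 0 < lambda_max (Jmat C \<beta> M (diag_vec X))"
  have "1 < X $ i $ i" for i
  proof -
    let ?J = "Jmat C \<beta> M (diag_vec X)"
    let ?e = "axis i 1 :: real^'n"
    have "?e \<bullet> (?J *v ?e) \<le> lambda_max ?J * (?e \<bullet> ?e)"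
      by (rule quadratic_le_lambda_max[OF symmetric_Jmat[OF sym]])
    then have "?J $ i $ i \<le> 0" using neg by (simp add: inner_axis' matrix_vector_mult_basis column_def inner_axis_axis)
    then have "C $ i $ i \<le> \<beta> * gibbs M (diag_vec X - 1) $ i" by (simp add: Jmat_def diag_matrix_def)
    then have "0 < \<beta> * gibbs M (diag_vec X - 1) $ i" using pos[of i] by linarith
    then have "0 < gibbs M (diag_vec X - 1) $ i" using trace_pos by (simp add: \<beta> zero_less_mult_iff)
    then have "0 < sinh (M * (X $ i $ i - 1))"
      using sum_cosh_pos[of "\<lambda>j. M * (diag_vec X - 1) $ j"] by (simp add: gibbs_def zero_less_divide_iff diag_vec_def)
    then show ?thesis using M by (simp add: zero_less_mult_iff)
  qed
  then have "(\<Sum>i\<in>(UNIV::'n set). 1) < trace X" unfolding trace_def by (intro sum_strict_mono) auto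
  then show False using X by (simp add: feasible_def)
qed

lemma obj_le: 
  assumes "X \<in> feasible"
  shows "obj C \<beta> M X \<le> 2 * real CARD('n) * trace C"
proof -
  have "0 \<le> \<beta> * phi M (diag_vec X - 1)"
    using phi_ge_abs[OF M, of "diag_vec X - 1" undefined] trace_pos by (simp add: \<beta>)
  moreover have "C \<bullet> X \<le> 2 * real CARD('n) * trace C"
    using assms by (intro inner_le_diag_bound) (auto simp: feasible_diag feasible_def[of])
  ultimately show ?thesis by (simp add: obj_eq)
qed

end

section \<open>Linear images of Gaussian vectors\<close>

definition gauss :: "real measure" where
  "gauss = density lborel (\<lambda>x. ennreal (std_normal_density x))"

lemma sets_gauss[measurable_cong, simp]: "sets gauss = sets borel"
  and space_gauss[simp]: "space gauss = UNIV"
  by (simp_all add: gauss_def)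

lemma prob_space_gauss: "prob_space gauss"
  unfolding gauss_def by (rule prob_space_normal_density) simp

interpretation gauss: prob_space gauss by (rule prob_space_gauss)
interpretation gauss_pair: pair_prob_space gauss gauss ..
interpretation gauss_product: product_prob_space "\<lambda>_::'i. gauss" UNIV ..

lemma nn_integral_gauss:
  "f \<in> borel_measurable borel \<Longrightarrow> (\<integral>\<^sup>+x. f x \<partial>gauss) = (\<integral>\<^sup>+x. ennreal (std_normal_density x) * f x \<partial>lborel)"
  unfolding gauss_def by (subst nn_integral_density) auto

lemma nn_integral_gauss_pair:
  assumes [measurable]: "H \<in> borel_measurable (borel \<Otimes>\<^sub>M borel)"
  shows "(\<integral>\<^sup>+x. \<integral>\<^sup>+y. H (x, y) \<partial>gauss \<partial>gauss)
    = (\<integral>\<^sup>+x. \<integral>\<^sup>+y. ennreal (exp (- (x\<^sup>2 + y\<^sup>2) / 2) / (2 * pi)) * H (x, y) \<partial>lborel \<partial>lborel)"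
proof -
  have e: "std_normal_density x * std_normal_density y = exp (- (x\<^sup>2 + y\<^sup>2) / 2) / (2 * pi)" for x y
    by (simp add: std_normal_density_def add_divide_distrib exp_add[symmetric] flip: real_sqrt_mult)
  have "(\<integral>\<^sup>+x. \<integral>\<^sup>+y. H (x, y) \<partial>gauss \<partial>gauss)
     = (\<integral>\<^sup>+x. ennreal (std_normal_density x) * (\<integral>\<^sup>+y. ennreal (std_normal_density y) * H (x, y) \<partial>lborel) \<partial>lborel)"
    by (simp add: nn_integral_gauss)
  also have "\<dots> = (\<integral>\<^sup>+x. \<integral>\<^sup>+y. ennreal (std_normal_density x) * (ennreal (std_normal_density y) * H (x, y)) \<partial>lborel \<partial>lborel)"
    by (subst nn_integral_cmult) auto
  finally show ?thesis by (simp add: mult.assoc[symmetric] e flip: ennreal_mult)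
qed

text \<open>A rotation with \<open>c \<noteq> 0\<close> is a composition of two affine substitutions
  in one variable each, with Jacobians \<open>1 / c\<close> and \<open>c\<close> that cancel; Fubini
  exchanges the variables in between. For \<open>c = 0\<close> the rotation is an exchange of the
  variables up to signs.\<close>

lemma lborel_rotation:
  fixes c s :: real
  assumes [measurable]: "K \<in> borel_measurable (borel \<Otimes>\<^sub>M borel)" and cs: "c\<^sup>2 + s\<^sup>2 = 1"
  shows "(\<integral>\<^sup>+x. \<integral>\<^sup>+y. K (c * x - s * y, s * x + c * y) \<partial>lborel \<partial>lborel) = (\<integral>\<^sup>+x. \<integral>\<^sup>+y. K (x, y) \<partial>lborel \<partial>lborel)"
proof -
  have swap: "(\<integral>\<^sup>+x. \<integral>\<^sup>+y. f (x, y) \<partial>lborel \<partial>lborel) = (\<integral>\<^sup>+y. \<integral>\<^sup>+x. f (x, y) \<partial>lborel \<partial>lborel)"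
    if [measurable]: "f \<in> borel_measurable (borel \<Otimes>\<^sub>M borel)" for f :: "real \<times> real \<Rightarrow> ennreal"
    using lborel_pair.Fubini'[of "\<lambda>x y. f (x, y)"] by simp
  show ?thesis
  proof (cases "c = 0")
    case True
    then have s: "s\<^sup>2 = 1" "\<bar>s\<bar> = 1" "s * s = 1" using cs by (auto simp: power2_eq_1_iff)
    have "(\<integral>\<^sup>+x. \<integral>\<^sup>+y. K (x, y) \<partial>lborel \<partial>lborel) = (\<integral>\<^sup>+u. \<integral>\<^sup>+x. K (u, s * x) \<partial>lborel \<partial>lborel)"
    proof (rule nn_integral_cong)
      fix u show "(\<integral>\<^sup>+v. K (u, v) \<partial>lborel) = (\<integral>\<^sup>+x. K (u, s * x) \<partial>lborel)"
        using nn_integral_real_affine[of "\<lambda>v. K (u, v)" s 0] s by auto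
    qed
    also have "\<dots> = (\<integral>\<^sup>+x. \<integral>\<^sup>+u. K (u, s * x) \<partial>lborel \<partial>lborel)"
      using swap[of "\<lambda>(u, x). K (u, s * x)"] by simp
    also have "\<dots> = (\<integral>\<^sup>+x. \<integral>\<^sup>+y. K (- s * y, s * x) \<partial>lborel \<partial>lborel)"
    proof (rule nn_integral_cong)
      fix x show "(\<integral>\<^sup>+u. K (u, s * x) \<partial>lborel) = (\<integral>\<^sup>+y. K (- s * y, s * x) \<partial>lborel)"
        using nn_integral_real_affine[of "\<lambda>u. K (u, s * x)" "- s" 0] s by auto
    qed
    finally show ?thesis using True by simp
  next
    case False
    have "(\<integral>\<^sup>+u. \<integral>\<^sup>+v. K (u, v) \<partial>lborel \<partial>lborel) = (\<integral>\<^sup>+u. ennreal \<bar>1 / c\<bar> * (\<integral>\<^sup>+y. K (u, s / c * u + 1 / c * y) \<partial>lborel) \<partial>lborel)"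
      using False by (intro nn_integral_cong nn_integral_real_affine) auto
    also have "\<dots> = ennreal \<bar>1 / c\<bar> * (\<integral>\<^sup>+u. \<integral>\<^sup>+y. K (u, s / c * u + 1 / c * y) \<partial>lborel \<partial>lborel)"
      by (rule nn_integral_cmult) measurable
    also have "(\<integral>\<^sup>+u. \<integral>\<^sup>+y. K (u, s / c * u + 1 / c * y) \<partial>lborel \<partial>lborel) = (\<integral>\<^sup>+y. \<integral>\<^sup>+u. K (u, s / c * u + 1 / c * y) \<partial>lborel \<partial>lborel)"
      using swap[of "\<lambda>(u, y). K (u, s / c * u + 1 / c * y)"] by simp
    also have "\<dots> = (\<integral>\<^sup>+y. ennreal \<bar>c\<bar> * (\<integral>\<^sup>+x. K (- s * y + c * x, s / c * (- s * y + c * x) + 1 / c * y) \<partial>lborel) \<partial>lborel)"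
      using False by (intro nn_integral_cong nn_integral_real_affine) auto
    also have "\<dots> = ennreal \<bar>c\<bar> * (\<integral>\<^sup>+y. \<integral>\<^sup>+x. K (- s * y + c * x, s / c * (- s * y + c * x) + 1 / c * y) \<partial>lborel \<partial>lborel)"
      by (rule nn_integral_cmult) measurable
    also have "(\<integral>\<^sup>+y. \<integral>\<^sup>+x. K (- s * y + c * x, s / c * (- s * y + c * x) + 1 / c * y) \<partial>lborel \<partial>lborel)
        = (\<integral>\<^sup>+y. \<integral>\<^sup>+x. K (c * x - s * y, s * x + c * y) \<partial>lborel \<partial>lborel)"
    proof -
      have "s / c * (- s * y + c * x) + 1 / c * y = s * x + c * y" for x y
      proof -
        have "s / c * (- s * y + c * x) + 1 / c * y = s * x + ((1 - s\<^sup>2) / c) * y"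
          using False by (simp add: field_simps power2_eq_square)
        also have "(1 - s\<^sup>2) / c = c" using cs False by (simp add: field_simps power2_eq_square)
        finally show ?thesis .
      qed
      then show ?thesis by (simp add: algebra_simps)
    qed
    also have "\<dots> = (\<integral>\<^sup>+x. \<integral>\<^sup>+y. K (c * x - s * y, s * x + c * y) \<partial>lborel \<partial>lborel)"
      using swap[of "\<lambda>(x, y). K (c * x - s * y, s * x + c * y)"] by simp
    finally have "(\<integral>\<^sup>+u. \<integral>\<^sup>+v. K (u, v) \<partial>lborel \<partial>lborel)
      = (ennreal \<bar>1 / c\<bar> * ennreal \<bar>c\<bar>) * (\<integral>\<^sup>+x. \<integral>\<^sup>+y. K (c * x - s * y, s * x + c * y) \<partial>lborel \<partial>lborel)"
      by (simp add: mult.assoc)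
    also have "ennreal \<bar>1 / c\<bar> * ennreal \<bar>c\<bar> = 1" using False by (simp flip: ennreal_mult add: abs_mult[symmetric])
    finally show ?thesis by simp
  qed
qed

lemma gauss_rotation:
  assumes [measurable]: "H \<in> borel_measurable (borel \<Otimes>\<^sub>M borel)" and cs: "c\<^sup>2 + s\<^sup>2 = 1"
  shows "(\<integral>\<^sup>+x. \<integral>\<^sup>+y. H (c * x - s * y, s * x + c * y) \<partial>gauss \<partial>gauss) = (\<integral>\<^sup>+x. \<integral>\<^sup>+y. H (x, y) \<partial>gauss \<partial>gauss)"
proof -
  define K where "K = (\<lambda>(x, y). ennreal (exp (- (x\<^sup>2 + y\<^sup>2) / 2) / (2 * pi)) * H (x, y))"
  have [measurable]: "K \<in> borel_measurable (borel \<Otimes>\<^sub>M borel)" unfolding K_def by measurable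
  have inv: "(c * x - s * y)\<^sup>2 + (s * x + c * y)\<^sup>2 = x\<^sup>2 + y\<^sup>2" for x y
  proof -
    have "(c * x - s * y)\<^sup>2 + (s * x + c * y)\<^sup>2 = (c\<^sup>2 + s\<^sup>2) * (x\<^sup>2 + y\<^sup>2)"
      by (simp add: power2_eq_square algebra_simps)
    then show ?thesis using cs by simp
  qed
  have "(\<integral>\<^sup>+x. \<integral>\<^sup>+y. H (c * x - s * y, s * x + c * y) \<partial>gauss \<partial>gauss)
    = (\<integral>\<^sup>+x. \<integral>\<^sup>+y. K (c * x - s * y, s * x + c * y) \<partial>lborel \<partial>lborel)"
  proof -
    have "(\<lambda>(x, y). H (c * x - s * y, s * x + c * y)) \<in> borel_measurable (borel \<Otimes>\<^sub>M borel)" by measurable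
    from nn_integral_gauss_pair[OF this] show ?thesis by (simp only: K_def case_prod_conv inv)
  qed
  also have "\<dots> = (\<integral>\<^sup>+x. \<integral>\<^sup>+y. K (x, y) \<partial>lborel \<partial>lborel)" by (rule lborel_rotation) (use cs in auto)
  also have "\<dots> = (\<integral>\<^sup>+x. \<integral>\<^sup>+y. H (x, y) \<partial>gauss \<partial>gauss)"
    by (subst nn_integral_gauss_pair) (auto simp: K_def)
  finally show ?thesis .
qed

text \<open>Rotate the plane so that \<open>(\<mu>, \<nu>)\<close> points along the first axis; the
  integrand then ignores the second variable.\<close>

lemma gauss_combine:
  fixes \<mu> \<nu> :: real
  assumes [measurable]: "f \<in> borel_measurable borel"
  shows "(\<integral>\<^sup>+x. \<integral>\<^sup>+y. f (\<mu> * x + \<nu> * y) \<partial>gauss \<partial>gauss) = (\<integral>\<^sup>+x. f (sqrt (\<mu>\<^sup>2 + \<nu>\<^sup>2) * x) \<partial>gauss)"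
proof (cases "\<mu>\<^sup>2 + \<nu>\<^sup>2 = 0")
  case True
  then show ?thesis using gauss.emeasure_space_1 by (auto simp: sum_power2_eq_zero_iff)
next
  case False
  define r where "r = sqrt (\<mu>\<^sup>2 + \<nu>\<^sup>2)"
  have r: "r \<noteq> 0" "r\<^sup>2 = \<mu>\<^sup>2 + \<nu>\<^sup>2" using False by (auto simp: r_def)
  have cs: "(\<mu> / r)\<^sup>2 + (\<nu> / r)\<^sup>2 = 1" using r False by (simp add: power_divide flip: add_divide_distrib)
  have m: "\<mu> * (\<mu> / r * x - \<nu> / r * y) + \<nu> * (\<nu> / r * x + \<mu> / r * y) = r * x" for x y
  proof -
    have "\<mu> * (\<mu> / r * x - \<nu> / r * y) + \<nu> * (\<nu> / r * x + \<mu> / r * y) = (\<mu>\<^sup>2 + \<nu>\<^sup>2) / r * x"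
      by (simp add: power2_eq_square algebra_simps add_divide_distrib)
    also have "(\<mu>\<^sup>2 + \<nu>\<^sup>2) / r = r" using r(1) unfolding r(2)[symmetric] by (simp add: power2_eq_square)
    finally show ?thesis .
  qed
  have "(\<integral>\<^sup>+x. \<integral>\<^sup>+y. f (\<mu> * x + \<nu> * y) \<partial>gauss \<partial>gauss) = (\<integral>\<^sup>+x. \<integral>\<^sup>+y. f (r * x) \<partial>gauss \<partial>gauss)"
  proof -
    have "(\<lambda>(x, y). f (\<mu> * x + \<nu> * y)) \<in> borel_measurable (borel \<Otimes>\<^sub>M borel)" by measurable
    from gauss_rotation[OF this cs] show ?thesis by (simp only: case_prod_conv m)
  qed
  then show ?thesis using gauss.emeasure_space_1 by (simp add: r_def)
qed

lemma gauss_swap: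
  assumes [measurable]: "H \<in> borel_measurable (borel \<Otimes>\<^sub>M borel)"
  shows "(\<integral>\<^sup>+x. \<integral>\<^sup>+y. H (x, y) \<partial>gauss \<partial>gauss) = (\<integral>\<^sup>+y. \<integral>\<^sup>+x. H (x, y) \<partial>gauss \<partial>gauss)"
  using gauss_pair.Fubini'[of "\<lambda>x y. H (x, y)"] by simp

text \<open>Induction over \<open>I\<close>: each new summand is absorbed by a rotation of the plane. The coefficients are those of the
  Cholesky factor of the Gram matrix of \<open>a\<close> and \<open>b\<close>.\<close>

lemma linear_pair_law:
  fixes a b :: "'i \<Rightarrow> real"
  assumes "finite I"
  shows "\<exists>\<alpha> \<beta> \<delta>. 0 \<le> \<alpha> \<and> 0 \<le> \<delta> \<and> \<alpha>\<^sup>2 = (\<Sum>i\<in>I. (a i)\<^sup>2) \<and> \<alpha> * \<beta> = (\<Sum>i\<in>I. a i * b i)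
    \<and> \<beta>\<^sup>2 + \<delta>\<^sup>2 = (\<Sum>i\<in>I. (b i)\<^sup>2)
    \<and> (\<forall>F\<in>borel_measurable (borel \<Otimes>\<^sub>M borel).
        (\<integral>\<^sup>+g. F (\<Sum>i\<in>I. a i * g i, \<Sum>i\<in>I. b i * g i) \<partial>PiM I (\<lambda>_. gauss))
        = (\<integral>\<^sup>+x. \<integral>\<^sup>+y. F (\<alpha> * x, \<beta> * x + \<delta> * y) \<partial>gauss \<partial>gauss))"
  using assms
proof (induction I rule: finite_induct)
  case empty
  show ?case
  proof (intro exI[of _ 0] conjI ballI)
    fix F :: "real \<times> real \<Rightarrow> ennreal"
    show "(\<integral>\<^sup>+g. F (\<Sum>i\<in>{}. a i * g i, \<Sum>i\<in>{}. b i * g i) \<partial>PiM {} (\<lambda>_. gauss))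
        = (\<integral>\<^sup>+x. \<integral>\<^sup>+y. F (0 * x, 0 * x + 0 * y) \<partial>gauss \<partial>gauss)"
    proof -
      have "prob_space (PiM ({}::'i set) (\<lambda>_. gauss))" by (rule prob_space_PiM) simp
      from prob_space.emeasure_space_1[OF this] show ?thesis using gauss.emeasure_space_1 by simp
    qed
  qed auto
next
  case (insert k I)
  then obtain \<alpha> \<beta> \<delta> where IH: "0 \<le> \<alpha>" "0 \<le> \<delta>" "\<alpha>\<^sup>2 = (\<Sum>i\<in>I. (a i)\<^sup>2)" "\<alpha> * \<beta> = (\<Sum>i\<in>I. a i * b i)"
    "\<beta>\<^sup>2 + \<delta>\<^sup>2 = (\<Sum>i\<in>I. (b i)\<^sup>2)"
    and law: "\<And>F. F\<in>borel_measurable (borel \<Otimes>\<^sub>M borel) \<Longrightarrow>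
        (\<integral>\<^sup>+g. F (\<Sum>i\<in>I. a i * g i, \<Sum>i\<in>I. b i * g i) \<partial>PiM I (\<lambda>_. gauss))
        = (\<integral>\<^sup>+x. \<integral>\<^sup>+y. F (\<alpha> * x, \<beta> * x + \<delta> * y) \<partial>gauss \<partial>gauss)"
    by blast
  define p q where "p = a k" and "q = b k"
  define r where "r = sqrt (\<alpha>\<^sup>2 + p\<^sup>2)"
  \<comment> \<open>The rotation that turns \<open>(\<alpha>, p)\<close> into \<open>(r, 0)\<close>;
    if both entries vanish, the identity serves. The same rotation turns \<open>(\<beta>, q)\<close>
    into \<open>(\<beta>', \<mu>)\<close>, and \<open>\<mu>\<close> is then merged with
    \<open>\<delta>\<close> by \<open>gauss_combine\<close>.\<close>
  define c s where "c = (if r = 0 then 1 else \<alpha> / r)" and "s = (if r = 0 then 0 else p / r)"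
  have r2: "r\<^sup>2 = \<alpha>\<^sup>2 + p\<^sup>2" by (simp add: r_def)
  have r0: "\<alpha> = 0 \<and> p = 0" if "r = 0" using that r2 by (simp add: sum_power2_eq_zero_iff)
  have cs: "c\<^sup>2 + s\<^sup>2 = 1"
    using r2 by (auto simp: c_def s_def power_divide sum_power2_eq_zero_iff simp flip: add_divide_distrib)
  have ac: "\<alpha> = r * c" "p = r * s" using r0 by (auto simp: c_def s_def)
  define \<beta>' \<mu> where "\<beta>' = \<beta> * c + q * s" and "\<mu> = q * c - \<beta> * s"
  show ?case
  proof (rule exI[of _ r], rule exI[of _ \<beta>'], rule exI[of _ "sqrt (\<mu>\<^sup>2 + \<delta>\<^sup>2)"], intro conjI ballI)
    show "0 \<le> r" by (simp add: r_def)
    show "0 \<le> sqrt (\<mu>\<^sup>2 + \<delta>\<^sup>2)" by simp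
    show "r\<^sup>2 = (\<Sum>i\<in>insert k I. (a i)\<^sup>2)" using insert IH r2 by (simp add: p_def)
    show "r * \<beta>' = (\<Sum>i\<in>insert k I. a i * b i)"
    proof -
      have "r * \<beta>' = (r * c) * \<beta> + (r * s) * q" by (simp add: \<beta>'_def algebra_simps)
      then show ?thesis using insert IH unfolding ac[symmetric] by (simp add: p_def q_def)
    qed
    show "\<beta>'\<^sup>2 + (sqrt (\<mu>\<^sup>2 + \<delta>\<^sup>2))\<^sup>2 = (\<Sum>i\<in>insert k I. (b i)\<^sup>2)"
    proof -
      have "\<beta>'\<^sup>2 + \<mu>\<^sup>2 = (c\<^sup>2 + s\<^sup>2) * (\<beta>\<^sup>2 + q\<^sup>2)"
        by (simp add: \<beta>'_def \<mu>_def power2_eq_square algebra_simps)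
      then show ?thesis using insert IH cs by (simp add: q_def)
    qed
    fix F :: "real \<times> real \<Rightarrow> ennreal" assume [measurable]: "F \<in> borel_measurable (borel \<Otimes>\<^sub>M borel)"
    let ?A = "\<lambda>g. \<Sum>i\<in>I. a i * g i" and ?B = "\<lambda>g. \<Sum>i\<in>I. b i * g i"
    have "(\<integral>\<^sup>+g. F (\<Sum>i\<in>insert k I. a i * g i, \<Sum>i\<in>insert k I. b i * g i) \<partial>PiM (insert k I) (\<lambda>_. gauss))
       = (\<integral>\<^sup>+g. \<integral>\<^sup>+z. F (\<Sum>i\<in>insert k I. a i * (g(k := z)) i, \<Sum>i\<in>insert k I. b i * (g(k := z)) i) \<partial>gauss \<partial>PiM I (\<lambda>_. gauss))"
      using insert.hyps by (intro gauss_product.product_nn_integral_insert) measurable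
    also have "\<dots> = (\<integral>\<^sup>+g. (\<lambda>(A, B). \<integral>\<^sup>+z. F (A + p * z, B + q * z) \<partial>gauss) (?A g, ?B g) \<partial>PiM I (\<lambda>_. gauss))"
    proof -
      have "(\<Sum>i\<in>insert k I. f i * (g(k := z)) i) = (\<Sum>i\<in>I. f i * g i) + f k * z" for f :: "'i \<Rightarrow> real" and g :: "'i \<Rightarrow> real" and z
      proof -
        have "(\<Sum>i\<in>I. f i * (g(k := z)) i) = (\<Sum>i\<in>I. f i * g i)" using insert.hyps by (intro sum.cong) auto
        then show ?thesis using insert.hyps by simp
      qed
      then show ?thesis by (simp only: p_def q_def case_prod_conv)
    qed
    also have "\<dots> = (\<integral>\<^sup>+x. \<integral>\<^sup>+y. \<integral>\<^sup>+z. F (\<alpha> * x + p * z, \<beta> * x + \<delta> * y + q * z) \<partial>gauss \<partial>gauss \<partial>gauss)"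
      by (subst law) auto
    also have "\<dots> = (\<integral>\<^sup>+x. \<integral>\<^sup>+z. \<integral>\<^sup>+y. F (\<alpha> * x + p * z, \<beta> * x + \<delta> * y + q * z) \<partial>gauss \<partial>gauss \<partial>gauss)"
    proof (rule nn_integral_cong)
      fix x
      show "(\<integral>\<^sup>+y. \<integral>\<^sup>+z. F (\<alpha> * x + p * z, \<beta> * x + \<delta> * y + q * z) \<partial>gauss \<partial>gauss)
         = (\<integral>\<^sup>+z. \<integral>\<^sup>+y. F (\<alpha> * x + p * z, \<beta> * x + \<delta> * y + q * z) \<partial>gauss \<partial>gauss)"
        using gauss_swap[of "\<lambda>(y, z). F (\<alpha> * x + p * z, \<beta> * x + \<delta> * y + q * z)"] by simp
    qed
    also have "\<dots> = (\<integral>\<^sup>+x. \<integral>\<^sup>+z. \<integral>\<^sup>+y. F (r * x, \<beta>' * x + (\<mu> * z + \<delta> * y)) \<partial>gauss \<partial>gauss \<partial>gauss)"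
    proof -
      have e1: "\<alpha> * (c * x - s * z) + p * (s * x + c * z) = r * x" for x z
      proof -
        have "\<alpha> * (c * x - s * z) + p * (s * x + c * z) = r * (c\<^sup>2 + s\<^sup>2) * x"
          unfolding ac by (simp add: power2_eq_square algebra_simps)
        then show ?thesis using cs by simp
      qed
      have e2: "\<beta> * (c * x - s * z) + \<delta> * y + q * (s * x + c * z) = \<beta>' * x + (\<mu> * z + \<delta> * y)" for x y z
        by (simp add: \<beta>'_def \<mu>_def algebra_simps)
      show ?thesis
        using gauss_rotation[of "\<lambda>(x, z). \<integral>\<^sup>+y. F (\<alpha> * x + p * z, \<beta> * x + \<delta> * y + q * z) \<partial>gauss", OF _ cs]
        by (simp add: e1 e2)
    qed
    also have "\<dots> = (\<integral>\<^sup>+x. \<integral>\<^sup>+y. F (r * x, \<beta>' * x + sqrt (\<mu>\<^sup>2 + \<delta>\<^sup>2) * y) \<partial>gauss \<partial>gauss)"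
    proof (rule nn_integral_cong)
      fix x
      show "(\<integral>\<^sup>+z. \<integral>\<^sup>+y. F (r * x, \<beta>' * x + (\<mu> * z + \<delta> * y)) \<partial>gauss \<partial>gauss)
          = (\<integral>\<^sup>+y. F (r * x, \<beta>' * x + sqrt (\<mu>\<^sup>2 + \<delta>\<^sup>2) * y) \<partial>gauss)"
        by (rule gauss_combine[where f="\<lambda>t. F (r * x, \<beta>' * x + t)"]) measurable
    qed
    finally show "(\<integral>\<^sup>+g. F (\<Sum>i\<in>insert k I. a i * g i, \<Sum>i\<in>insert k I. b i * g i) \<partial>PiM (insert k I) (\<lambda>_. gauss))
       = (\<integral>\<^sup>+x. \<integral>\<^sup>+y. F (r * x, \<beta>' * x + sqrt (\<mu>\<^sup>2 + \<delta>\<^sup>2) * y) \<partial>gauss \<partial>gauss)" .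
  qed
qed

section \<open>Quadrant probabilities of a Gaussian pair\<close>

lemma nn_integral_gauss_ray:
  assumes w: "0 < w"
  shows "(\<integral>\<^sup>+x. ennreal (x * (exp (- (x\<^sup>2 * w) / 2) / (2 * pi))) * indicator {0..} x \<partial>lborel) = ennreal (1 / w / (2 * pi))"
proof -
  let ?F = "\<lambda>x. - (exp (- (x\<^sup>2 * w) / 2) / w / (2 * pi))"
  have "(\<integral>\<^sup>+x. ennreal (x * (exp (- (x\<^sup>2 * w) / 2) / (2 * pi))) * indicator {0..} x \<partial>lborel) = ennreal (0 - ?F 0)"
  proof (rule nn_integral_FTC_atLeast)
    show "(?F has_real_derivative x * (exp (- (x\<^sup>2 * w) / 2) / (2 * pi))) (at x)" for x
    proof -
      have "((\<lambda>x. exp (- (x\<^sup>2 * w) / 2)) has_real_derivative exp (- (x\<^sup>2 * w) / 2) * (- (x * w))) (at x)"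
        by (auto intro!: derivative_eq_intros)
      from DERIV_cmult[OF this, of "- (1 / w / (2 * pi))"]
      show ?thesis by (rule DERIV_cong[THEN DERIV_cong_ev[OF refl _ refl, THEN iffD1, rotated]]) (use w in auto)
    qed
    have "((\<lambda>x::real. exp (- (x\<^sup>2 * w) / 2)) \<longlongrightarrow> 0) at_top"
      using w by real_asymp
    from tendsto_mult_left[OF this, of "- (1 / w / (2 * pi))"] show "(?F \<longlongrightarrow> 0) at_top" by simp
  qed auto
  then show ?thesis by simp
qed

text \<open>The substitution \<open>y = x * u\<close> turns the wedge into the half-line
  \<open>u \<le> - k\<close> of slopes. Integrating over \<open>x\<close> leaves the density
  \<open>1 / (2 * pi * (1 + u^2))\<close>, whose integral is an arctangent; the line
  \<open>x = 0\<close> is a null set.\<close>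

lemma gauss_wedge:
  "(\<integral>\<^sup>+x. \<integral>\<^sup>+y. indicator {z. 0 \<le> fst z \<and> snd z \<le> - k * fst z} (x, y) \<partial>gauss \<partial>gauss)
    = ennreal ((pi / 2 - arctan k) / (2 * pi))"
proof -
  let ?W = "{z::real \<times> real. 0 \<le> fst z \<and> snd z \<le> - k * fst z}"
  have [measurable]: "?W \<in> sets (borel \<Otimes>\<^sub>M borel)"
  proof -
    have "{z \<in> space (borel \<Otimes>\<^sub>M borel). 0 \<le> fst z \<and> snd z \<le> - k * fst z} \<in> sets (borel \<Otimes>\<^sub>M borel)"
      by measurable
    then show ?thesis by (simp add: space_pair_measure)
  qed
  let ?e = "\<lambda>x u. x * (exp (- (x\<^sup>2 * (1 + u\<^sup>2)) / 2) / (2 * pi)) :: real"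
  define F where "F = (\<lambda>z::real \<times> real. ennreal (exp (- ((fst z)\<^sup>2 + (snd z)\<^sup>2) / 2) / (2 * pi)) * indicator ?W z)"
  have [measurable]: "F \<in> borel_measurable (borel \<Otimes>\<^sub>M borel)" unfolding F_def by measurable
  have "(\<integral>\<^sup>+x. \<integral>\<^sup>+y. indicator ?W (x, y) \<partial>gauss \<partial>gauss) = (\<integral>\<^sup>+x. \<integral>\<^sup>+y. F (x, y) \<partial>lborel \<partial>lborel)"
    by (subst nn_integral_gauss_pair) (auto simp: F_def)
  also have "\<dots> = (\<integral>\<^sup>+x. \<integral>\<^sup>+u. ennreal (?e x u) * indicator {0..} x * indicator {..- k} u \<partial>lborel \<partial>lborel)"
  proof (rule nn_integral_cong_AE, rule eventually_mono[OF AE_lborel_singleton[of 0]])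
    fix x :: real assume x: "x \<noteq> 0"
    show "(\<integral>\<^sup>+y. F (x, y) \<partial>lborel) = (\<integral>\<^sup>+u. ennreal (?e x u) * indicator {0..} x * indicator {..- k} u \<partial>lborel)"
    proof (cases "0 < x")
      case True
      have "(\<integral>\<^sup>+y. F (x, y) \<partial>lborel) = ennreal \<bar>x\<bar> * (\<integral>\<^sup>+u. F (x, 0 + x * u) \<partial>lborel)"
        using x by (intro nn_integral_real_affine) auto
      also have "\<dots> = (\<integral>\<^sup>+u. ennreal \<bar>x\<bar> * F (x, 0 + x * u) \<partial>lborel)"
        by (rule nn_integral_cmult[symmetric]) measurable
      also have "\<dots> = (\<integral>\<^sup>+u. ennreal (?e x u) * indicator {0..} x * indicator {..- k} u \<partial>lborel)"
      proof (rule nn_integral_cong)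
        fix u
        have "x * u \<le> - k * x \<longleftrightarrow> u \<le> - k" using True by (metis mult.commute mult_le_cancel_left_pos)
        then have i: "indicator ?W (x, 0 + x * u) = (indicator {0..} x * indicator {..- k} u :: ennreal)"
          using True by (auto simp: indicator_def)
        have "x\<^sup>2 + (0 + x * u)\<^sup>2 = x\<^sup>2 * (1 + u\<^sup>2)" by (simp add: power_mult_distrib algebra_simps)
        then have "ennreal \<bar>x\<bar> * ennreal (exp (- (x\<^sup>2 + (0 + x * u)\<^sup>2) / 2) / (2 * pi)) = ennreal (?e x u)"
          using True by (simp flip: ennreal_mult)
        then show "ennreal \<bar>x\<bar> * F (x, 0 + x * u) = ennreal (?e x u) * indicator {0..} x * indicator {..- k} u"
          unfolding F_def i fst_conv snd_conv by (simp only: mult.assoc[symmetric])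
      qed
      finally show ?thesis .
    next
      case False
      then show ?thesis using x by (simp add: F_def)
    qed
  qed
  also have "\<dots> = (\<integral>\<^sup>+u. \<integral>\<^sup>+x. ennreal (?e x u) * indicator {0..} x * indicator {..- k} u \<partial>lborel \<partial>lborel)"
    using lborel_pair.Fubini'[of "\<lambda>x u. ennreal (?e x u) * indicator {0..} x * indicator {..- k} u"] by simp
  also have "\<dots> = (\<integral>\<^sup>+u. ennreal (1 / (1 + u\<^sup>2) / (2 * pi)) * indicator {..- k} u \<partial>lborel)"
  proof (rule nn_integral_cong)
    fix u :: real
    have "0 < 1 + u\<^sup>2" by (simp add: add_pos_nonneg)
    from nn_integral_gauss_ray[OF this]
    show "(\<integral>\<^sup>+x. ennreal (?e x u) * indicator {0..} x * indicator {..- k} u \<partial>lborel) = ennreal (1 / (1 + u\<^sup>2) / (2 * pi)) * indicator {..- k} u"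
      by (subst nn_integral_multc) auto
  qed
  also have "\<dots> = (\<integral>\<^sup>+u. ennreal (1 / (1 + u\<^sup>2) / (2 * pi)) * indicator {k..} u \<partial>lborel)"
  proof -
    have "(indicator {..- k} (0 + - 1 * u) :: ennreal) = indicator {k..} u" for u
      by (auto simp: indicator_def)
    then show ?thesis
      using nn_integral_real_affine[of "\<lambda>u. ennreal (1 / (1 + u\<^sup>2) / (2 * pi)) * indicator {..- k} u" "-1" 0]
      by simp
  qed
  also have "\<dots> = ennreal (pi / 2 / (2 * pi) - arctan k / (2 * pi))"
  proof (rule nn_integral_FTC_atLeast[where F="\<lambda>u. arctan u / (2 * pi)"])
    show "((\<lambda>u. arctan u / (2 * pi)) has_real_derivative 1 / (1 + u\<^sup>2) / (2 * pi)) (at u)" for u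
      using DERIV_cdivide[OF DERIV_arctan, of "2 * pi" u] by (simp only: inverse_eq_divide)
    show "((\<lambda>u. arctan u / (2 * pi)) \<longlongrightarrow> pi / 2 / (2 * pi)) at_top"
      by (rule tendsto_divide[OF tendsto_arctan_at_top tendsto_const]) simp
    show "0 \<le> 1 / (1 + u\<^sup>2) / (2 * pi)" for u :: real
      by (simp add: add_nonneg_nonneg)
  qed measurable
  finally show ?thesis by (simp add: diff_divide_distrib)
qed

lemma emeasure_gauss_singleton: "emeasure gauss {c} = 0"
  unfolding gauss_def by (subst emeasure_density) auto

lemma emeasure_gauss_nonneg_half: "emeasure gauss {0..} = ennreal (1 / 2)"
proof -
  have n: "emeasure gauss A = (\<integral>\<^sup>+x. ennreal (std_normal_density x) * indicator A x \<partial>lborel)" if "A \<in> sets borel" for A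
    unfolding gauss_def using that by (intro emeasure_density) auto
  have "emeasure gauss {0..} = emeasure gauss {..0}"
    unfolding n[of "{0..}", simplified]
    by (subst nn_integral_real_affine[where c="-1" and t=0])
      (auto simp: n std_normal_density_def indicator_def intro!: nn_integral_cong)
  moreover have "emeasure gauss {0..} = emeasure gauss {0<..}"
  proof -
    have "emeasure gauss ({0} \<union> {0<..}) = emeasure gauss {0} + emeasure gauss {0<..}"
      by (intro plus_emeasure[symmetric]) auto
    moreover have "{0::real} \<union> {0<..} = {0..}" by auto
    ultimately show ?thesis by (simp add: emeasure_gauss_singleton)
  qed
  moreover have "emeasure gauss ({..0} \<union> {0<..}) = emeasure gauss {..0} + emeasure gauss {0<..}"
    by (intro plus_emeasure[symmetric]) auto
  moreover have "{..0::real} \<union> {0<..} = UNIV" by auto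
  moreover have "emeasure gauss UNIV = 1" using gauss.emeasure_space_1 by simp
  ultimately have "emeasure gauss {0..} + emeasure gauss {0..} = 1" by simp
  then have "ennreal (measure gauss {0..} + measure gauss {0..}) = 1"
    by (simp only: gauss.emeasure_eq_measure ennreal_plus[OF measure_nonneg measure_nonneg])
  then have "measure gauss {0..} = 1 / 2" by (simp add: ennreal_eq_1)
  then show ?thesis by (simp only: gauss.emeasure_eq_measure)
qed

text \<open>For \<open>\<delta> > 0\<close> the event is a wedge of slope
  \<open>- \<rho> / \<delta>\<close>, and \<open>arctan (\<rho> / \<delta>)\<close> is
  \<open>arcsin \<rho>\<close>. In the degenerate case the second variable is the first one up to
  sign, and the event is a point or a half-line.\<close>

lemma gauss_quadrant:
  assumes "\<rho>\<^sup>2 + \<delta>\<^sup>2 = 1" "0 \<le> \<delta>"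
  shows "(\<integral>\<^sup>+x. \<integral>\<^sup>+y. indicator {z. 0 \<le> fst z \<and> snd z \<le> 0} (x, \<rho> * x + \<delta> * y) \<partial>gauss \<partial>gauss)
    = ennreal (arccos \<rho> / (2 * pi))"
proof (cases "\<delta> = 0")
  case True
  then consider "\<rho> = 1" | "\<rho> = - 1" using assms by (auto simp: power2_eq_1_iff)
  then show ?thesis
  proof cases
    case 1
    have "(\<integral>\<^sup>+x. indicator {z. 0 \<le> fst z \<and> snd z \<le> 0} (x, x) \<partial>gauss) = (\<integral>\<^sup>+x. indicator {0} x \<partial>gauss)"
      by (intro nn_integral_cong) (auto simp: indicator_def)
    then show ?thesis using 1 True gauss.emeasure_space_1 by (simp add: emeasure_gauss_singleton)
  next
    case 2
    have "(\<integral>\<^sup>+x. indicator {z. 0 \<le> fst z \<and> snd z \<le> 0} (x, - x) \<partial>gauss) = (\<integral>\<^sup>+x. indicator {0..} x \<partial>gauss)"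
      by (intro nn_integral_cong) (auto simp: indicator_def)
    then show ?thesis using 2 True gauss.emeasure_space_1 by (simp add: emeasure_gauss_nonneg_half)
  qed
next
  case False
  then have \<delta>: "0 < \<delta>" using assms by simp
  have "\<rho>\<^sup>2 < 1" using assms(1) \<delta> by (smt (verit) zero_less_power2)
  then have \<rho>: "- 1 < \<rho>" "\<rho> < 1" by (auto simp: abs_square_less_1 abs_less_iff)
  have "\<delta> = sqrt (1 - \<rho>\<^sup>2)" using assms by (simp add: real_sqrt_unique[symmetric] algebra_simps)
  then have a: "arcsin \<rho> = arctan (\<rho> / \<delta>)" using arcsin_arctan[OF \<rho>] by simp
  have "(\<integral>\<^sup>+x. \<integral>\<^sup>+y. indicator {z. 0 \<le> fst z \<and> snd z \<le> 0} (x, \<rho> * x + \<delta> * y) \<partial>gauss \<partial>gauss)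
     = (\<integral>\<^sup>+x. \<integral>\<^sup>+y. indicator {z. 0 \<le> fst z \<and> snd z \<le> - (\<rho> / \<delta>) * fst z} (x, y) \<partial>gauss \<partial>gauss)"
  proof -
    have "\<rho> * x + \<delta> * y \<le> 0 \<longleftrightarrow> y \<le> - (\<rho> / \<delta>) * x" for x y
      using \<delta> by (auto simp: field_simps)
    then show ?thesis by (intro nn_integral_cong) (auto simp: indicator_def)
  qed
  also have "\<dots> = ennreal ((pi / 2 - arctan (\<rho> / \<delta>)) / (2 * pi))" by (rule gauss_wedge)
  also have "pi / 2 - arctan (\<rho> / \<delta>) = arccos \<rho>"
    using \<rho> by (simp add: a[symmetric] arccos_arcsin_eq)
  finally show ?thesis .
qed

lemma emeasure_vimage_eq_nn_integral:
  assumes [measurable]: "f \<in> measurable M N" "A \<in> sets N"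
  shows "emeasure M {\<omega>\<in>space M. f \<omega> \<in> A} = (\<integral>\<^sup>+\<omega>. indicator A (f \<omega>) \<partial>M)"
proof -
  have "(\<integral>\<^sup>+\<omega>. indicator A (f \<omega>) \<partial>M) = (\<integral>\<^sup>+z. indicator A z \<partial>distr M N f)"
    by (rule nn_integral_distr[symmetric]) measurable
  also have "\<dots> = emeasure M (f -` A \<inter> space M)" by (simp add: emeasure_distr)
  also have "f -` A \<inter> space M = {\<omega>\<in>space M. f \<omega> \<in> A}" by auto
  finally show ?thesis by simp
qed

section \<open>Linear forms in independent normal variables\<close>

context prob_space
begin

lemma nn_integral_linear_pair:
  fixes G :: "'i \<Rightarrow> 'a \<Rightarrow> real"
  assumes I: "finite I" "I \<noteq> {}" and ind: "indep_vars (\<lambda>_. borel) G I"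
    and norm: "\<forall>i\<in>I. distributed M lborel (G i) std_normal_density"
  shows "\<exists>\<alpha> \<beta> \<delta>. 0 \<le> \<alpha> \<and> 0 \<le> \<delta> \<and> \<alpha>\<^sup>2 = (\<Sum>i\<in>I. (a i)\<^sup>2) \<and> \<alpha> * \<beta> = (\<Sum>i\<in>I. a i * b i)
    \<and> \<beta>\<^sup>2 + \<delta>\<^sup>2 = (\<Sum>i\<in>I. (b i)\<^sup>2)
    \<and> (\<forall>F\<in>borel_measurable (borel \<Otimes>\<^sub>M borel).
        (\<integral>\<^sup>+\<omega>. F (\<Sum>i\<in>I. a i * G i \<omega>, \<Sum>i\<in>I. b i * G i \<omega>) \<partial>M)
        = (\<integral>\<^sup>+x. \<integral>\<^sup>+y. F (\<alpha> * x, \<beta> * x + \<delta> * y) \<partial>gauss \<partial>gauss))"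
proof -
  have rv: "random_variable borel (G i)" if "i \<in> I" for i using norm[rule_format, OF that] by (simp add: distributed_def)
  have d: "distr M borel (G i) = gauss" if "i \<in> I" for i
    using norm[rule_format, OF that] by (simp add: distributed_def gauss_def cong: distr_cong)
  have "distr M (PiM I (\<lambda>_. borel)) (\<lambda>x. \<lambda>i\<in>I. G i x) = PiM I (\<lambda>i. distr M borel (G i))"
    using indep_vars_iff_distr_eq_PiM'[where M'="\<lambda>_. borel" and X=G, OF I(2)] rv ind by simp
  also have "\<dots> = PiM I (\<lambda>_. gauss)" using d by (intro PiM_cong) auto
  finally have law: "distr M (PiM I (\<lambda>_. borel)) (\<lambda>x. \<lambda>i\<in>I. G i x) = PiM I (\<lambda>_. gauss)" .
  have "(\<integral>\<^sup>+\<omega>. F (\<Sum>i\<in>I. a i * G i \<omega>, \<Sum>i\<in>I. b i * G i \<omega>) \<partial>M)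
      = (\<integral>\<^sup>+g. F (\<Sum>i\<in>I. a i * g i, \<Sum>i\<in>I. b i * g i) \<partial>PiM I (\<lambda>_. gauss))"
    if [measurable]: "F \<in> borel_measurable (borel \<Otimes>\<^sub>M borel)" for F :: "real \<times> real \<Rightarrow> ennreal"
    unfolding law[symmetric]
    by (subst nn_integral_distr) (auto intro!: measurable_restrict rv nn_integral_cong cong: sum.cong)
  then show ?thesis using linear_pair_law[OF I(1), of a b] by auto
qed

lemma gaussian_quadrant:
  fixes G :: "'i \<Rightarrow> 'a \<Rightarrow> real"
  assumes I: "finite I" and ind: "indep_vars (\<lambda>_. borel) G I"
    and norm: "\<forall>i\<in>I. distributed M lborel (G i) std_normal_density"
    and a: "(\<Sum>i\<in>I. (a i)\<^sup>2) = 1" and b: "(\<Sum>i\<in>I. (b i)\<^sup>2) = 1"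
  shows "prob {\<omega>\<in>space M. 0 \<le> (\<Sum>i\<in>I. a i * G i \<omega>) \<and> (\<Sum>i\<in>I. b i * G i \<omega>) \<le> 0} = arccos (\<Sum>i\<in>I. a i * b i) / (2 * pi)"
    and "AE \<omega> in M. (\<Sum>i\<in>I. a i * G i \<omega>) \<noteq> 0"
    and "emeasure M {\<omega>\<in>space M. \<bar>\<Sum>i\<in>I. a i * G i \<omega>\<bar> \<le> y} = emeasure gauss {- y..y}"
proof -
  have "I \<noteq> {}" using a by auto
  from nn_integral_linear_pair[OF I this ind norm, of a b]
  obtain \<alpha> \<beta> \<delta> where g: "0 \<le> \<alpha>" "0 \<le> \<delta>" "\<alpha>\<^sup>2 = 1" "\<alpha> * \<beta> = (\<Sum>i\<in>I. a i * b i)" "\<beta>\<^sup>2 + \<delta>\<^sup>2 = 1"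
    and law: "\<And>F. F\<in>borel_measurable (borel \<Otimes>\<^sub>M borel) \<Longrightarrow>
        (\<integral>\<^sup>+\<omega>. F (\<Sum>i\<in>I. a i * G i \<omega>, \<Sum>i\<in>I. b i * G i \<omega>) \<partial>M)
        = (\<integral>\<^sup>+x. \<integral>\<^sup>+y. F (\<alpha> * x, \<beta> * x + \<delta> * y) \<partial>gauss \<partial>gauss)"
    unfolding a b by blast
  have \<alpha>: "\<alpha> = 1" using g by (auto simp: power2_eq_1_iff)
  have [measurable]: "i \<in> I \<Longrightarrow> random_variable borel (G i)" for i using norm[rule_format, of i] by (simp add: distributed_def)
  let ?Q = "{z::real \<times> real. 0 \<le> fst z \<and> snd z \<le> 0}"
  have [measurable]: "?Q \<in> sets (borel \<Otimes>\<^sub>M borel)"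
  proof -
    have "{z \<in> space (borel \<Otimes>\<^sub>M borel). (0::real) \<le> fst z \<and> snd z \<le> (0::real)} \<in> sets (borel \<Otimes>\<^sub>M borel)"
      by measurable
    then show ?thesis by (simp add: space_pair_measure)
  qed
  have "emeasure M {\<omega>\<in>space M. 0 \<le> (\<Sum>i\<in>I. a i * G i \<omega>) \<and> (\<Sum>i\<in>I. b i * G i \<omega>) \<le> 0}
      = (\<integral>\<^sup>+\<omega>. indicator ?Q (\<Sum>i\<in>I. a i * G i \<omega>, \<Sum>i\<in>I. b i * G i \<omega>) \<partial>M)"
    using emeasure_vimage_eq_nn_integral[of "\<lambda>\<omega>. (\<Sum>i\<in>I. a i * G i \<omega>, \<Sum>i\<in>I. b i * G i \<omega>)" M "borel \<Otimes>\<^sub>M borel" ?Q] by simp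
  also have "\<dots> = ennreal (arccos (\<Sum>i\<in>I. a i * b i) / (2 * pi))"
    using gauss_quadrant[OF g(5) g(2)] g(4) by (subst law) (auto simp: \<alpha>)
  finally have e: "emeasure M {\<omega>\<in>space M. 0 \<le> (\<Sum>i\<in>I. a i * G i \<omega>) \<and> (\<Sum>i\<in>I. b i * G i \<omega>) \<le> 0}
      = ennreal (arccos (\<Sum>i\<in>I. a i * b i) / (2 * pi))" .
  have "\<beta>\<^sup>2 \<le> 1" using g(5) zero_le_power2[of \<delta>] by linarith
  then have "\<bar>\<beta>\<bar> \<le> 1" by (simp add: abs_square_le_1)
  then have "0 \<le> arccos (\<Sum>i\<in>I. a i * b i)" using g(4) \<alpha> arccos_lbound[of \<beta>] by (simp add: abs_le_iff)
  then show "prob {\<omega>\<in>space M. 0 \<le> (\<Sum>i\<in>I. a i * G i \<omega>) \<and> (\<Sum>i\<in>I. b i * G i \<omega>) \<le> 0} = arccos (\<Sum>i\<in>I. a i * b i) / (2 * pi)"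
    unfolding measure_def e by (intro enn2real_ennreal divide_nonneg_pos) auto
  have law1: "emeasure M {\<omega>\<in>space M. (\<Sum>i\<in>I. a i * G i \<omega>) \<in> A} = emeasure gauss A" if [measurable]: "A \<in> sets borel" for A
  proof -
    have "emeasure M {\<omega>\<in>space M. (\<Sum>i\<in>I. a i * G i \<omega>) \<in> A} = (\<integral>\<^sup>+\<omega>. indicator A (fst (\<Sum>i\<in>I. a i * G i \<omega>, \<Sum>i\<in>I. b i * G i \<omega>)) \<partial>M)"
      using emeasure_vimage_eq_nn_integral[of "\<lambda>\<omega>. \<Sum>i\<in>I. a i * G i \<omega>" M borel A] by simp
    also have "\<dots> = emeasure gauss A"
      using law[of "\<lambda>z. indicator A (fst z)"] gauss.emeasure_space_1 by (simp add: \<alpha>)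
    finally show ?thesis .
  qed
  have "emeasure M {\<omega>\<in>space M. \<not> (\<Sum>i\<in>I. a i * G i \<omega>) \<noteq> 0} = 0"
    using law1[of "{0}"] by (simp add: emeasure_gauss_singleton)
  then show "AE \<omega> in M. (\<Sum>i\<in>I. a i * G i \<omega>) \<noteq> 0" by (subst AE_iff_measurable[OF _ refl]) auto
  show "emeasure M {\<omega>\<in>space M. \<bar>\<Sum>i\<in>I. a i * G i \<omega>\<bar> \<le> y} = emeasure gauss {- y..y}"
  proof -
    have "{\<omega>\<in>space M. \<bar>\<Sum>i\<in>I. a i * G i \<omega>\<bar> \<le> y} = {\<omega>\<in>space M. (\<Sum>i\<in>I. a i * G i \<omega>) \<in> {- y..y}}" by auto
    moreover have "{- y..y} \<in> sets borel" by simp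
    ultimately show ?thesis by (simp only: law1)
  qed
qed

text \<open>Sheppard's formula. Off the null set where a form vanishes, the product of the signs is
  1 minus twice the indicator of opposite signs, and each of the two ways to have opposite signs has
  probability \<open>arccos \<rho> / (2 * pi)\<close>.\<close>

lemma gaussian_sign_correlation:
  fixes G :: "'i \<Rightarrow> 'a \<Rightarrow> real"
  assumes I: "finite I" and ind: "indep_vars (\<lambda>_. borel) G I"
    and norm: "\<forall>i\<in>I. distributed M lborel (G i) std_normal_density"
    and a: "(\<Sum>i\<in>I. (a i)\<^sup>2) = 1" and b: "(\<Sum>i\<in>I. (b i)\<^sup>2) = 1"
  shows "expectation (\<lambda>\<omega>. sgn (\<Sum>i\<in>I. a i * G i \<omega>) * sgn (\<Sum>i\<in>I. b i * G i \<omega>)) = 1 - 2 / pi * arccos (\<Sum>i\<in>I. a i * b i)"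
proof -
  let ?A = "\<lambda>\<omega>. \<Sum>i\<in>I. a i * G i \<omega>" and ?B = "\<lambda>\<omega>. \<Sum>i\<in>I. b i * G i \<omega>"
  let ?E = "{\<omega>\<in>space M. 0 \<le> ?A \<omega> \<and> ?B \<omega> \<le> 0}" and ?E' = "{\<omega>\<in>space M. 0 \<le> ?B \<omega> \<and> ?A \<omega> \<le> 0}"
  have [measurable]: "i \<in> I \<Longrightarrow> random_variable borel (G i)" for i using norm[rule_format, of i] by (simp add: distributed_def)
  have [measurable]: "?E \<in> events" "?E' \<in> events" by measurable
  have "expectation (\<lambda>\<omega>. sgn (?A \<omega>) * sgn (?B \<omega>)) = expectation (\<lambda>\<omega>. 1 - 2 * indicator ?E \<omega> - 2 * indicator ?E' \<omega>)"
  proof (rule integral_cong_AE)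
    show "AE \<omega> in M. sgn (?A \<omega>) * sgn (?B \<omega>) = 1 - 2 * indicator ?E \<omega> - 2 * indicator ?E' \<omega>"
      using gaussian_quadrant(2)[OF I ind norm a b] gaussian_quadrant(2)[OF I ind norm b a] AE_space
      by eventually_elim (auto simp: indicator_def sgn_if)
  qed measurable
  also have "\<dots> = 1 - 2 * prob ?E - 2 * prob ?E'"
  proof -
    have i: "integrable M (\<lambda>\<omega>. indicator A \<omega> :: real)" if "A \<in> events" for A
      using that by (intro integrable_real_indicator) (auto simp: emeasure_eq_measure)
    show ?thesis using i[of ?E] i[of ?E'] by (simp add: Bochner_Integration.integral_diff prob_space)
  qed
  also have "\<dots> = 1 - 2 / pi * arccos (\<Sum>i\<in>I. a i * b i)"
    unfolding gaussian_quadrant(1)[OF I ind norm a b] gaussian_quadrant(1)[OF I ind norm b a]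
    by (simp add: mult.commute[of "b _"])
  finally show ?thesis .
qed

end

section \<open>Gaussian starts and independence of the sources\<close>

text \<open>For \<open>\<bar>z\<bar> > x\<close> the density at \<open>z\<close> is at most
  \<open>exp (- x^2 / 2)\<close> times the density at \<open>\<bar>z\<bar> - x\<close>. That shifted
  density is dominated by two translates of the Gaussian, each of total mass 1.\<close>

lemma gauss_tail:
  assumes x: "0 \<le> x"
  shows "emeasure gauss {z. x < \<bar>z\<bar>} \<le> ennreal (2 * exp (- x\<^sup>2 / 2))"
proof -
  let ?e = "exp (- x\<^sup>2 / 2)" and ?d = std_normal_density
  have shift: "(\<integral>\<^sup>+z. ennreal (?d (z + c)) \<partial>lborel) = 1" for c
  proof -
    have "(\<integral>\<^sup>+z. ennreal (?d z) \<partial>lborel) = (\<integral>\<^sup>+z. ennreal (?d (c + 1 * z)) \<partial>lborel)"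
      using nn_integral_real_affine[of "\<lambda>z. ennreal (?d z)" 1 c] by simp
    moreover have "(\<integral>\<^sup>+z. ennreal (?d z) \<partial>lborel) = 1"
      using gauss.emeasure_space_1 unfolding gauss_def by (simp add: emeasure_density)
    ultimately show ?thesis by (simp add: add.commute)
  qed
  have pt: "?d z \<le> ?e * ?d (\<bar>z\<bar> - x)" if "x < \<bar>z\<bar>" for z
  proof -
    have "0 \<le> x * (\<bar>z\<bar> - x)" using x that by simp
    then have "- z\<^sup>2 / 2 \<le> - x\<^sup>2 / 2 + - (\<bar>z\<bar> - x)\<^sup>2 / 2"
      by (simp add: power2_eq_square algebra_simps)
    then have "exp (- z\<^sup>2 / 2) \<le> ?e * exp (- (\<bar>z\<bar> - x)\<^sup>2 / 2)" by (simp flip: exp_add)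
    then show ?thesis unfolding std_normal_density_def by (simp add: divide_right_mono)
  qed
  have sq: "?d (\<bar>z\<bar> - x) \<le> ?d (z + - x) + ?d (z + x)" for z
  proof (cases "0 \<le> z")
    case False
    have "?d (- z - x) = ?d (z + x)" by (simp add: std_normal_density_def power2_eq_square algebra_simps)
    then show ?thesis using False by simp
  qed simp
  have "emeasure gauss {z. x < \<bar>z\<bar>} = (\<integral>\<^sup>+z. ennreal (?d z) * indicator {z. x < \<bar>z\<bar>} z \<partial>lborel)"
    unfolding gauss_def by (rule emeasure_density) auto
  also have "\<dots> \<le> (\<integral>\<^sup>+z. ennreal ?e * (ennreal (?d (z + - x)) + ennreal (?d (z + x))) \<partial>lborel)"
  proof (rule nn_integral_mono)
    fix z
    show "ennreal (?d z) * indicator {z. x < \<bar>z\<bar>} z \<le> ennreal ?e * (ennreal (?d (z + - x)) + ennreal (?d (z + x)))"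
    proof (cases "x < \<bar>z\<bar>")
      case True
      have "?d z \<le> ?e * (?d (z + - x) + ?d (z + x))"
        by (rule order_trans[OF pt[OF True] mult_left_mono[OF sq]]) simp
      then show ?thesis using True
        by (simp add: ennreal_leI flip: ennreal_plus ennreal_mult)
    qed simp
  qed
  also have "\<dots> = ennreal ?e * (1 + 1)"
    by (subst nn_integral_cmult, simp, subst nn_integral_add) (simp_all only: shift, auto)
  also have "\<dots> = ennreal (2 * ?e)"
    by (simp add: ennreal_mult' mult.commute)
  finally show ?thesis .
qed

lemma gauss_small_ball:
  assumes y: "0 \<le> y"
  shows "emeasure gauss {- y..y} \<le> ennreal (2 * y / sqrt (2 * pi))"
proof -
  have "emeasure gauss {- y..y} = (\<integral>\<^sup>+z. ennreal (std_normal_density z) * indicator {- y..y} z \<partial>lborel)"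
    unfolding gauss_def by (rule emeasure_density) auto
  also have "\<dots> \<le> (\<integral>\<^sup>+z. ennreal (1 / sqrt (2 * pi)) * indicator {- y..y} z \<partial>lborel)"
    by (intro nn_integral_mono mult_right_mono ennreal_leI)
      (auto simp: std_normal_density_def intro!: divide_right_mono)
  also have "\<dots> = ennreal (1 / sqrt (2 * pi)) * ennreal (2 * y)"
    using y by (subst nn_integral_cmult_indicator) auto
  also have "\<dots> = ennreal (2 * y / sqrt (2 * pi))" using y by (simp flip: ennreal_mult)
  finally show ?thesis .
qed

text \<open>That a function reads only the coordinates in \<open>A\<close> is expressed as
  invariance under \<open>mask_sources A\<close>. Filling up with 0 keeps the index type, so the
  same product space serves both halves of a split.\<close>

definition mask_sources :: "'s set \<Rightarrow> ('s \<Rightarrow> real) \<Rightarrow> 's \<Rightarrow> real" where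
  "mask_sources A r = (\<lambda>s. if s \<in> A then r s else 0)"

lemma exp_1_ge: "5 / 2 \<le> exp (1::real)"
  using exp_lower_Taylor_quadratic[of 1] by simp

text \<open>For \<open>p \<le> 1 / 8\<close> one has \<open>8 * n / p \<le> n / p^2\<close>, so the
  logarithm of the tail bound is at most \<open>L\<close> and cancels the \<open>L\<close> in the
  denominator. What remains is \<open>4 * p^2 / (e * pi)\<close>, below
  \<open>(3 / 4 * p)^2\<close>.\<close>

lemma small_ball_radius_bound:
  fixes p n :: real
  assumes p: "0 < p" "p \<le> 1 / 8" and n: "1 \<le> n"
  defines "L \<equiv> ln (n / p\<^sup>2)"
  shows "1 < L" "2 * sqrt (p\<^sup>2 / (n * exp 1 * L) * (n * (2 * ln (8 * n / p)))) / sqrt (2 * pi) \<le> 3 / 4 * p"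
proof -
  have p2: "0 < p\<^sup>2" using p by simp
  have "8 \<le> 1 / p" using p by (simp add: field_simps)
  then have "8 * n / p \<le> (n / p) * (1 / p)" using n p mult_left_mono[of 8 "1 / p" "n / p"] by (simp add: mult.commute)
  also have "\<dots> = n / p\<^sup>2" by (simp add: power2_eq_square)
  finally have le: "8 * n / p \<le> n / p\<^sup>2" .
  have "8 \<le> 8 * n / p" using n p by (simp add: field_simps)
  then have "exp 1 < n / p\<^sup>2" using le exp_le by linarith
  then have "ln (exp 1) < L" unfolding L_def by (subst ln_less_cancel_iff) (auto intro: less_trans[OF exp_gt_zero])
  then show L1: "1 < L" by simp
  have KL: "ln (8 * n / p) \<le> L" unfolding L_def using le n p by (subst ln_le_cancel_iff) auto
  have "(2 * sqrt (p\<^sup>2 / (n * exp 1 * L) * (n * (2 * ln (8 * n / p)))) / sqrt (2 * pi))\<^sup>2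
      = 4 * (p\<^sup>2 / (n * exp 1 * L) * (n * (2 * ln (8 * n / p)))) / (2 * pi)"
  proof -
    have "0 \<le> ln (8 * n / p)" using \<open>8 \<le> 8 * n / p\<close> by simp
    then have "0 \<le> p\<^sup>2 / (n * exp 1 * L) * (n * (2 * ln (8 * n / p)))" using L1 n by simp
    then show ?thesis by (simp add: power_divide power_mult_distrib)
  qed
  also have "\<dots> = 4 * p\<^sup>2 * (ln (8 * n / p) / L) / (exp 1 * pi)"
    using n L1 by (simp add: field_simps)
  also have "\<dots> \<le> 4 * p\<^sup>2 * 1 / (5 / 2 * 3)"
    using KL L1 p2 exp_1_ge pi_gt3 by (intro frac_le mult_left_mono mult_mono) auto
  also have "\<dots> \<le> (3 / 4 * p)\<^sup>2" by (simp add: power_mult_distrib power_divide)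
  finally show "2 * sqrt (p\<^sup>2 / (n * exp 1 * L) * (n * (2 * ln (8 * n / p)))) / sqrt (2 * pi) \<le> 3 / 4 * p"
    by (rule power2_le_imp_le) (use p in simp)
qed

context prob_space
begin

text \<open>With \<open>K = 2 * ln (8 * n / p)\<close>, a bad start either has a coordinate beyond
  \<open>sqrt K\<close>, which has probability at most \<open>p / 4\<close> in total, or squared
  norm at most \<open>n * K\<close>. In the second case \<open>b \<bullet> \<xi>\<close>, a standard
  normal variable, lies in a ball of radius \<open>y\<close>, with probability at most
  \<open>3 / 4 * p\<close>. The value of \<open>c\<close> is the threshold required by
  \<open>power_method_success\<close>.\<close>

lemma gaussian_start_bad:
  fixes X :: "'n::finite \<Rightarrow> 's" and G :: "'s \<Rightarrow> 'a \<Rightarrow> real" and b :: "real^'n"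
  assumes ind: "indep_vars (\<lambda>_. borel) G UNIV" and inj: "inj X"
    and norm: "\<And>s. distributed M lborel (G s) std_normal_density"
    and b: "norm b = 1" and p: "0 < p" "p \<le> 1 / 8"
  defines "\<xi> \<equiv> \<lambda>\<omega>. \<chi> i. G (X i) \<omega>"
  defines "c \<equiv> p\<^sup>2 / (real CARD('n) * exp 1 * ln (real CARD('n) / p\<^sup>2))"
  shows "emeasure M {\<omega>\<in>space M. (b \<bullet> \<xi> \<omega>)\<^sup>2 \<le> c * (\<xi> \<omega> \<bullet> \<xi> \<omega>)} \<le> ennreal p"
proof -
  let ?n = "real CARD('n)"
  let ?I = "range X"
  define K where "K = 2 * ln (8 * ?n / p)"
  define y where "y = sqrt (c * (?n * K))"
  have n1: "1 \<le> ?n" by (simp add: Suc_le_eq)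
  note bnd = small_ball_radius_bound[OF p n1]
  have [measurable]: "random_variable borel (G s)" for s using norm[of s] by (simp add: distributed_def)
  have "p \<le> ?n" using n1 p by linarith
  then have "8 \<le> 8 * ?n / p" using p by (simp add: field_simps)
  then have K0: "0 \<le> K" by (simp add: K_def)
  have c0: "0 \<le> c" 
  proof -
    have "0 \<le> ln (?n / p\<^sup>2)" using bnd(1) by linarith
    then show ?thesis unfolding c_def by (intro divide_nonneg_nonneg mult_nonneg_nonneg) (assumption | simp)+
  qed
  have lin: "emeasure M {\<omega>\<in>space M. \<bar>\<Sum>i\<in>UNIV. a i * G (X i) \<omega>\<bar> \<le> z} = emeasure gauss {- z..z}"
    if "(\<Sum>i\<in>UNIV. (a i)\<^sup>2) = 1" for a z
  proof -
    have r: "(\<Sum>s\<in>?I. f s) = (\<Sum>i\<in>UNIV. f (X i))" for f :: "'s \<Rightarrow> real" using inj by (simp add: sum.reindex)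
    have i: "inv X (X i) = i" for i using inj by simp
    have 1: "(\<Sum>s\<in>?I. (a (inv X s))\<^sup>2) = 1" using that by (simp add: r i)
    have "indep_vars (\<lambda>_. borel) G ?I" by (rule indep_vars_subset[OF ind]) simp
    from gaussian_quadrant(3)[OF _ this _ 1 1, of z] norm show ?thesis by (simp add: r i)
  qed
  have ball: "emeasure M {\<omega>\<in>space M. \<bar>b \<bullet> \<xi> \<omega>\<bar> \<le> y} \<le> ennreal (3 / 4 * p)"
  proof -
    have "(\<Sum>i\<in>UNIV. (b $ i)\<^sup>2) = 1"
      using b by (simp add: norm_eq_sqrt_inner inner_vec_def power2_eq_square)
    from lin[OF this, of y] have "emeasure M {\<omega>\<in>space M. \<bar>b \<bullet> \<xi> \<omega>\<bar> \<le> y} = emeasure gauss {- y..y}"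
      by (simp add: \<xi>_def inner_vec_def)
    also have "\<dots> \<le> ennreal (2 * y / sqrt (2 * pi))" using c0 K0 n1 by (intro gauss_small_ball) (simp add: y_def)
    also have "\<dots> \<le> ennreal (3 / 4 * p)" using bnd(2) by (intro ennreal_leI) (simp add: y_def c_def K_def)
    finally show ?thesis .
  qed
  have tail: "emeasure M {\<omega>\<in>space M. sqrt K < \<bar>G (X i) \<omega>\<bar>} \<le> ennreal (p / (4 * ?n))" for i
  proof -
    have "distr M lborel (G (X i)) = gauss" using norm[of "X i"] by (simp add: distributed_def gauss_def)
    then have "emeasure gauss {z. sqrt K < \<bar>z\<bar>} = emeasure (distr M lborel (G (X i))) {z. sqrt K < \<bar>z\<bar>}" by simp
    also have "\<dots> = emeasure M (G (X i) -` {z. sqrt K < \<bar>z\<bar>} \<inter> space M)"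
      by (rule emeasure_distr) auto
    also have "G (X i) -` {z. sqrt K < \<bar>z\<bar>} \<inter> space M = {\<omega>\<in>space M. sqrt K < \<bar>G (X i) \<omega>\<bar>}" by auto
    finally have "emeasure M {\<omega>\<in>space M. sqrt K < \<bar>G (X i) \<omega>\<bar>} \<le> ennreal (2 * exp (- (sqrt K)\<^sup>2 / 2))"
      using gauss_tail[of "sqrt K"] K0 by simp
    also have "exp (- (sqrt K)\<^sup>2 / 2) = p / (8 * ?n)"
    proof -
      have s: "(sqrt K)\<^sup>2 = K" using K0 by simp
      have "0 < 8 * ?n / p" using p by simp
      then have "exp (- (sqrt K)\<^sup>2 / 2) = inverse (8 * ?n / p)" unfolding s by (simp add: K_def exp_minus)
      then show ?thesis by simp
    qed
    finally show ?thesis by simp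
  qed
  have sub: "{\<omega>\<in>space M. (b \<bullet> \<xi> \<omega>)\<^sup>2 \<le> c * (\<xi> \<omega> \<bullet> \<xi> \<omega>)}
     \<subseteq> {\<omega>\<in>space M. \<bar>b \<bullet> \<xi> \<omega>\<bar> \<le> y} \<union> (\<Union>i. {\<omega>\<in>space M. sqrt K < \<bar>G (X i) \<omega>\<bar>})"
  proof clarify
    fix \<omega> assume w: "\<omega> \<in> space M" "(b \<bullet> \<xi> \<omega>)\<^sup>2 \<le> c * (\<xi> \<omega> \<bullet> \<xi> \<omega>)" "\<omega> \<notin> (\<Union>i. {\<omega>\<in>space M. sqrt K < \<bar>G (X i) \<omega>\<bar>})"
    have "G (X i) \<omega> * G (X i) \<omega> \<le> K" for i
    proof -
      have "\<bar>G (X i) \<omega>\<bar> \<le> sqrt K" using w(1,3) by (auto simp: not_less)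
      then have "\<bar>G (X i) \<omega>\<bar>\<^sup>2 \<le> (sqrt K)\<^sup>2" by (intro power_mono) auto
      then show ?thesis using K0 by (simp add: power2_eq_square)
    qed
    then have "\<xi> \<omega> \<bullet> \<xi> \<omega> \<le> (\<Sum>i\<in>(UNIV::'n set). K)"
      unfolding \<xi>_def inner_vec_def by (simp only: vec_lambda_beta inner_real_def) (rule sum_mono)
    then have "c * (\<xi> \<omega> \<bullet> \<xi> \<omega>) \<le> c * (?n * K)" using c0 by (intro mult_left_mono) simp_all
    with w(2) have "(b \<bullet> \<xi> \<omega>)\<^sup>2 \<le> c * (?n * K)" by (rule order_trans)
    then have "\<bar>b \<bullet> \<xi> \<omega>\<bar> \<le> y" unfolding y_def using real_sqrt_le_mono[of "(b \<bullet> \<xi> \<omega>)\<^sup>2"] by simp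
    then show "\<bar>b \<bullet> \<xi> \<omega>\<bar> \<le> y" .
  qed
  have [measurable]: "(\<lambda>\<omega>. b \<bullet> \<xi> \<omega>) \<in> borel_measurable M" unfolding \<xi>_def inner_vec_def by simp
  have "emeasure M {\<omega>\<in>space M. (b \<bullet> \<xi> \<omega>)\<^sup>2 \<le> c * (\<xi> \<omega> \<bullet> \<xi> \<omega>)}
     \<le> emeasure M ({\<omega>\<in>space M. \<bar>b \<bullet> \<xi> \<omega>\<bar> \<le> y} \<union> (\<Union>i. {\<omega>\<in>space M. sqrt K < \<bar>G (X i) \<omega>\<bar>}))"
    by (rule emeasure_mono[OF sub]) measurable
  also have "\<dots> \<le> emeasure M {\<omega>\<in>space M. \<bar>b \<bullet> \<xi> \<omega>\<bar> \<le> y} + emeasure M (\<Union>i. {\<omega>\<in>space M. sqrt K < \<bar>G (X i) \<omega>\<bar>})"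
    by (rule emeasure_subadditive) measurable
  also have "\<dots> \<le> ennreal (3 / 4 * p) + (\<Sum>i\<in>UNIV. emeasure M {\<omega>\<in>space M. sqrt K < \<bar>G (X i) \<omega>\<bar>})"
    by (intro add_mono ball emeasure_subadditive_finite) auto
  also have "\<dots> \<le> ennreal (3 / 4 * p) + (\<Sum>i\<in>(UNIV::'n set). ennreal (p / (4 * ?n)))"
    by (intro add_left_mono sum_mono tail)
  also have "(\<Sum>i\<in>(UNIV::'n set). ennreal (p / (4 * ?n))) = ennreal (p / 4)"
    using p by (simp add: ennreal_of_nat_eq_real_of_nat flip: ennreal_mult)
  also have "ennreal (3 / 4 * p) + ennreal (p / 4) = ennreal p"
    using p by (simp flip: ennreal_plus)
  finally show ?thesis .
qed

text \<open>Decoupling: the sources in \<open>A\<close> and those outside are independent, so the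
  second argument may be driven by an independent copy. It serves to separate the starts from all
  other sources, and the start of one call from those of earlier calls.\<close>

lemma nn_integral_split_sources:
  fixes G :: "'s \<Rightarrow> 'a \<Rightarrow> real" and A :: "'s set"
  assumes ind: "indep_vars (\<lambda>_. borel) G UNIV"
    and F: "F \<in> borel_measurable (PiM UNIV (\<lambda>_. borel) \<Otimes>\<^sub>M PiM UNIV (\<lambda>_. borel))"
    and dep: "\<And>r r'. F (r, r') = F (mask_sources A r, mask_sources (- A) r')"
  shows "(\<integral>\<^sup>+\<omega>. F (\<lambda>s. G s \<omega>, \<lambda>s. G s \<omega>) \<partial>M) = (\<integral>\<^sup>+\<omega>. \<integral>\<^sup>+\<omega>'. F (\<lambda>s. G s \<omega>, \<lambda>s. G s \<omega>') \<partial>M \<partial>M)"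
proof -
  let ?P = "PiM UNIV (\<lambda>_::'s. borel :: real measure)"
  have e: "(\<lambda>r s. if s \<in> B then r s else 0) \<in> measurable (PiM B (\<lambda>_. borel)) ?P" for B :: "'s set"
  proof (rule measurable_PiM_single')
    fix s :: 's
    show "(\<lambda>r. if s \<in> B then r s else 0) \<in> borel_measurable (PiM B (\<lambda>_. borel))"
      by (cases "s \<in> B") (auto intro!: measurable_component_singleton)
  qed auto
  let ?X = "\<lambda>\<omega>. mask_sources A (\<lambda>s. G s \<omega>)" and ?Y = "\<lambda>\<omega>. mask_sources (- A) (\<lambda>s. G s \<omega>)"
  have "indep_var ?P ((\<lambda>r s. if s \<in> A then r s else 0) \<circ> (\<lambda>\<omega>. restrict (\<lambda>s. G s \<omega>) A))
      ?P ((\<lambda>r s. if s \<in> - A then r s else 0) \<circ> (\<lambda>\<omega>. restrict (\<lambda>s. G s \<omega>) (- A)))"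
    by (rule indep_var_compose[OF indep_var_restrict[OF ind]]) (use e[of A] e[of "- A"] in auto)
  moreover have "(\<lambda>r s. if s \<in> B then r s else 0) \<circ> (\<lambda>\<omega>. restrict (\<lambda>s. G s \<omega>) B) = (\<lambda>\<omega>. mask_sources B (\<lambda>s. G s \<omega>))" for B
    by (auto simp: mask_sources_def fun_eq_iff)
  ultimately have "indep_var ?P ?X ?P ?Y" by (simp only:)
  then have XY: "?X \<in> measurable M ?P" "?Y \<in> measurable M ?P"
    and law: "distr M ?P ?X \<Otimes>\<^sub>M distr M ?P ?Y = distr M (?P \<Otimes>\<^sub>M ?P) (\<lambda>\<omega>. (?X \<omega>, ?Y \<omega>))"
    unfolding indep_var_distribution_eq by auto
  interpret Y: prob_space "distr M ?P ?Y" by (rule prob_space_distr[OF XY(2)])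
  note F' = measurable_compose[OF _ F]
  have "(\<integral>\<^sup>+\<omega>. F (\<lambda>s. G s \<omega>, \<lambda>s. G s \<omega>) \<partial>M) = (\<integral>\<^sup>+\<omega>. F (?X \<omega>, ?Y \<omega>) \<partial>M)"
    by (simp only: dep[symmetric])
  also have "\<dots> = (\<integral>\<^sup>+z. F z \<partial>distr M (?P \<Otimes>\<^sub>M ?P) (\<lambda>\<omega>. (?X \<omega>, ?Y \<omega>)))"
    using XY F by (subst nn_integral_distr) auto
  also have "\<dots> = (\<integral>\<^sup>+x. \<integral>\<^sup>+y. F (x, y) \<partial>distr M ?P ?Y \<partial>distr M ?P ?X)"
    unfolding law[symmetric]
  proof (rule Y.nn_integral_fst[symmetric])
    have "sets (distr M ?P ?X \<Otimes>\<^sub>M distr M ?P ?Y) = sets (?P \<Otimes>\<^sub>M ?P)" by (intro sets_pair_measure_cong) simp_all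
    then show "F \<in> borel_measurable (distr M ?P ?X \<Otimes>\<^sub>M distr M ?P ?Y)"
      using F measurable_cong_sets by blast
  qed
  also have "\<dots> = (\<integral>\<^sup>+\<omega>. \<integral>\<^sup>+y. F (?X \<omega>, y) \<partial>distr M ?P ?Y \<partial>M)"
  proof (rule nn_integral_distr[OF XY(1)])
    have "sets (?P \<Otimes>\<^sub>M distr M ?P ?Y) = sets (?P \<Otimes>\<^sub>M ?P)" by (intro sets_pair_measure_cong) simp_all
    then have "F \<in> borel_measurable (?P \<Otimes>\<^sub>M distr M ?P ?Y)" using F measurable_cong_sets by blast
    from Y.borel_measurable_nn_integral_fst[OF this]
    show "(\<lambda>x. \<integral>\<^sup>+y. F (x, y) \<partial>distr M ?P ?Y) \<in> borel_measurable (distr M ?P ?X)" by simp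
  qed
  also have "\<dots> = (\<integral>\<^sup>+\<omega>. \<integral>\<^sup>+\<omega>'. F (?X \<omega>, ?Y \<omega>') \<partial>M \<partial>M)"
  proof (rule nn_integral_cong)
    fix \<omega> assume "\<omega> \<in> space M"
    then have "?X \<omega> \<in> space ?P" using XY(1) by (auto dest: measurable_space)
    then show "(\<integral>\<^sup>+y. F (?X \<omega>, y) \<partial>distr M ?P ?Y) = (\<integral>\<^sup>+\<omega>'. F (?X \<omega>, ?Y \<omega>') \<partial>M)"
      using measurable_compose[OF measurable_Pair1' F, of "?X \<omega>"] by (intro nn_integral_distr[OF XY(2)]) simp
  qed
  also have "\<dots> = (\<integral>\<^sup>+\<omega>. \<integral>\<^sup>+\<omega>'. F (\<lambda>s. G s \<omega>, \<lambda>s. G s \<omega>') \<partial>M \<partial>M)"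
    by (simp only: dep[symmetric])
  finally show ?thesis .
qed

end

section \<open>Trajectory of a run\<close>

text \<open>\<open>V\<close> is a separate argument, so that it can be frozen while the start
  remains random.\<close>

definition lmo_vec :: "('n::finite) fw_param \<Rightarrow> nat \<Rightarrow> ('n source \<Rightarrow> real) \<Rightarrow> real \<times> (real^'n) \<Rightarrow> real^'n" where
  "lmo_vec S t r V = (power_step (fw_J S V) ^^ power_count S t (fw_J S V)) (sgn (\<chi> i. r (Seed t i)))"

text \<open>The recursion ignores the stopping test and hence is defined for all \<open>t\<close>;
  the run follows it up to the stop. Statements about a fixed call number thus need no case
  distinction.\<close>

primrec fwV :: "('n::finite) fw_param \<Rightarrow> ('n source \<Rightarrow> real) \<Rightarrow> nat \<Rightarrow> real \<times> (real^'n)" where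
  "fwV S r 0 = B_op (fw_cost S) (mat 1)"
| "fwV S r (Suc t) = (1 - fw_gamma t) *\<^sub>R fwV S r t
     + fw_gamma t *\<^sub>R B_op (fw_cost S) (fw_H (fw_J S (fwV S r t)) (lmo_vec S t r (fwV S r t)))"

abbreviation fwJ :: "('n::finite) fw_param \<Rightarrow> ('n source \<Rightarrow> real) \<Rightarrow> nat \<Rightarrow> real^'n^'n" where
  "fwJ S r t \<equiv> fw_J S (fwV S r t)"

definition fww :: "('n::finite) fw_param \<Rightarrow> ('n source \<Rightarrow> real) \<Rightarrow> nat \<Rightarrow> real^'n" where
  "fww S r t = lmo_vec S t r (fwV S r t)"

primrec fwX :: "('n::finite) fw_param \<Rightarrow> ('n source \<Rightarrow> real) \<Rightarrow> nat \<Rightarrow> real^'n^'n" where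
  "fwX S r 0 = mat 1"
| "fwX S r (Suc t) = (1 - fw_gamma t) *\<^sub>R fwX S r t + fw_gamma t *\<^sub>R fw_H (fwJ S r t) (fww S r t)"

text \<open>The seeds \<open>r\<close> and the remaining normal variables \<open>r'\<close> are kept apart, so that one can condition on the seeds.\<close>

primrec fwz :: "('n::finite) fw_param \<Rightarrow> ('n source \<Rightarrow> real) \<Rightarrow> ('n source \<Rightarrow> real) \<Rightarrow> nat \<Rightarrow> real^'n" where
  "fwz S r r' 0 = (\<chi> i. r' (Init i))"
| "fwz S r r' (Suc t) = sqrt (1 - fw_gamma t) *\<^sub>R fwz S r r' t
     + (sqrt (fw_gamma t) * r' (Zeta t)) *\<^sub>R fw_direction (fwJ S r t) (fww S r t)"

definition fw_gap :: "('n::finite) fw_param \<Rightarrow> ('n source \<Rightarrow> real) \<Rightarrow> nat \<Rightarrow> real" where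
  "fw_gap S r t = (B_op (fw_cost S) (fw_H (fwJ S r t) (fww S r t)) - fwV S r t) \<bullet> fw_grad S (fwV S r t)"

definition call_count :: "('n::finite) fw_param \<Rightarrow> ('n source \<Rightarrow> real) \<Rightarrow> nat \<Rightarrow> nat" where
  "call_count S r t = power_count S t (fwJ S r t)"

text \<open>The 2 counts the step that enters LMO and the step that performs the stopping
  test.\<close>

definition start_index :: "('n::finite) fw_param \<Rightarrow> ('n source \<Rightarrow> real) \<Rightarrow> nat \<Rightarrow> nat" where
  "start_index S r t = (\<Sum>i<t. call_count S r i + 2)"

lemma fwV_eq_B_op: "fwV S r t = B_op (fw_cost S) (fwX S r t)"
  by (induction t) (simp_all add: B_op_linear_simps fww_def)

lemma start_index_Suc: "start_index S r (Suc t) = start_index S r t + call_count S r t + 2"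
  by (simp add: start_index_def)

lemma fw_run_Suc:
  "fw_run S r (Suc k) = (fw_step S r (fst (fw_run S r k)), fw_cov_step S r (fst (fw_run S r k)) (snd (fw_run S r k)))"
  by (simp add: fw_run_def case_prod_beta)

context
  fixes S :: "('n::finite) fw_param" and r :: "'n source \<Rightarrow> real"
begin

definition seed_vec :: "nat \<Rightarrow> real^'n" where
  "seed_vec t = sgn (\<chi> i. r (Seed t i))"

lemma run_power:
  assumes "fw_run S r K = (Start t z V, X)" "j \<le> power_count S t (fw_J S V)"
  shows "fw_run S r (Suc (K + j)) = (Power t z V (power_count S t (fw_J S V) - j) ((power_step (fw_J S V) ^^ j) (seed_vec t)), X)"
  using assms(2)
proof (induction j)
  case 0
  then show ?case by (simp add: fw_run_Suc assms(1) fw_cov_step_def seed_vec_def)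
next
  case (Suc j)
  then obtain m where m: "power_count S t (fw_J S V) - j = Suc m" "power_count S t (fw_J S V) - Suc j = m"
    by (metis Suc_diff_Suc Suc_le_lessD)
  have IH: "fw_run S r (Suc (K + j)) = (Power t z V (Suc m) ((power_step (fw_J S V) ^^ j) (seed_vec t)), X)"
    using Suc m by simp
  show ?case unfolding add_Suc_right fw_run_Suc[of _ _ "Suc (K + j)"] IH m
    by (simp add: fw_cov_step_def)
qed

lemma run_start:
  assumes "\<And>i. i < t \<Longrightarrow> \<not> fw_gap S r i \<le> fw_tol S"
  shows "fw_run S r (start_index S r t) = (Start t (fwz S r r t) (fwV S r t), fwX S r t)"
  using assms
proof (induction t)
  case 0
  then show ?case by (simp add: fw_run_def start_index_def)
next
  case (Suc t)
  then have st: "fw_run S r (start_index S r t) = (Start t (fwz S r r t) (fwV S r t), fwX S r t)" by simp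
  have "fw_run S r (Suc (start_index S r t + call_count S r t)) = (Power t (fwz S r r t) (fwV S r t) 0 (fww S r t), fwX S r t)"
    using run_power[OF st, of "call_count S r t"] by (simp add: call_count_def fww_def lmo_vec_def seed_vec_def)
  moreover have "start_index S r (Suc t) = Suc (Suc (start_index S r t + call_count S r t))"
    by (simp add: start_index_Suc)
  moreover have "\<not> fw_gap S r t \<le> fw_tol S" using Suc by simp
  ultimately show ?case
    by (simp add: fw_run_Suc[of _ _ "Suc _"] fw_cov_step_def Let_def fw_gap_def fww_def algebra_simps)
qed

lemma run_inner:
  assumes "\<And>i. i < t \<Longrightarrow> \<not> fw_gap S r i \<le> fw_tol S" "j \<le> call_count S r t"
  shows "fw_run S r (Suc (start_index S r t + j))
    = (Power t (fwz S r r t) (fwV S r t) (call_count S r t - j) ((power_step (fwJ S r t) ^^ j) (seed_vec t)), fwX S r t)"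
  using run_power[OF run_start[OF assms(1)]] assms(2) unfolding call_count_def by blast

lemma run_call_end:
  assumes "\<And>i. i < t \<Longrightarrow> \<not> fw_gap S r i \<le> fw_tol S"
  shows "fw_run S r (Suc (start_index S r t + call_count S r t)) = (Power t (fwz S r r t) (fwV S r t) 0 (fww S r t), fwX S r t)"
  using run_inner[OF assms order_refl] by (simp add: call_count_def fww_def lmo_vec_def seed_vec_def)

lemma index_decomposition:
  "l < start_index S r m \<Longrightarrow> \<exists>t<m. \<exists>j \<le> Suc (call_count S r t). l = start_index S r t + j"
proof (induction m)
  case 0
  then show ?case by (simp add: start_index_def)
next
  case (Suc m)
  show ?case
  proof (cases "l < start_index S r m")
    case True
    then show ?thesis using Suc by (meson less_SucI)
  next
    case False
    then show ?thesis using Suc.prems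
      by (intro exI[of _ m] conjI exI[of _ "l - start_index S r m"]) (auto simp: start_index_Suc)
  qed
qed

context
  fixes \<tau>
  assumes stop: "fw_gap S r \<tau> \<le> fw_tol S" and nonstop: "\<And>i. i < \<tau> \<Longrightarrow> \<not> fw_gap S r i \<le> fw_tol S"
begin

lemma run_stop: "fw_run S r (start_index S r (Suc \<tau>)) = (Stop \<tau> (fwz S r r \<tau>) (fwV S r \<tau>), fwX S r \<tau>)"
proof -
  have "start_index S r (Suc \<tau>) = Suc (Suc (start_index S r \<tau> + call_count S r \<tau>))" by (simp add: start_index_Suc)
  then show ?thesis using run_call_end[OF nonstop] stop
    by (simp add: fw_run_Suc[of _ _ "Suc _"] fw_cov_step_def Let_def fw_gap_def fww_def)
qed

lemma run_output:
  "start_index S r (Suc \<tau>) < l \<Longrightarrow>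
    fw_run S r l = (Output (generate_sample (fwz S r r \<tau>) (snd (fwV S r \<tau>)) (\<chi> i. r (Round i))), fwX S r \<tau>)"
proof (induction l)
  case (Suc l)
  show ?case
  proof (cases "l = start_index S r (Suc \<tau>)")
    case True
    then show ?thesis using run_stop by (simp add: fw_run_Suc fw_cov_step_def)
  next
    case False
    then have "start_index S r (Suc \<tau>) < l" using Suc.prems by simp
    from Suc.IH[OF this] show ?thesis by (simp add: fw_run_Suc fw_cov_step_def)
  qed
qed simp

text \<open>An explicit form of every configuration of the run. Uniqueness of the output and of the
  stop, the meaning of \<open>lmo_success\<close> and the count of multiplications follow by
  inspecting the four cases.\<close>

lemma run_cases:
  obtains (starts) t where "t \<le> \<tau>" "l = start_index S r t" "fw_run S r l = (Start t (fwz S r r t) (fwV S r t), fwX S r t)"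
  | (inner) t j where "t \<le> \<tau>" "j \<le> call_count S r t" "l = Suc (start_index S r t + j)"
      "fw_run S r l = (Power t (fwz S r r t) (fwV S r t) (call_count S r t - j) ((power_step (fwJ S r t) ^^ j) (seed_vec t)), fwX S r t)"
  | (stops) "l = start_index S r (Suc \<tau>)" "fw_run S r l = (Stop \<tau> (fwz S r r \<tau>) (fwV S r \<tau>), fwX S r \<tau>)"
  | (outputs) "fw_run S r l = (Output (generate_sample (fwz S r r \<tau>) (snd (fwV S r \<tau>)) (\<chi> i. r (Round i))), fwX S r \<tau>)"
proof -
  consider "l < start_index S r (Suc \<tau>)" | "l = start_index S r (Suc \<tau>)" | "start_index S r (Suc \<tau>) < l"
    by linarith
  then show thesis
  proof cases
    case 1
    from index_decomposition[OF 1] obtain t j where t: "t < Suc \<tau>" "j \<le> Suc (call_count S r t)" "l = start_index S r t + j"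
      by blast
    have ns: "\<And>i. i < t \<Longrightarrow> \<not> fw_gap S r i \<le> fw_tol S" using nonstop t(1) by simp
    show thesis
    proof (cases j)
      case 0
      then show thesis using starts[of t] run_start[OF ns] t by simp
    next
      case (Suc i)
      have i: "i \<le> call_count S r t" "l = Suc (start_index S r t + i)" using t Suc by auto
      have "t \<le> \<tau>" using t by simp
      then show thesis
      proof (rule inner[of t i, OF _ i])
        show "fw_run S r l = (Power t (fwz S r r t) (fwV S r t) (call_count S r t - i) ((power_step (fwJ S r t) ^^ i) (seed_vec t)), fwX S r t)"
          unfolding i(2) by (rule run_inner) (use ns i(1) in auto)
      qed
    qed
  next
    case 2
    then show thesis using stops run_stop by simp
  next
    case 3
    then show thesis using outputs run_output by simp
  qed
qed

lemma fw_output_eq: "fw_output S r = generate_sample (fwz S r r \<tau>) (snd (fwV S r \<tau>)) (\<chi> i. r (Round i))"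
  unfolding fw_output_def
proof (rule the_equality)
  show "\<exists>k X. fw_run S r k = (Output (generate_sample (fwz S r r \<tau>) (snd (fwV S r \<tau>)) (\<chi> i. r (Round i))), X)"
    using run_output[OF lessI] by blast
next
  fix w assume "\<exists>k X. fw_run S r k = (Output w, X)"
  then obtain k X where k: "fw_run S r k = (Output w, X)" by blast
  show "w = generate_sample (fwz S r r \<tau>) (snd (fwV S r \<tau>)) (\<chi> i. r (Round i))"
    by (rule run_cases[of k]) (use k in auto)
qed

lemma fw_stops_iff: "fw_stops S r t X \<longleftrightarrow> t = \<tau> \<and> X = fwX S r \<tau>"
proof
  assume "fw_stops S r t X"
  then obtain k z V where k: "fw_run S r k = (Stop t z V, X)" unfolding fw_stops_def by blast
  show "t = \<tau> \<and> X = fwX S r \<tau>" by (rule run_cases[of k]) (use k in auto)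
next
  assume "t = \<tau> \<and> X = fwX S r \<tau>"
  then show "fw_stops S r t X" unfolding fw_stops_def using run_stop by blast
qed

lemma lmo_success_iff:
  "lmo_success S r \<longleftrightarrow> (\<forall>t\<le>\<tau>. norm (fww S r t) = 1 \<and>
     real CARD('n) * (fww S r t \<bullet> (fwJ S r t *v fww S r t)) \<ge> real CARD('n) * lambda_max (fwJ S r t) - lmo_error S t)"
  (is "_ \<longleftrightarrow> ?R")
proof
  assume s: "lmo_success S r"
  show ?R
  proof (intro allI impI)
    fix t assume "t \<le> \<tau>"
    then have "\<And>i. i < t \<Longrightarrow> \<not> fw_gap S r i \<le> fw_tol S" using nonstop by simp
    from run_call_end[OF this] show "norm (fww S r t) = 1 \<and>
     real CARD('n) * (fww S r t \<bullet> (fwJ S r t *v fww S r t)) \<ge> real CARD('n) * lambda_max (fwJ S r t) - lmo_error S t"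
      using s unfolding lmo_success_def by blast
  qed
next
  assume R: ?R
  show "lmo_success S r" unfolding lmo_success_def
  proof (intro allI impI)
    fix k t z V w X assume k: "fw_run S r k = (Power t z V 0 w, X)"
    show "norm w = 1 \<and> real CARD('n) * (w \<bullet> (fw_J S V *v w)) \<ge> real CARD('n) * lambda_max (fw_J S V) - lmo_error S t"
    proof (rule run_cases[of k])
      fix t' j
      assume a: "t' \<le> \<tau>" "j \<le> call_count S r t'"
        "fw_run S r k = (Power t' (fwz S r r t') (fwV S r t') (call_count S r t' - j) ((power_step (fwJ S r t') ^^ j) (seed_vec t')), fwX S r t')"
      then have "j = call_count S r t'" using k by simp
      then have "t = t'" "V = fwV S r t'" "w = fww S r t'"
        using a k by (auto simp: call_count_def fww_def lmo_vec_def seed_vec_def)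
      then show ?thesis using R a(1) by simp
    qed (use k in auto)
  qed
qed

text \<open>The \<open>Power\<close> configurations of iteration \<open>t\<close> are consecutive;
  the last of them, with counter 0, accounts for the additional multiplication.\<close>

lemma fw_matvecs_le: "fw_matvecs S r t k \<le> call_count S r t + 1"
proof -
  have "{l. l < k \<and> (\<exists>z V j x X. fw_run S r l = (Power t z V j x, X))} \<subseteq> (\<lambda>j. Suc (start_index S r t + j)) ` {..call_count S r t}"
  proof clarify
    fix l z V j x X assume l: "fw_run S r l = (Power t z V j x, X)"
    show "l \<in> (\<lambda>j. Suc (start_index S r t + j)) ` {..call_count S r t}"
      by (rule run_cases[of l]) (use l in auto)
  qed
  then have "fw_matvecs S r t k \<le> card ((\<lambda>j. Suc (start_index S r t + j)) ` {..call_count S r t})"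
    unfolding fw_matvecs_def by (intro card_mono) auto
  also have "\<dots> \<le> card {..call_count S r t}" by (rule card_image_le) simp
  finally show ?thesis by simp
qed

end

end

lemma working_memory_le: "real (working_memory c) \<le> 3 * real CARD('n)" for c :: "('n::finite) config"
  by (cases c) (simp_all add: working_memory_def)

section \<open>The power method\<close>

text \<open>Normalization can be postponed to the end, since the linear step commutes with positive
  scaling and \<open>sgn\<close> forgets it.\<close>

lemma power_step_iterate:
  "(power_step J ^^ k) (sgn x) = sgn (((\<lambda>y. J *v y + abs_eigenvalue_max J *\<^sub>R y) ^^ k) x)"
proof (induction k)
  case (Suc k)
  let ?B = "\<lambda>y. J *v y + abs_eigenvalue_max J *\<^sub>R y"
  have "power_step J (sgn y) = sgn (?B y)" for y
  proof (cases "y = 0")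
    case False
    have "J *v sgn y + abs_eigenvalue_max J *\<^sub>R sgn y = inverse (norm y) *\<^sub>R ?B y"
      by (simp add: sgn_div_norm matrix_vector_mult_scaleR algebra_simps)
    then show ?thesis using False by (simp add: power_step_def sgn_scaleR)
  qed (simp add: power_step_def)
  then show ?case using Suc by simp
qed simp

lemma shifted_power_inner:
  assumes "eigenbasis J B l" "b \<in> B"
  shows "((\<lambda>y. J *v y + c *\<^sub>R y) ^^ k) x \<bullet> b = (l b + c) ^ k * (x \<bullet> b)"
  by (induction k) (simp_all add: inner_add_left eb_mult_inner[OF assms] algebra_simps)

lemma mult_exp_neg_le: "z * exp (- z) \<le> exp (- 1)" for z :: real
proof -
  have "z \<le> exp (z - 1)" using exp_ge_add_one_self[of "z - 1"] by simp
  then have "z * exp (- z) \<le> exp (z - 1) * exp (- z)" by (intro mult_right_mono) auto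
  then show ?thesis by (simp flip: exp_add)
qed

text \<open>\<open>D\<close> is the deficit of an eigenvalue against the largest one; only deficits
  above \<open>\<delta>\<close> contribute negatively. For them
  \<open>1 - D / \<mu> \<le> exp (- D / \<mu>)\<close> gives the weight
  \<open>exp (- (a * D))\<close>. Splitting \<open>D = u + \<delta>\<close> produces a factor
  \<open>exp (- L)\<close> from \<open>\<delta>\<close>, and
  \<open>z * exp (- z) \<le> 1 / e\<close> takes care of \<open>u\<close>.\<close>

lemma power_weight_lower:
  fixes \<mu> \<kappa> D \<delta> L :: real
  assumes \<mu>: "0 < \<mu>" "\<mu> \<le> 2 * \<kappa>" and D: "0 \<le> D" "D \<le> \<mu>" and \<delta>: "0 < \<delta>" and L: "0 < L"
    and k: "\<kappa> / \<delta> * L \<le> real k"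
  shows "- (\<mu> ^ (2 * k) * \<delta> * (exp (- L) / (exp 1 * L))) \<le> (\<delta> - D) * (\<mu> - D) ^ (2 * k)"
proof (cases "D \<le> \<delta>")
  case True
  have "0 \<le> (\<delta> - D) * (\<mu> - D) ^ (2 * k)" using True by simp
  moreover have "0 \<le> \<mu> ^ (2 * k) * \<delta> * (exp (- L) / (exp 1 * L))" using \<mu> \<delta> L by simp
  ultimately show ?thesis by linarith
next
  case False
  define a where "a = 2 * real k / \<mu>"
  define u where "u = D - \<delta>"
  have u: "0 < u" using False by (simp add: u_def)
  have \<kappa>: "0 < \<kappa>" using \<mu> by linarith
  have aL: "L \<le> a * \<delta>"
  proof -
    have "\<kappa> * L \<le> real k * \<delta>" using k \<delta> by (simp add: field_simps)
    then have "\<mu> * L \<le> 2 * real k * \<delta>" using \<mu> L mult_right_mono[of \<mu> "2 * \<kappa>" L] by linarith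
    then show ?thesis using \<mu> by (simp add: a_def field_simps)
  qed
  have a0: "0 < a" using aL L \<delta> by (smt (verit) mult_nonpos_nonneg)
  have "(\<mu> - D) ^ (2 * k) = \<mu> ^ (2 * k) * (1 - D / \<mu>) ^ (2 * k)"
    using \<mu> by (simp add: field_simps flip: power_mult_distrib)
  also have "\<dots> \<le> \<mu> ^ (2 * k) * exp (- D / \<mu>) ^ (2 * k)"
    using D \<mu> exp_ge_add_one_self[of "- D / \<mu>"] by (intro mult_left_mono power_mono) auto
  also have "exp (- D / \<mu>) ^ (2 * k) = exp (- (a * D))"
    by (simp add: a_def flip: exp_of_nat_mult)
  finally have 1: "u * (\<mu> - D) ^ (2 * k) \<le> u * (\<mu> ^ (2 * k) * exp (- (a * D)))" using u by (intro mult_left_mono) auto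
  have "exp (- (a * D)) = exp (- (a * u)) * exp (- (a * \<delta>))"
    by (simp add: u_def algebra_simps flip: exp_add)
  then have "u * exp (- (a * D)) = ((a * u) * exp (- (a * u))) * exp (- (a * \<delta>)) / a" using a0 by simp
  also have "\<dots> \<le> exp (- 1) * exp (- L) / a"
    using aL a0 by (intro divide_right_mono mult_mono mult_exp_neg_le) auto
  also have "\<dots> \<le> exp (- 1) * exp (- L) / (L / \<delta>)"
    using aL a0 L \<delta> by (intro divide_left_mono mult_pos_pos) (auto simp: field_simps)
  also have "\<dots> = \<delta> * (exp (- L) / (exp 1 * L))" by (simp add: exp_minus field_simps)
  finally have "\<mu> ^ (2 * k) * (u * exp (- (a * D))) \<le> \<mu> ^ (2 * k) * (\<delta> * (exp (- L) / (exp 1 * L)))"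
    using \<mu> by (intro mult_left_mono) auto
  then have "u * (\<mu> - D) ^ (2 * k) \<le> \<mu> ^ (2 * k) * \<delta> * (exp (- L) / (exp 1 * L))"
    using 1 by (simp add: mult_ac)
  then show ?thesis by (simp add: u_def algebra_simps)
qed

text \<open>In an eigenbasis, the quadratic form of the iterate minus
  \<open>lambda_max J - \<delta>\<close> times its squared norm gets at least
  \<open>\<mu>^(2 * k) * \<delta> * (b \<bullet> x)^2\<close> from the top eigenspace. All other
  eigenvectors together take away at most \<open>\<mu>^(2 * k) * \<delta>\<close> times the
  left-hand side of \<open>x\<close>.\<close>

lemma power_method_success:
  assumes sym: "symmetric_matrix J" and b: "norm b = 1" "J *v b = lambda_max J *\<^sub>R b" and pos: "0 < lambda_max J"
    and \<delta>: "0 < \<delta>" and L: "0 < L" and k: "abs_eigenvalue_max J / \<delta> * L \<le> real k"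
    and x: "exp (- L) / (exp 1 * L) * (x \<bullet> x) < (b \<bullet> x)\<^sup>2"
  defines "w \<equiv> (power_step J ^^ k) (sgn x)"
  shows "norm w = 1" "lambda_max J - \<delta> \<le> w \<bullet> (J *v w)"
proof -
  define \<kappa> where "\<kappa> = abs_eigenvalue_max J"
  define \<mu> where "\<mu> = lambda_max J + \<kappa>"
  let ?y = "((\<lambda>y. J *v y + \<kappa> *\<^sub>R y) ^^ k) x"
  obtain B l where eb: "eigenbasis J B l" using eigenbasis_exists[OF sym] by blast
  have w: "w = sgn ?y" unfolding w_def \<kappa>_def by (rule power_step_iterate)
  have "lambda_max J \<le> \<kappa>"
    using abs_quadratic_le_abs_eigenvalue_max[OF sym, of b] b pos by (simp add: \<kappa>_def dot_square_norm)
  \<comment> \<open>The shift at most doubles the top eigenvalue relative to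
    \<open>\<kappa>\<close>. This is compensated by the exponent \<open>2 * k\<close>, which appears
    because the form is quadratic in the iterate.\<close>
  then have \<mu>: "0 < \<mu>" "\<mu> \<le> 2 * \<kappa>" using pos by (auto simp: \<mu>_def)
  have yb: "b \<bullet> ?y = \<mu> ^ k * (b \<bullet> x)"
  proof (induction k)
    case (Suc k)
    let ?z = "((\<lambda>y. J *v y + \<kappa> *\<^sub>R y) ^^ k) x"
    have "b \<bullet> (J *v ?z) = lambda_max J * (b \<bullet> ?z)"
      using symmetric_matrix_inner[OF sym, of b ?z] b(2) by (simp add: inner_commute)
    then show ?case using Suc by (simp add: inner_add_right \<mu>_def algebra_simps)
  qed simp
  have "0 \<le> exp (- L) / (exp 1 * L) * (x \<bullet> x)" using L by simp
  then have "b \<bullet> x \<noteq> 0" using x by auto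
  then have y0: "?y \<noteq> 0" using yb \<mu> by auto
  then show "norm w = 1" by (simp add: w norm_sgn)
  have main: "0 \<le> ?y \<bullet> (J *v ?y) - (lambda_max J - \<delta>) * (?y \<bullet> ?y)"
  proof -
    define q where "q = exp (- L) / (exp 1 * L)"
    define f where "f = (\<lambda>c. (l c - (lambda_max J - \<delta>)) * ((l c + \<kappa>) ^ (2 * k) * (x \<bullet> c)\<^sup>2))"
    define top where "top = {c \<in> B. l c = lambda_max J}"
    have e: "?y \<bullet> (J *v ?y) - (lambda_max J - \<delta>) * (?y \<bullet> ?y) = (\<Sum>c\<in>B. f c)"
    proof -
      have p: "a ^ (2 * k) = a ^ k * a ^ k" for a :: real by (simp add: mult_2 power_add)
      show ?thesis
        unfolding eb_quadratic[OF eb] eb_inner[OF eb, of ?y ?y] sum_distrib_left sum_subtractf[symmetric] f_def p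
        by (intro sum.cong refl) (simp add: shifted_power_inner[OF eb] power2_eq_square algebra_simps)
    qed
    have low: "- (\<mu> ^ (2 * k) * \<delta> * q) * (x \<bullet> c)\<^sup>2 \<le> f c" if "c \<in> B" for c
    proof -
      have "lambda_max J - l c \<le> \<mu>" using eb_abs_le[OF eb that] by (simp add: \<mu>_def \<kappa>_def)
      then have "- (\<mu> ^ (2 * k) * \<delta> * q) \<le> (\<delta> - (lambda_max J - l c)) * (\<mu> - (lambda_max J - l c)) ^ (2 * k)"
        unfolding q_def using eb_le_lambda_max[OF eb that] k by (intro power_weight_lower[OF \<mu> _ _ \<delta> L]) (auto simp: \<kappa>_def)
      then have "- (\<mu> ^ (2 * k) * \<delta> * q) * (x \<bullet> c)\<^sup>2 \<le> (\<delta> - (lambda_max J - l c)) * (\<mu> - (lambda_max J - l c)) ^ (2 * k) * (x \<bullet> c)\<^sup>2"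
        by (intro mult_right_mono) auto
      then show ?thesis by (simp add: f_def \<mu>_def algebra_simps)
    qed
    have fB: "finite B" by (rule eb_finite[OF eb])
    have top: "f c = \<mu> ^ (2 * k) * \<delta> * (x \<bullet> c)\<^sup>2" if "c \<in> top" for c
      using that by (simp add: top_def f_def \<mu>_def)
    \<comment> \<open>The given \<open>b\<close> need not belong to the basis, but it lies in the
      span of \<open>top\<close>, so Cauchy-Schwarz applies there.\<close>
    have bx: "(b \<bullet> x)\<^sup>2 \<le> (\<Sum>c\<in>top. (x \<bullet> c)\<^sup>2)"
    proof -
      have z: "b \<bullet> c = 0" if "c \<in> B - top" for c
      proof -
        have "lambda_max J * (b \<bullet> c) = l c * (b \<bullet> c)" using eb_mult_inner[OF eb, of c b] b(2) that by simp
        then show ?thesis using that by (auto simp: top_def)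
      qed
      have s: "(\<Sum>c\<in>B. (b \<bullet> c) * g c) = (\<Sum>c\<in>top. (b \<bullet> c) * g c)" for g
        using z fB by (intro sum.mono_neutral_right) (auto simp: top_def)
      have "(b \<bullet> x)\<^sup>2 = (\<Sum>c\<in>top. (b \<bullet> c) * (x \<bullet> c))\<^sup>2" unfolding eb_inner[OF eb, of b x] s ..
      also have "\<dots> \<le> (\<Sum>c\<in>top. (b \<bullet> c)\<^sup>2) * (\<Sum>c\<in>top. (x \<bullet> c)\<^sup>2)" by (rule Cauchy_Schwarz_ineq_sum)
      also have "(\<Sum>c\<in>top. (b \<bullet> c)\<^sup>2) = 1"
        using b(1) eb_inner[OF eb, of b b] s[of "\<lambda>c. b \<bullet> c"] by (simp add: power2_eq_square dot_square_norm)
      finally show ?thesis by simp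
    qed
    have "0 \<le> \<mu> ^ (2 * k) * \<delta> * (b \<bullet> x)\<^sup>2 - \<mu> ^ (2 * k) * \<delta> * q * (x \<bullet> x)"
      using mult_left_mono[OF less_imp_le[OF x], of "\<mu> ^ (2 * k) * \<delta>"] \<mu> \<delta> by (simp add: q_def mult.assoc)
    also have "\<dots> \<le> \<mu> ^ (2 * k) * \<delta> * (\<Sum>c\<in>top. (x \<bullet> c)\<^sup>2) - \<mu> ^ (2 * k) * \<delta> * q * (\<Sum>c\<in>B. (x \<bullet> c)\<^sup>2)"
      using mult_left_mono[OF bx, of "\<mu> ^ (2 * k) * \<delta>"] \<mu> \<delta> eb_inner[OF eb, of x x] by (simp add: power2_eq_square)
    also have "\<dots> \<le> (\<Sum>c\<in>top. f c) + (\<Sum>c\<in>B - top. f c)"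
    proof -
      have q: "0 \<le> \<mu> ^ (2 * k) * \<delta> * q" using \<mu> \<delta> L by (simp add: q_def)
      have t: "(\<Sum>c\<in>top. f c) = \<mu> ^ (2 * k) * \<delta> * (\<Sum>c\<in>top. (x \<bullet> c)\<^sup>2)"
        unfolding sum_distrib_left by (intro sum.cong top refl)
      have "(\<Sum>c\<in>B - top. - (\<mu> ^ (2 * k) * \<delta> * q) * (x \<bullet> c)\<^sup>2) \<le> (\<Sum>c\<in>B - top. f c)"
        using low by (intro sum_mono) auto
      moreover have "(\<Sum>c\<in>B - top. - (\<mu> ^ (2 * k) * \<delta> * q) * (x \<bullet> c)\<^sup>2) = - (\<mu> ^ (2 * k) * \<delta> * q * (\<Sum>c\<in>B - top. (x \<bullet> c)\<^sup>2))"
        by (simp only: sum_distrib_left sum_negf mult_minus_left)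
      moreover have "\<mu> ^ (2 * k) * \<delta> * q * (\<Sum>c\<in>B - top. (x \<bullet> c)\<^sup>2) \<le> \<mu> ^ (2 * k) * \<delta> * q * (\<Sum>c\<in>B. (x \<bullet> c)\<^sup>2)"
        using q fB by (intro mult_left_mono sum_mono2) auto
      ultimately show ?thesis unfolding t by linarith
    qed
    also have "\<dots> = (\<Sum>c\<in>B. f c)" using fB by (subst sum.subset_diff[of top B]) (auto simp: top_def)
    finally show ?thesis unfolding e .
  qed
  have "w \<bullet> (J *v w) = (?y \<bullet> (J *v ?y)) / (?y \<bullet> ?y)"
    using y0 by (simp add: w sgn_div_norm matrix_vector_mult_scaleR power2_norm_eq_inner[symmetric] power2_eq_square divide_inverse)
  moreover have "0 < ?y \<bullet> ?y" using y0 by simp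
  ultimately show "lambda_max J - \<delta> \<le> w \<bullet> (J *v w)" using main by (simp add: pos_le_divide_eq)
qed

lemma lmo_vec_norm: "lmo_vec S t r V \<bullet> lmo_vec S t r V \<le> 1"
proof -
  have "norm (lmo_vec S t r V) \<le> 1" by (simp add: lmo_vec_def power_step_iterate norm_sgn)
  then show ?thesis by (simp add: dot_square_norm power_le_one)
qed

section \<open>Convergence of Frank-Wolfe\<close>

locale max_cut_frank_wolfe =
  fixes C :: "real^'n::finite^'n" and \<epsilon> n T :: real and extra :: "nat \<Rightarrow> nat" and S :: "'n fw_param"
  assumes eps: "0 < \<epsilon>" "\<epsilon> < 1 / 3"
    and C: "symmetric_matrix C" "diagonally_dominant C" "\<And>i. C $ i $ i > 0"
    and n: "n = real CARD('n)"
    and T: "T = 64 * (ln (2 * n) * n\<^sup>2 / \<epsilon>\<^sup>2)"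
    and S: "S = \<lparr> fw_cost = C, fw_beta = 4 * trace C, fw_M = 4 * (ln (2 * n) / \<epsilon>),
                  fw_curv = 16 * (trace C * ln (2 * n) * n\<^sup>2 / \<epsilon>), fw_tol = \<epsilon> * trace C,
                  fw_eta = 1, fw_p = \<epsilon> / T, fw_extra = extra \<rparr>"
begin

lemma S_simps: "fw_cost S = C" "fw_beta S = 4 * trace C" "fw_M S = 4 * (ln (2 * n) / \<epsilon>)"
  "fw_curv S = 16 * (trace C * ln (2 * n) * n\<^sup>2 / \<epsilon>)" "fw_tol S = \<epsilon> * trace C"
  "fw_eta S = 1" "fw_p S = \<epsilon> / T" "fw_extra S = extra"
  by (simp_all add: S)

abbreviation "M \<equiv> fw_M S"
abbreviation "\<beta> \<equiv> fw_beta S"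
abbreviation "Cg \<equiv> fw_curv S"
abbreviation "tol \<equiv> fw_tol S"

lemma n_ge_1: "1 \<le> n"
  by (simp add: n Suc_le_eq)

lemma ln_2n: "693 / 1000 \<le> ln (2 * n)"
proof -
  have "ln 2 \<le> ln (2 * n)" using n_ge_1 by (subst ln_le_cancel_iff) auto
  then show ?thesis using ln2_lower by linarith
qed

lemma ln_2n_pos: "0 < ln (2 * n)"
  using ln_2n by linarith

lemma M_ge: "12 * ln (2 * n) \<le> M"
proof -
  have "3 * \<epsilon> * ln (2 * n) \<le> 1 * ln (2 * n)" using eps ln_2n_pos by (intro mult_right_mono) auto
  then show ?thesis using eps by (simp add: S_simps field_simps)
qed

lemma M_pos: "0 < M" and M_nz: "M \<noteq> 0"
  using M_ge ln_2n_pos by linarith+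

lemma trace_C_pos: "0 < trace C"
  by (rule trace_pos[OF C S_simps(2) M_pos])

lemma beta_nonneg: "0 \<le> \<beta>"
  using trace_C_pos by (simp add: S_simps)

lemma Cg_eq: "Cg = \<beta> * M * n\<^sup>2"
  using eps by (simp add: S_simps)

lemma Cg_pos: "0 < Cg"
  using trace_C_pos ln_2n_pos n_ge_1 eps by (simp add: S_simps)

lemma tol_pos: "0 < tol"
  using trace_C_pos eps by (simp add: S_simps)

text \<open>The origin of the 64: it is 4 times the 16 in the curvature bound.\<close>

lemma T_eq: "T = 4 * Cg / tol"
  using trace_C_pos eps by (simp add: S_simps T power2_eq_square field_simps)

lemma T_ge: "576 * ln (2 * n) * n\<^sup>2 \<le> T"
proof -
  have "9 * \<epsilon>\<^sup>2 \<le> 1" using eps power_mono[of \<epsilon> "1/3" 2] by (simp add: power_divide)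
  then have "9 * (64 * (ln (2 * n) * n\<^sup>2)) * \<epsilon>\<^sup>2 \<le> 64 * (ln (2 * n) * n\<^sup>2)"
    using mult_right_mono[of "9 * \<epsilon>\<^sup>2" 1 "64 * (ln (2 * n) * n\<^sup>2)"] ln_2n_pos by (simp add: mult_ac)
  then show ?thesis using eps unfolding T by (simp add: pos_le_divide_eq)
qed

lemma T_ge_399: "399 \<le> T"
proof -
  have "693 / 1000 * 1 \<le> ln (2 * n) * n\<^sup>2" using ln_2n n_ge_1 by (intro mult_mono) auto
  then show ?thesis using T_ge by simp
qed

text \<open>The size of \<open>T\<close> at which \<open>frank_wolfe_gap_contradiction\<close>
  absorbs its rounding losses.\<close>

lemma T_ge_3000:
  assumes "2 \<le> CARD('n)"
  shows "3000 \<le> T"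
proof -
  have n2: "2 \<le> n" using assms by (simp add: n)
  have "ln 4 \<le> ln (2 * n)" using n2 by (subst ln_le_cancel_iff) auto
  moreover have "ln 4 = 2 * ln (2::real)" using ln_realpow[of 2 2] by simp
  ultimately have "1386 / 1000 \<le> ln (2 * n)" using ln2_lower by linarith
  then have "1386 / 1000 * 4 \<le> ln (2 * n) * n\<^sup>2" using n2 power_mono[of 2 n 2] by (intro mult_mono) auto
  then show ?thesis using T_ge by simp
qed

lemma p_bounds: "0 < fw_p S" "fw_p S \<le> 1 / 8" "T * fw_p S = \<epsilon>"
  using eps T_ge_399 by (auto simp: S_simps field_simps)

lemma fww_norm: "fww S r t \<bullet> fww S r t \<le> 1"
  unfolding fww_def by (rule lmo_vec_norm)

lemma gamma_bounds: "0 \<le> fw_gamma t" "fw_gamma t \<le> 1"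
  by (auto simp: fw_gamma_def)

lemma fwX_feasible: "fwX S r t \<in> feasible"
  by (induction t) (simp_all add: feasible_mat_1 feasible_convex feasible_fw_H fww_norm gamma_bounds)

lemma snd_fwV: "snd (fwV S r t) = diag_vec (fwX S r t)"
  by (simp add: fwV_eq_B_op B_op_def)

lemma fwJ_eq: "fwJ S r t = Jmat C \<beta> M (diag_vec (fwX S r t))"
  by (simp only: fw_J_eq[OF M_nz] snd_fwV S_simps(1))

lemma symmetric_fwJ: "symmetric_matrix (fwJ S r t)"
  unfolding fwJ_eq by (rule symmetric_Jmat[OF C(1)])

lemma lambda_max_fwJ_pos: "0 < lambda_max (fwJ S r t)"
  unfolding fwJ_eq by (rule lambda_max_Jmat_pos[OF C S_simps(2) M_pos fwX_feasible])

lemma fw_gap_inner: "fw_gap S r t = fwJ S r t \<bullet> (fw_H (fwJ S r t) (fww S r t) - fwX S r t)"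
  unfolding fw_gap_def fwV_eq_B_op[of S r t] fw_gap_eq[OF M_nz]
  by (simp only: fw_J_eq[OF M_nz] B_op_def snd_conv S_simps(1))

lemma fw_objective_eq: "fw_objective S X = obj C \<beta> M X"
  by (simp add: fw_objective_def obj_def S_simps(1))

text \<open>Only \<open>norm w \<le> 1\<close> enters, so this holds whether or not the call
  succeeds, and also at \<open>t = 0\<close>, where \<open>fw_gamma 0 = 1\<close> is out of reach of
  \<open>step_log\<close>.\<close>

lemma step_quadratic:
  "obj C \<beta> M (fwX S r t) + fw_gamma t * fw_gap S r t - Cg * (fw_gamma t)\<^sup>2 / 2 \<le> obj C \<beta> M (fwX S r (Suc t))"
  using obj_step_quadratic[OF M_pos beta_nonneg fwX_feasible[of r t] feasible_fw_H[OF fww_norm[of r t], of "fwJ S r t"] gamma_bounds(1)[of t], of C]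
  by (simp only: fwX.simps fw_gap_inner fwJ_eq Cg_eq n)

lemma trace_fw_H:
  fixes w :: "real^'n"
  assumes "norm w = 1"
  shows "trace (fw_H J w) = n \<or> fw_H J w = 0"
  using assms trace_combine[of n "rank_one w" 0 "rank_one w"]
  by (auto simp: fw_H_def n trace_rank_one dot_square_norm)

lemma neg_ln_gamma_le:
  assumes "1 \<le> t"
  shows "- ln (1 - fw_gamma t) - fw_gamma t \<le> 2 / (real t * (real t + 2))"
proof -
  have t: "0 < real t" using assms by simp
  have g: "1 - fw_gamma t = 1 / ((real t + 2) / real t)" using t by (simp add: fw_gamma_def field_simps)
  have "- ln (1 - fw_gamma t) = ln ((real t + 2) / real t)" unfolding g using t by (subst ln_div) auto
  also have "\<dots> \<le> ((real t + 2) / real t - 1 / ((real t + 2) / real t)) / 2"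
    using t by (intro ln_le_half_diff_inverse) (simp add: field_simps)
  finally have "- ln (1 - fw_gamma t) - fw_gamma t \<le> ((real t + 2) / real t - 1 / ((real t + 2) / real t)) / 2 - 2 / (real t + 2)"
    by (simp add: fw_gamma_def)
  also have "\<dots> = 2 / (real t * (real t + 2))" using t by (simp add: divide_simps) (simp add: algebra_simps)
  finally show ?thesis .
qed

lemma step_log:
  assumes n2: "2 \<le> CARD('n)" and t: "1 \<le> t" and w: "norm (fww S r t) = 1"
  shows "obj C \<beta> M (fwX S r t) + 2 / (real t + 2) * fw_gap S r t - 28 / 100 * Cg * (2 / (real t * (real t + 2)))
    \<le> obj C \<beta> M (fwX S r (Suc t))"
proof -
  let ?H = "fw_H (fwJ S r t) (fww S r t)" and ?g = "fw_gamma t"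
  have g: "0 \<le> ?g" "?g < 1" using t by (auto simp: fw_gamma_def)
  have H: "0 \<le> ?H $ i $ i" "trace ?H = real CARD('n) \<or> ?H = 0" for i
    using feasible_diag(1)[OF feasible_fw_H[OF fww_norm]] trace_fw_H[OF w] by (auto simp: n)
  have "obj C \<beta> M (fwX S r t) + ?g * fw_gap S r t - \<beta> * M * (28 / 100 * n\<^sup>2) * (- ln (1 - ?g) - ?g)
    \<le> obj C \<beta> M (fwX S r (Suc t))"
    using obj_step_log[OF n2 M_ge[unfolded n] beta_nonneg H g, of C "fwX S r t"]
    by (simp only: fwX.simps fw_gap_inner fwJ_eq n)
  moreover have "\<beta> * M * (28 / 100 * n\<^sup>2) * (- ln (1 - ?g) - ?g) \<le> 28 / 100 * Cg * (2 / (real t * (real t + 2)))"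
    using mult_left_mono[OF neg_ln_gamma_le[OF t], of "28 / 100 * Cg"] Cg_pos by (simp add: Cg_eq mult_ac)
  moreover have "?g * fw_gap S r t = 2 / (real t + 2) * fw_gap S r t" by (simp add: fw_gamma_def)
  ultimately show ?thesis by linarith
qed

definition lmo_ok :: "('n source \<Rightarrow> real) \<Rightarrow> nat \<Rightarrow> bool" where
  "lmo_ok r t \<longleftrightarrow> norm (fww S r t) = 1 \<and>
     real CARD('n) * (fww S r t \<bullet> (fwJ S r t *v fww S r t)) \<ge> real CARD('n) * lambda_max (fwJ S r t) - lmo_error S t"

lemma lmo_error_eq: "lmo_error S t = Cg / (real t + 2)"
  by (simp add: lmo_error_def S_simps(6) fw_gamma_def)

definition fopt :: real where
  "fopt = (SUP X\<in>feasible. obj C \<beta> M X)"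

lemma obj_le_fopt: "X \<in> feasible \<Longrightarrow> obj C \<beta> M X \<le> fopt"
  unfolding fopt_def using obj_le[OF C S_simps(2) M_pos]
  by (intro cSUP_upper bdd_aboveI2[where M="2 * real CARD('n) * trace C"])

text \<open>By concavity the optimum is at most the maximum of the linearization over the feasible
  set. Since \<open>lambda_max\<close> is positive, that maximum is \<open>n * lambda_max\<close>,
  and a successful call comes within its error of it.\<close>

lemma gap_ge:
  assumes "lmo_ok r t"
  shows "(fopt - obj C \<beta> M (fwX S r t)) - Cg / (real t + 2) \<le> fw_gap S r t"
proof -
  let ?J = "fwJ S r t" and ?w = "fww S r t" and ?X = "fwX S r t"
  let ?l = "lambda_max ?J"
  have "fopt \<le> obj C \<beta> M ?X + real CARD('n) * ?l - ?J \<bullet> ?X"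
    unfolding fopt_def
  proof (rule cSUP_least)
    show "feasible \<noteq> ({} :: (real^'n^'n) set)" using feasible_zero by auto
    fix Y :: "real^'n^'n" assume Y: "Y \<in> feasible"
    have "obj C \<beta> M Y \<le> obj C \<beta> M ?X + ?J \<bullet> (Y - ?X)"
      unfolding fwJ_eq by (rule obj_concave[OF M_pos beta_nonneg])
    moreover have "?J \<bullet> Y \<le> max 0 (real CARD('n) * ?l)"
      using Y by (intro inner_psd_le[OF symmetric_fwJ]) (auto simp: feasible_def)
    ultimately show "obj C \<beta> M Y \<le> obj C \<beta> M ?X + real CARD('n) * ?l - ?J \<bullet> ?X"
      using lambda_max_fwJ_pos[of r t] by (simp add: inner_diff_right max_def)
  qed
  moreover have "real CARD('n) * ?l - Cg / (real t + 2) \<le> ?J \<bullet> fw_H ?J ?w"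
  proof (cases "0 \<le> ?w \<bullet> (?J *v ?w)")
    case True
    then show ?thesis using assms by (simp add: lmo_ok_def lmo_error_eq fw_H_def inner_rank_one)
  next
    \<comment> \<open>Replacing a direction of negative value by the zero matrix only improves the
      linear objective.\<close>
    case False
    then have "real CARD('n) * (?w \<bullet> (?J *v ?w)) \<le> 0" by (intro mult_nonneg_nonpos) auto
    then show ?thesis using False assms by (simp add: lmo_ok_def lmo_error_eq fw_H_def)
  qed
  ultimately show ?thesis unfolding fw_gap_inner by (simp add: inner_diff_right)
qed

lemma success_stops:
  assumes ok: "\<And>t. t < nat \<lfloor>T\<rfloor> \<Longrightarrow> lmo_ok r t"
  shows "\<exists>t < nat \<lfloor>T\<rfloor>. fw_gap S r t \<le> tol"
proof (cases "CARD('n) = 1")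
  case False
  then have n2: "2 \<le> CARD('n)" by (metis One_nat_def Suc_1 Suc_leI le_neq_implies_less one_le_card_finite)
  show ?thesis
  proof (rule ccontr)
    assume "\<not> (\<exists>t < nat \<lfloor>T\<rfloor>. fw_gap S r t \<le> tol)"
    then have ns: "tol < fw_gap S r t" if "t < nat \<lfloor>T\<rfloor>" for t using that by (auto simp: not_le)
    define h where "h = (\<lambda>t. fopt - obj C \<beta> M (fwX S r t))"
    show False
    proof (rule frank_wolfe_gap_contradiction[OF Cg_pos T_ge_3000[OF n2] refl, where h=h and G="fw_gap S r"])
      show "h 1 \<le> h 0 - fw_gap S r 0 + Cg / 2"
        using step_quadratic[of r 0] by (simp add: h_def fw_gamma_def del: fwX.simps)
      show "h (Suc t) \<le> h t - 2 / (real t + 2) * fw_gap S r t + 28 / 100 * Cg * (2 / (real t * (real t + 2)))"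
        if "1 \<le> t" "t < nat \<lfloor>T\<rfloor>" for t
        using step_log[OF n2 that(1), of r] ok[OF that(2)] unfolding lmo_ok_def h_def by linarith
      show "h t - Cg / (real t + 2) \<le> fw_gap S r t" if "t < nat \<lfloor>T\<rfloor>" for t
        using gap_ge[OF ok[OF that]] by (simp add: h_def)
      show "4 * Cg / T < fw_gap S r t" if "t < nat \<lfloor>T\<rfloor>" for t
      proof -
        have "4 * Cg / T = tol" using Cg_pos tol_pos by (simp add: T_eq)
        then show ?thesis using ns[OF that] by simp
      qed
      show "0 \<le> h (nat \<lfloor>T\<rfloor>)" using obj_le_fopt[OF fwX_feasible] by (simp add: h_def)
    qed
  qed
next
  case True
  have T0: "0 < nat \<lfloor>T\<rfloor>" using T_ge_399 by simp
  obtain i where i: "(UNIV :: 'n set) = {i}" using True by (auto simp: card_1_singleton_iff)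
  let ?w = "fww S r 0" and ?J = "fwJ S r 0"
  \<comment> \<open>With one index, every unit vector gives the starting matrix \<open>mat 1\<close>
    as candidate, so the first gap is 0.\<close>
  have r1: "rank_one x = mat 1" if "norm x = 1" for x :: "real^'n"
  proof -
    have "x \<bullet> x = 1" using that by (simp add: dot_square_norm)
    then have "x $ i * x $ i = 1" by (simp add: inner_vec_def i)
    moreover have "k = i" for k using i by (metis UNIV_I singletonD)
    ultimately have "x $ k * x $ l = 1" "k = l" for k l by metis+
    then show ?thesis by (simp add: rank_one_def mat_def vec_eq_iff)
  qed
  have w: "norm ?w = 1" using ok[OF T0] by (simp add: lmo_ok_def)
  obtain b where b: "norm b = 1" "?J *v b = lambda_max ?J *\<^sub>R b" by (rule lambda_max_attained[OF symmetric_fwJ])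
  have "?w \<bullet> (?J *v ?w) = b \<bullet> (?J *v b)" by (simp add: r1[OF w] r1[OF b(1)] flip: inner_rank_one)
  then have "0 \<le> ?w \<bullet> (?J *v ?w)" using b lambda_max_fwJ_pos[of r 0] by (simp add: dot_square_norm del: fwV.simps)
  then have "fw_H ?J ?w = mat 1" using True by (simp add: fw_H_def r1[OF w] del: fwV.simps)
  then have "fw_gap S r 0 = 0" unfolding fw_gap_inner by (simp del: fwV.simps)
  then show ?thesis using T0 tol_pos by (metis less_imp_le)
qed

text \<open>The divergence of \<open>\<Sum> fw_gamma t\<close> forces termination even when calls of LMO fail.\<close>

lemma uniform_stop: "\<exists>N. \<forall>r. \<exists>t<N. fw_gap S r t \<le> tol"
proof -
  define K where "K = 2 * real CARD('n) * trace C + 2 * Cg - obj C \<beta> M (mat 1)"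
  \<comment> \<open>Chosen so that the total gain \<open>2 * tol * ln ((N + 2) / 2)\<close> exceeds
    the upper bound of the objective minus its starting value, plus the curvature losses, which sum
    to at most \<open>2 * Cg\<close>.\<close>
  define N where "N = nat \<lceil>exp (K / (2 * tol) + ln 2 + 1)\<rceil>"
  have "exp (K / (2 * tol) + ln 2 + 1) \<le> real N + 2" unfolding N_def by linarith
  then have "K / (2 * tol) + ln 2 + 1 \<le> ln (real N + 2)" by (simp add: ln_ge_iff)
  then have "K / (2 * tol) < ln (real N + 2) - ln 2" by linarith
  then have big: "K < 2 * tol * (ln (real N + 2) - ln 2)" using tol_pos by (simp add: pos_divide_less_eq mult.commute)
  have "\<exists>t<N. fw_gap S r t \<le> tol" for r
  proof (rule ccontr)
    assume "\<not> (\<exists>t<N. fw_gap S r t \<le> tol)"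
    then have ns: "tol < fw_gap S r t" if "t < N" for t using that by (auto simp: not_le)
    have "obj C \<beta> M (mat 1) + 2 * tol * (ln (real t + 2) - ln 2) - 2 * Cg * (1 - 1 / (real t + 1)) \<le> obj C \<beta> M (fwX S r t)"
      if "t \<le> N" for t
      using that
    proof (induction t)
      case 0
      then show ?case by simp
    next
      case (Suc t)
      let ?t = "real t"
      have "ln (real (Suc t) + 2) - ln (?t + 2) = ln (1 + 1 / (?t + 2))"
      proof -
        have "1 + 1 / (?t + 2) = (real (Suc t) + 2) / (?t + 2)" by (simp add: field_simps)
        then show ?thesis by (simp add: ln_div)
      qed
      also have "\<dots> \<le> 1 / (?t + 2)" by (rule ln_add_one_self_le_self) simp
      finally have "2 * tol * (ln (real (Suc t) + 2) - ln (?t + 2)) \<le> 2 * tol * (1 / (?t + 2))"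
        using tol_pos by (intro mult_left_mono) auto
      also have "\<dots> = fw_gamma t * tol" by (simp add: fw_gamma_def)
      also have "\<dots> \<le> fw_gamma t * fw_gap S r t"
        using ns[of t] Suc.prems gamma_bounds(1)[of t] by (intro mult_left_mono) auto
      finally have 1: "2 * tol * (ln (real (Suc t) + 2) - ln (?t + 2)) \<le> fw_gamma t * fw_gap S r t" .
      have 2: "Cg * (fw_gamma t)\<^sup>2 / 2 \<le> 2 * Cg * (1 / (?t + 1) - 1 / (real (Suc t) + 1))"
      proof -
        have "(fw_gamma t)\<^sup>2 / 2 = 2 * (1 / ((?t + 2) * (?t + 2)))" by (simp add: fw_gamma_def power2_eq_square)
        also have "\<dots> \<le> 2 * (1 / ((?t + 1) * (?t + 2)))" by (intro mult_left_mono divide_left_mono mult_right_mono) auto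
        also have "1 / ((?t + 1) * (?t + 2)) = 1 / (?t + 1) - 1 / (real (Suc t) + 1)" by (simp add: divide_simps)
        finally show ?thesis using Cg_pos mult_left_mono[of "(fw_gamma t)\<^sup>2 / 2" _ Cg] by (simp add: mult_ac)
      qed
      have "obj C \<beta> M (mat 1) + 2 * tol * (ln (?t + 2) - ln 2) - 2 * Cg * (1 - 1 / (?t + 1)) \<le> obj C \<beta> M (fwX S r t)"
        using Suc by simp
      with 1 2 step_quadratic[of r t] show ?case by (simp only: right_diff_distrib)
    qed
    from this[of N] have "obj C \<beta> M (mat 1) + 2 * tol * (ln (real N + 2) - ln 2) - 2 * Cg * (1 - 1 / (real N + 1)) \<le> 2 * real CARD('n) * trace C"
      using obj_le[OF C S_simps(2) M_pos fwX_feasible[of r N]] by linarith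
    moreover have "2 * Cg * (1 - 1 / (real N + 1)) \<le> 2 * Cg" using Cg_pos by (simp add: field_simps)
    ultimately show False using big unfolding K_def by linarith
  qed
  then show ?thesis by blast
qed

text \<open>By \<open>uniform_stop\<close> the minimum exists for every \<open>r\<close>, not just
  almost surely.\<close>

definition stop_time :: "('n source \<Rightarrow> real) \<Rightarrow> nat" where
  "stop_time r = (LEAST t. fw_gap S r t \<le> tol)"

lemma stop_time_stops: "fw_gap S r (stop_time r) \<le> tol"
  and stop_time_nonstop: "i < stop_time r \<Longrightarrow> \<not> fw_gap S r i \<le> tol"
  unfolding stop_time_def using uniform_stop by (meson LeastI not_less_Least)+

lemma stop_time_le: "fw_gap S r t \<le> tol \<Longrightarrow> stop_time r \<le> t"
  unfolding stop_time_def by (rule Least_le)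

text \<open>The eigenvalue bound \<open>6 * trace C\<close> divided by the error, at least
  \<open>Cg / (T + 1)\<close>, gives the factor \<open>24 * (n / \<epsilon>) * (1 + 1 / T)\<close>,
  and the logarithm is at most \<open>7 * ln (4 * n / \<epsilon>)\<close>. The product is below 170;
  the distance to 240 absorbs the rounding up and the final multiplication.\<close>

lemma matvec_count_bound:
  assumes t: "real (Suc t) \<le> T"
  shows "real (call_count S r t + 1) \<le> 240 * (n / \<epsilon>) * ln (4 * n / \<epsilon>) + real (extra t)"
proof -
  define l where "l = ln (4 * n / \<epsilon>)"
  define L where "L = ln (n / (fw_p S)\<^sup>2)"
  define a where "a = abs_eigenvalue_max (fwJ S r t)"
  have ne: "3 \<le> n / \<epsilon>" using n_ge_1 eps by (simp add: field_simps)
  have "exp 1 \<le> 4 * n / \<epsilon>" using ne exp_le by simp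
  then have l1: "1 \<le> l" unfolding l_def using ne by (subst ln_ge_iff) auto
  have L0: "0 \<le> L" 
  proof -
    have "(fw_p S)\<^sup>2 \<le> 1" using p_bounds by (intro power_le_one) auto
    then have "1 \<le> n / (fw_p S)\<^sup>2" using n_ge_1 p_bounds by (simp add: field_simps)
    then show ?thesis by (simp add: L_def)
  qed
  have L7: "L \<le> 7 * l"
  proof -
    have "n / (fw_p S)\<^sup>2 = n * T\<^sup>2 / \<epsilon>\<^sup>2" by (simp add: S_simps power_divide)
    also have "\<dots> = 64\<^sup>2 * (ln (2 * n))\<^sup>2 * n ^ 5 / \<epsilon> ^ 6"
      by (simp add: T power_divide power_mult_distrib eval_nat_numeral mult_ac)
    \<comment> \<open>Aiming at a seventh power of \<open>4 * n / \<epsilon>\<close>: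
      \<open>64^2 * 2^2 = 4^7\<close>, the bound \<open>ln (2 * n) \<le> 2 * n\<close> supplies the
      missing \<open>n^2\<close>, and one more factor \<open>1 / \<epsilon>\<close> is given
      away.\<close>
    also have "\<dots> \<le> 64\<^sup>2 * (2 * n)\<^sup>2 * n ^ 5 / \<epsilon> ^ 7"
    proof (rule frac_le)
      have "ln (2 * n) \<le> 2 * n" using ln_le_minus_one[of "2 * n"] n_ge_1 by simp
      then show "64\<^sup>2 * (ln (2 * n))\<^sup>2 * n ^ 5 \<le> 64\<^sup>2 * (2 * n)\<^sup>2 * n ^ 5"
        using ln_2n_pos n_ge_1 by (intro mult_right_mono mult_left_mono power_mono) auto
      show "\<epsilon> ^ 7 \<le> \<epsilon> ^ 6" using eps by (intro power_decreasing) auto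
    qed (use eps n_ge_1 in auto)
    also have "\<dots> = (4 * n / \<epsilon>) ^ 7" by (simp add: power_divide power_mult_distrib eval_nat_numeral)
    finally have "L \<le> ln ((4 * n / \<epsilon>) ^ 7)"
      unfolding L_def using p_bounds n_ge_1 ne by (subst ln_le_cancel_iff) auto
    then show ?thesis using ne by (simp add: ln_realpow l_def)
  qed
  have a: "0 \<le> a" "a \<le> 6 * trace C"
    unfolding a_def using abs_eigenvalue_max_nonneg[OF symmetric_fwJ] abs_eigenvalue_Jmat_le[OF C S_simps(2) M_pos]
    by (simp_all add: fwJ_eq)
  have f: "a * n / lmo_error S t \<le> 24 * (n / \<epsilon>) * (1 + 1 / T)"
  proof -
    have "a * n / lmo_error S t = a * n * (real t + 2) / Cg" by (simp add: lmo_error_eq)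
    also have "\<dots> \<le> 6 * trace C * n * (T + 1) / Cg"
      using a n_ge_1 t Cg_pos trace_C_pos by (intro divide_right_mono mult_mono) auto
    also have "\<dots> = 24 * (n / \<epsilon>) * (1 + 1 / T)"
    proof -
      have Cg: "Cg = T * (\<epsilon> * trace C) / 4" using eps trace_C_pos unfolding T_eq by (simp add: S_simps(5))
      show ?thesis unfolding Cg using T_ge_399 eps trace_C_pos by (simp add: field_simps)
    qed
    finally show ?thesis .
  qed
  have "a * n / lmo_error S t * L \<le> 24 * (n / \<epsilon>) * (1 + 1 / T) * (7 * l)"
  proof (rule mult_mono[OF f L7 _ L0])
    show "0 \<le> 24 * (n / \<epsilon>) * (1 + 1 / T)"
      by (intro mult_nonneg_nonneg) (use n_ge_1 eps T_ge_399 in auto)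
  qed
  also have "\<dots> \<le> 24 * (n / \<epsilon>) * (1 + 1 / 100) * (7 * l)"
    using ne l1 T_ge_399 by (intro mult_right_mono mult_left_mono add_left_mono divide_left_mono) auto
  also have "\<dots> = 16968 / 100 * ((n / \<epsilon>) * l)" by simp
  also have "\<dots> \<le> 170 * ((n / \<epsilon>) * l)" using ne l1 by (intro mult_right_mono mult_nonneg_nonneg) auto
  finally have 1: "a * n / lmo_error S t * L \<le> 170 * ((n / \<epsilon>) * l)" .
  have "0 \<le> a * n / lmo_error S t * L"
    using a n_ge_1 L0 Cg_pos by (auto simp: lmo_error_eq)
  then have "real (nat \<lceil>a * n / lmo_error S t * L\<rceil>) \<le> a * n / lmo_error S t * L + 1" by linarith
  moreover have "call_count S r t = nat \<lceil>a * n / lmo_error S t * L\<rceil> + extra t"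
    by (simp add: call_count_def power_count_def a_def L_def n S_simps(8))
  ultimately have "real (call_count S r t + 1) \<le> 170 * ((n / \<epsilon>) * l) + 2 + real (extra t)"
    using 1 by simp
  moreover have "3 * 1 \<le> (n / \<epsilon>) * l" using ne l1 by (intro mult_mono) auto
  moreover have "c \<le> 240 * x + e" if "c \<le> 170 * x + 2 + e" "3 * 1 \<le> x" for c x e :: real using that by linarith
  ultimately have "real (call_count S r t + 1) \<le> 240 * ((n / \<epsilon>) * l) + real (extra t)" by blast
  then show ?thesis by (simp only: l_def mult.assoc)
qed

end

section \<open>Rounding\<close>

lemma alpha_GW_le: "0 < \<theta> \<Longrightarrow> \<theta> \<le> pi \<Longrightarrow> alpha_GW \<le> 2 / pi * (\<theta> / (1 - cos \<theta>))"
  unfolding alpha_GW_def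
  by (rule cINF_lower) (auto intro!: bdd_belowI2[where m=0] divide_nonneg_nonneg)

lemma alpha_GW_nonneg: "0 \<le> alpha_GW"
  unfolding alpha_GW_def by (rule cINF_greatest) (use pi_gt_zero in \<open>auto intro!: divide_nonneg_nonneg\<close>)

lemma alpha_GW_le_1: "alpha_GW \<le> 1"
  using alpha_GW_le[of pi] by simp

lemma alpha_GW_arccos:
  assumes "\<bar>\<rho>\<bar> \<le> 1"
  shows "alpha_GW * (1 - \<rho>) \<le> 2 / pi * arccos \<rho>"
proof (cases "\<rho> = 1")
  case False
  then have \<rho>: "- 1 \<le> \<rho>" "\<rho> < 1" using assms by auto
  have "0 < arccos \<rho>" using arccos_lt_bounded[of \<rho>] \<rho> by (cases "\<rho> = - 1") auto
  then have "alpha_GW \<le> 2 / pi * (arccos \<rho> / (1 - cos (arccos \<rho>)))"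
    using arccos_ubound[of \<rho>] \<rho> by (intro alpha_GW_le) auto
  then show ?thesis using \<rho> by (simp add: cos_arccos pos_le_divide_eq mult_ac)
qed simp

text \<open>Dominance writes each row as a nonnegative slack \<open>s\<close>, for which
  \<open>alpha_GW \<le> 1\<close> suffices, plus terms \<open>\<bar>c\<bar> + c * \<rho>\<close>.
  For negative \<open>c\<close> such a term is a multiple of \<open>1 - \<rho>\<close>, the
  classical case; for positive \<open>c\<close> it is a multiple of \<open>1 + \<rho>\<close>, and
  the classical case applies to \<open>- \<rho>\<close>.\<close>

lemma goemans_williamson_sum:
  fixes C R :: "real^'n^'n"
  assumes dd: "diagonally_dominant C" "\<And>i. 0 < C $ i $ i"
    and R: "\<And>i. R $ i $ i = 1" "\<And>i j. \<bar>R $ i $ j\<bar> \<le> 1"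
  shows "alpha_GW * (C \<bullet> R) \<le> (\<Sum>i\<in>UNIV. \<Sum>j\<in>UNIV. C $ i $ j * (1 - 2 / pi * arccos (R $ i $ j)))"
proof -
  let ?E = "\<lambda>i j. 1 - 2 / pi * arccos (R $ i $ j)"
  have off: "alpha_GW * (\<bar>c\<bar> + c * \<rho>) \<le> \<bar>c\<bar> + c * (1 - 2 / pi * arccos \<rho>)" if r: "\<bar>\<rho>\<bar> \<le> 1" for c \<rho> :: real
  proof (cases "0 \<le> c")
    case True
    define A where "A = 2 / pi * arccos \<rho>"
    have "alpha_GW * (1 + \<rho>) \<le> 2 / pi * arccos (- \<rho>)" using alpha_GW_arccos[of "- \<rho>"] r by simp
    also have "\<dots> = 1 + (1 - A)" using r by (simp add: A_def arccos_minus abs_le_iff field_simps)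
    finally have "c * (alpha_GW * (1 + \<rho>)) \<le> c * (1 + (1 - A))" using True by (rule mult_left_mono)
    then show ?thesis using True unfolding A_def[symmetric] by (simp add: algebra_simps)
  next
    case False
    then show ?thesis using mult_left_mono[OF alpha_GW_arccos[OF r], of "- c"] by (simp add: algebra_simps)
  qed
  have row: "alpha_GW * (\<Sum>j\<in>UNIV. C $ i $ j * R $ i $ j) \<le> (\<Sum>j\<in>UNIV. C $ i $ j * ?E i j)" for i
  proof -
    define s where "s = C $ i $ i - (\<Sum>j\<in>UNIV - {i}. \<bar>C $ i $ j\<bar>)"
    have s0: "0 \<le> s" unfolding s_def using dd(1) dd(2)[of i] unfolding diagonally_dominant_def by (metis abs_of_pos diff_ge_0_iff_ge)
    have split: "(\<Sum>j\<in>UNIV. C $ i $ j * f j) = s + (\<Sum>j\<in>UNIV - {i}. \<bar>C $ i $ j\<bar> + C $ i $ j * f j)" if "f i = 1" for f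
      unfolding s_def sum.distrib using that by (simp add: sum.remove[of UNIV i])
    have "alpha_GW * (\<Sum>j\<in>UNIV. C $ i $ j * R $ i $ j) = alpha_GW * s + (\<Sum>j\<in>UNIV - {i}. alpha_GW * (\<bar>C $ i $ j\<bar> + C $ i $ j * R $ i $ j))"
      unfolding split[of "\<lambda>j. R $ i $ j", OF R(1)] by (simp add: distrib_left sum_distrib_left)
    also have "\<dots> \<le> s + (\<Sum>j\<in>UNIV - {i}. \<bar>C $ i $ j\<bar> + C $ i $ j * ?E i j)"
      using off[OF R(2)] alpha_GW_le_1 s0 by (intro add_mono sum_mono) (auto intro!: mult_left_le_one_le alpha_GW_nonneg)
    also have "\<dots> = (\<Sum>j\<in>UNIV. C $ i $ j * ?E i j)" by (rule split[symmetric]) (simp add: R(1))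
    finally show ?thesis .
  qed
  have "alpha_GW * (C \<bullet> R) = (\<Sum>i\<in>UNIV. alpha_GW * (\<Sum>j\<in>UNIV. C $ i $ j * R $ i $ j))"
    by (simp add: inner_matrix_def sum_distrib_left)
  also have "\<dots> \<le> (\<Sum>i\<in>UNIV. \<Sum>j\<in>UNIV. C $ i $ j * ?E i j)" by (intro sum_mono row)
  finally show ?thesis .
qed

section \<open>Binary vectors\<close>

lemma finite_binary_vectors: "finite (binary_vectors :: (real^'n) set)"
proof -
  have "(binary_vectors :: (real^'n) set) \<subseteq> vec_lambda ` (PiE UNIV (\<lambda>_. {-1, 1}))"
  proof
    fix x :: "real^'n" assume "x \<in> binary_vectors"
    then have "(\<lambda>i. x $ i) \<in> PiE UNIV (\<lambda>_. {-1, 1})" by (auto simp: binary_vectors_def)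
    then show "x \<in> vec_lambda ` (PiE UNIV (\<lambda>_. {-1, 1}))" by (metis image_eqI vec_lambda_eta)
  qed
  then show ?thesis by (rule finite_subset) (auto intro!: finite_PiE)
qed

lemma binary_vectors_square: "x \<in> binary_vectors \<Longrightarrow> x $ i * x $ i = 1"
proof -
  assume "x \<in> binary_vectors"
  then have "x $ i \<in> {-1, 1}" unfolding binary_vectors_def by blast
  then show ?thesis by auto
qed

lemma binary_opt_ge: "x \<in> binary_vectors \<Longrightarrow> x \<bullet> (C *v x) \<le> binary_opt C"
  unfolding binary_opt_def using finite_binary_vectors by (intro Max_ge) auto

lemma binary_opt_attained: "\<exists>x\<in>binary_vectors. binary_opt C = x \<bullet> (C *v x)"
proof -
  have "(\<chi> i. 1) \<in> (binary_vectors :: (real^'n) set)" by (simp add: binary_vectors_def)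
  then have "binary_opt C \<in> (\<lambda>x. x \<bullet> (C *v x)) ` binary_vectors"
    unfolding binary_opt_def using finite_binary_vectors by (intro Max_in) auto
  then show ?thesis by auto
qed

text \<open>\<open>z_t\<close> as a linear form in the sources. Once the starts \<open>r\<close> are
  frozen, the coefficients are deterministic.\<close>

primrec zcoef :: "('n::finite) fw_param \<Rightarrow> ('n source \<Rightarrow> real) \<Rightarrow> nat \<Rightarrow> 'n source \<Rightarrow> real^'n" where
  "zcoef S r 0 s = (case s of Init k \<Rightarrow> axis k 1 | _ \<Rightarrow> 0)"
| "zcoef S r (Suc t) s = sqrt (1 - fw_gamma t) *\<^sub>R zcoef S r t s
     + (if s = Zeta t then sqrt (fw_gamma t) *\<^sub>R fw_direction (fwJ S r t) (fww S r t) else 0)"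

definition zsources :: "nat \<Rightarrow> ('n::finite) source set" where
  "zsources t = range Init \<union> Zeta ` {..<t}"

lemma finite_zsources: "finite (zsources t)"
  by (simp add: zsources_def)

lemma zsources_Suc: "zsources (Suc t) = insert (Zeta t) (zsources t)" "Zeta t \<notin> zsources t"
  by (auto simp: zsources_def lessThan_Suc)

lemma zcoef_Zeta: "t \<le> t' \<Longrightarrow> zcoef S r t (Zeta t') = 0"
  by (induction t) auto

lemma fwz_linear: "fwz S r r' t = (\<Sum>s\<in>zsources t. r' s *\<^sub>R zcoef S r t s)"
proof (induction t)
  case 0
  have "(\<Sum>s\<in>range Init. r' s *\<^sub>R zcoef S r 0 s) = (\<Sum>k\<in>UNIV. r' (Init k) *\<^sub>R axis k (1::real))"
    by (subst sum.reindex) (auto simp: inj_on_def)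
  also have "\<dots> = (\<chi> i. r' (Init i))"
    by (simp add: vec_eq_iff axis_def if_distrib cong: if_cong)
  finally show ?case by (simp add: zsources_def del: zcoef.simps)
next
  case (Suc t)
  have "(\<Sum>s\<in>zsources (Suc t). r' s *\<^sub>R zcoef S r (Suc t) s)
      = r' (Zeta t) *\<^sub>R zcoef S r (Suc t) (Zeta t) + (\<Sum>s\<in>zsources t. r' s *\<^sub>R zcoef S r (Suc t) s)"
    unfolding zsources_Suc by (rule sum.insert[OF finite_zsources zsources_Suc(2)])
  also have "(\<Sum>s\<in>zsources t. r' s *\<^sub>R zcoef S r (Suc t) s) = (\<Sum>s\<in>zsources t. sqrt (1 - fw_gamma t) *\<^sub>R (r' s *\<^sub>R zcoef S r t s))"
    using zsources_Suc(2) by (intro sum.cong) auto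
  also have "\<dots> = sqrt (1 - fw_gamma t) *\<^sub>R fwz S r r' t" unfolding Suc.IH by (rule scaleR_sum_right[symmetric])
  finally show ?case by (simp add: zcoef_Zeta mult.commute)
qed

lemma fw_direction_product: "fw_direction J w $ i * fw_direction J w $ j = fw_H J w $ i $ j"
  by (simp add: fw_direction_def fw_H_def rank_one_def)

text \<open>The Gram matrix of the coefficients is the covariance. The source \<open>Zeta t\<close>
  is new in step \<open>t\<close>, so no cross terms arise and the square roots in the update of
  \<open>z\<close> become the convex combination that defines \<open>fwX\<close>.\<close>

lemma zcoef_gram: "(\<Sum>s\<in>zsources t. zcoef S r t s $ i * zcoef S r t s $ j) = fwX S r t $ i $ j"
proof (induction t)
  case 0
  have "(\<Sum>s\<in>range Init. zcoef S r 0 s $ i * zcoef S r 0 s $ j) = (\<Sum>k\<in>UNIV. axis k 1 $ i * axis k (1::real) $ j)"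
    by (subst sum.reindex) (auto simp: inj_on_def)
  also have "\<dots> = (\<Sum>k\<in>UNIV. if k = i then (if i = j then 1 else 0) else 0)"
    by (intro sum.cong) (auto simp: axis_def)
  also have "\<dots> = mat 1 $ i $ j" by (simp add: mat_def)
  finally show ?case by (simp add: zsources_def del: zcoef.simps)
next
  case (Suc t)
  have g: "0 \<le> fw_gamma t" "fw_gamma t \<le> 1" by (auto simp: fw_gamma_def)
  have "(\<Sum>s\<in>zsources (Suc t). zcoef S r (Suc t) s $ i * zcoef S r (Suc t) s $ j)
      = zcoef S r (Suc t) (Zeta t) $ i * zcoef S r (Suc t) (Zeta t) $ j + (\<Sum>s\<in>zsources t. zcoef S r (Suc t) s $ i * zcoef S r (Suc t) s $ j)"
    unfolding zsources_Suc by (rule sum.insert[OF finite_zsources zsources_Suc(2)])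
  also have "(\<Sum>s\<in>zsources t. zcoef S r (Suc t) s $ i * zcoef S r (Suc t) s $ j) = (\<Sum>s\<in>zsources t. (1 - fw_gamma t) * (zcoef S r t s $ i * zcoef S r t s $ j))"
    using zsources_Suc(2) g by (intro sum.cong) auto
  also have "\<dots> = (1 - fw_gamma t) * fwX S r t $ i $ j" unfolding Suc.IH[symmetric] by (rule sum_distrib_left[symmetric])
  also have "zcoef S r (Suc t) (Zeta t) $ i * zcoef S r (Suc t) (Zeta t) $ j = fw_gamma t * fw_H (fwJ S r t) (fww S r t) $ i $ j"
    using g by (simp add: zcoef_Zeta fw_direction_product[symmetric])
  finally show ?case by simp
qed

definition sample :: "('n::finite) fw_param \<Rightarrow> ('n source \<Rightarrow> real) \<Rightarrow> ('n source \<Rightarrow> real) \<Rightarrow> nat \<Rightarrow> real^'n" where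
  "sample S r r' t = generate_sample (fwz S r r' t) (snd (fwV S r t)) (\<chi> i. r' (Round i))"

section \<open>The rounded vector for frozen starts\<close>

locale max_cut_run = max_cut_frank_wolfe C \<epsilon> n T extra S + prob_space P
  for C :: "real^'n::finite^'n" and \<epsilon> n T extra S and P :: "'w measure" +
  fixes G :: "'n source \<Rightarrow> 'w \<Rightarrow> real"
  assumes G_indep: "indep_vars (\<lambda>_. borel) G UNIV"
    and G_normal: "\<And>s. distributed P lborel (G s) std_normal_density"
begin

lemma G_measurable[measurable]: "G s \<in> borel_measurable P"
  using G_normal[of s] by (simp add: distributed_def)

definition dmax :: "('n source \<Rightarrow> real) \<Rightarrow> nat \<Rightarrow> real" where
  "dmax r t = Max (range (\<lambda>i. fwX S r t $ i $ i))"

lemma dmax_ge: "fwX S r t $ i $ i \<le> dmax r t"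
  unfolding dmax_def by (rule Max_ge) auto

lemma fwX_psd: "psd (fwX S r t)"
  using fwX_feasible by (simp add: feasible_def)

lemma dmax_nonneg: "0 \<le> dmax r t"
  using dmax_ge[of r t undefined] psd_diag_nonneg[OF fwX_psd, of r t undefined] by linarith

text \<open>If \<open>dmax\<close> is 0 the quotient is 0 by convention; then the rounding noise
  alone provides unit variance, and the later formulas remain valid.\<close>

lemma dmax_ratio: "fwX S r t $ i $ i / dmax r t \<le> 1"
  using dmax_ge[of r t i] dmax_nonneg[of r t] by (cases "dmax r t = 0") (auto simp: divide_le_eq_1 less_le)

definition wcoef :: "('n source \<Rightarrow> real) \<Rightarrow> nat \<Rightarrow> 'n \<Rightarrow> 'n source \<Rightarrow> real" where
  "wcoef r t i s = (case s of Round k \<Rightarrow> if k = i then sqrt (1 - fwX S r t $ i $ i / dmax r t) else 0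
     | _ \<Rightarrow> zcoef S r t s $ i / sqrt (dmax r t))"

definition wsources :: "nat \<Rightarrow> 'n source set" where
  "wsources t = zsources t \<union> range Round"

lemma sum_wsources: "(\<Sum>s\<in>wsources t. f s) = (\<Sum>s\<in>zsources t. f s) + (\<Sum>k\<in>UNIV. f (Round k))" for f :: "'n source \<Rightarrow> real"
proof -
  have "(\<Sum>s\<in>wsources t. f s) = (\<Sum>s\<in>zsources t. f s) + (\<Sum>s\<in>range Round. f s)"
    unfolding wsources_def by (rule sum.union_disjoint) (auto simp: finite_zsources zsources_def)
  also have "(\<Sum>s\<in>range Round. f s) = (\<Sum>k\<in>UNIV. f (Round k))"
    by (subst sum.reindex) (auto simp: inj_on_def)
  finally show ?thesis .
qed

lemma wcoef_zsources: "s \<in> zsources t \<Longrightarrow> wcoef r t i s = zcoef S r t s $ i / sqrt (dmax r t)"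
  by (auto simp: wcoef_def zsources_def)

lemma sample_nth: "sample S r r' t $ i = sgn (\<Sum>s\<in>wsources t. wcoef r t i s * r' s)"
proof -
  have m: "Max (range (\<lambda>i. snd (fwV S r t) $ i)) = dmax r t" by (simp add: snd_fwV dmax_def diag_vec_def)
  have "(\<Sum>s\<in>zsources t. wcoef r t i s * r' s) = fwz S r r' t $ i / sqrt (dmax r t)"
    unfolding fwz_linear by (simp add: wcoef_zsources sum_divide_distrib mult.commute)
  moreover have "(\<Sum>k\<in>UNIV. wcoef r t i (Round k) * r' (Round k)) = sqrt (1 - fwX S r t $ i $ i / dmax r t) * r' (Round i)"
    by (simp add: wcoef_def if_distrib[of "\<lambda>x. x * _"] cong: if_cong)
  ultimately show ?thesis
    unfolding sample_def generate_sample_def Let_def m sum_wsources by (simp add: snd_fwV diag_vec_def)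
qed

text \<open>The covariance of the vector whose signs are taken: the rounding noise fills the
  diagonal up to 1 and leaves the other entries alone.\<close>

definition corr :: "('n source \<Rightarrow> real) \<Rightarrow> nat \<Rightarrow> real^'n^'n" where
  "corr r t = (\<chi> i j. if i = j then 1 else fwX S r t $ i $ j / dmax r t)"

lemma wcoef_gram: "(\<Sum>s\<in>wsources t. wcoef r t i s * wcoef r t j s) = corr r t $ i $ j"
proof -
  have "(\<Sum>s\<in>zsources t. wcoef r t i s * wcoef r t j s) = fwX S r t $ i $ j / dmax r t"
  proof -
    have "sqrt (dmax r t) * sqrt (dmax r t) = dmax r t" using dmax_nonneg by simp
    then have "(\<Sum>s\<in>zsources t. wcoef r t i s * wcoef r t j s) = (\<Sum>s\<in>zsources t. zcoef S r t s $ i * zcoef S r t s $ j / dmax r t)"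
      by (intro sum.cong refl) (simp add: wcoef_zsources)
    then show ?thesis by (simp add: zcoef_gram flip: sum_divide_distrib)
  qed
  moreover have "(\<Sum>k\<in>UNIV. wcoef r t i (Round k) * wcoef r t j (Round k)) = (if i = j then 1 - fwX S r t $ i $ i / dmax r t else 0)"
  proof (cases "i = j")
    case True
    then show ?thesis using dmax_ratio[of r t j]
      by (simp add: wcoef_def if_distrib[of "\<lambda>x. x * _"] cong: if_cong)
  next
    case False
    then show ?thesis by (auto simp: wcoef_def intro!: sum.neutral)
  qed
  ultimately show ?thesis unfolding sum_wsources by (simp add: corr_def)
qed

lemma abs_corr_le: "\<bar>corr r t $ i $ j\<bar> \<le> 1"
proof -
  have "2 * \<bar>fwX S r t $ i $ j\<bar> \<le> 2 * dmax r t"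
    using psd_offdiag_le[OF fwX_psd, of r t i j] dmax_ge[of r t i] dmax_ge[of r t j] by linarith
  then show ?thesis using dmax_nonneg[of r t]
    by (cases "dmax r t = 0") (auto simp: corr_def divide_le_eq_1 abs_divide less_le)
qed

text \<open>Raising the diagonal entries to 1 cannot decrease the value, since the diagonal of
  \<open>C\<close> is positive.\<close>

lemma inner_corr_ge: "C \<bullet> fwX S r t / dmax r t \<le> C \<bullet> corr r t"
proof -
  have "C \<bullet> fwX S r t / dmax r t = (\<Sum>i\<in>UNIV. \<Sum>j\<in>UNIV. C $ i $ j * (fwX S r t $ i $ j / dmax r t))"
    by (simp add: inner_matrix_def sum_divide_distrib)
  also have "\<dots> \<le> (\<Sum>i\<in>UNIV. \<Sum>j\<in>UNIV. C $ i $ j * corr r t $ i $ j)"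
  proof (intro sum_mono)
    fix i j
    show "C $ i $ j * (fwX S r t $ i $ j / dmax r t) \<le> C $ i $ j * corr r t $ i $ j"
    proof (cases "i = j")
      case True
      have "C $ j $ j * (fwX S r t $ j $ j / dmax r t) \<le> C $ j $ j * 1"
        using dmax_ratio C(3)[of j] by (intro mult_left_mono) auto
      then show ?thesis using True by (simp add: corr_def)
    qed (simp add: corr_def)
  qed
  finally show ?thesis by (simp add: inner_matrix_def)
qed

lemma finite_wsources: "finite (wsources t)"
  by (simp add: wsources_def finite_zsources)

lemma wsources_indep: "indep_vars (\<lambda>_. borel) G (wsources t)"
  by (rule indep_vars_subset[OF G_indep]) simp

lemma wcoef_unit: "(\<Sum>s\<in>wsources t. (wcoef r t i s)\<^sup>2) = 1"
  using wcoef_gram[where i=i and j=i] by (simp add: power2_eq_square corr_def)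

lemma sample_binary: "AE \<omega> in P. sample S r (\<lambda>s. G s \<omega>) t \<in> binary_vectors"
proof -
  have "AE \<omega> in P. \<forall>i. (\<Sum>s\<in>wsources t. wcoef r t i s * G s \<omega>) \<noteq> 0"
    by (intro AE_all_countable[THEN iffD2] allI gaussian_quadrant(2)[OF finite_wsources wsources_indep _ wcoef_unit wcoef_unit])
      (simp add: G_normal)
  then show ?thesis
    by eventually_elim (auto simp: binary_vectors_def sample_nth sgn_if)
qed

lemma quadratic_form_sample:
  "sample S r r' t \<bullet> (C *v sample S r r' t)
    = (\<Sum>i\<in>UNIV. \<Sum>j\<in>UNIV. C $ i $ j * (sgn (\<Sum>s\<in>wsources t. wcoef r t i s * r' s) * sgn (\<Sum>s\<in>wsources t. wcoef r t j s * r' s)))"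
  unfolding inner_matrix_vector sample_nth ..

text \<open>With \<open>r\<close> fixed and only the second argument random, this is the conditional
  expectation given the starts.\<close>

lemma expectation_sample:
  "expectation (\<lambda>\<omega>. sample S r (\<lambda>s. G s \<omega>) t \<bullet> (C *v sample S r (\<lambda>s. G s \<omega>) t))
    = (\<Sum>i\<in>UNIV. \<Sum>j\<in>UNIV. C $ i $ j * (1 - 2 / pi * arccos (corr r t $ i $ j)))"
proof -
  let ?f = "\<lambda>i j \<omega>. sgn (\<Sum>s\<in>wsources t. wcoef r t i s * G s \<omega>) * sgn (\<Sum>s\<in>wsources t. wcoef r t j s * G s \<omega>)"
  have int: "integrable P (?f i j)" for i j
    by (rule integrable_const_bound[where B=1]) (auto simp: abs_mult abs_sgn_eq)
  have "expectation (?f i j) = 1 - 2 / pi * arccos (corr r t $ i $ j)" for i j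
    unfolding wcoef_gram[symmetric]
    by (rule gaussian_sign_correlation[OF finite_wsources wsources_indep _ wcoef_unit wcoef_unit]) (simp add: G_normal)
  then show ?thesis unfolding quadratic_form_sample
    by (simp add: int Bochner_Integration.integral_sum)
qed

lemma expectation_sample_ge:
  "alpha_GW * (C \<bullet> fwX S r t / dmax r t)
    \<le> expectation (\<lambda>\<omega>. sample S r (\<lambda>s. G s \<omega>) t \<bullet> (C *v sample S r (\<lambda>s. G s \<omega>) t))"
proof -
  have "alpha_GW * (C \<bullet> fwX S r t / dmax r t) \<le> alpha_GW * (C \<bullet> corr r t)"
    using inner_corr_ge alpha_GW_nonneg by (rule mult_left_mono)
  also have "\<dots> \<le> expectation (\<lambda>\<omega>. sample S r (\<lambda>s. G s \<omega>) t \<bullet> (C *v sample S r (\<lambda>s. G s \<omega>) t))"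
    unfolding expectation_sample 
  proof (rule goemans_williamson_sum[OF C(2,3)])
    show "corr r t $ i $ i = 1" for i by (simp add: corr_def)
    show "\<bar>corr r t $ i $ j\<bar> \<le> 1" for i j by (rule abs_corr_le)
  qed
  finally show ?thesis .
qed

lemma quadratic_nonneg: "0 \<le> x \<bullet> (C *v x)"
  by (rule quadratic_bounds(1)[OF C S_simps(2) M_pos])

text \<open>A sample with covariance \<open>mat 1\<close> is a uniformly random binary vector.\<close>

lemma trace_le_binary_opt: "trace C \<le> binary_opt C"
proof -
  let ?w = "\<lambda>\<omega>. sample S (\<lambda>_. 0) (\<lambda>s. G s \<omega>) 0"
  have d: "dmax (\<lambda>_. 0) 0 = 1" by (simp add: dmax_def mat_def image_constant_conv)
  have "corr (\<lambda>_. 0) 0 = mat 1" unfolding corr_def d by (simp add: mat_def vec_eq_iff)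
  then have "expectation (\<lambda>\<omega>. ?w \<omega> \<bullet> (C *v ?w \<omega>)) = (\<Sum>i\<in>UNIV. \<Sum>j\<in>UNIV. if i = j then C $ i $ i else 0)"
    unfolding expectation_sample by (intro sum.cong refl) (auto simp: mat_def)
  also have "\<dots> = trace C" by (simp add: trace_def)
  finally have e: "expectation (\<lambda>\<omega>. ?w \<omega> \<bullet> (C *v ?w \<omega>)) = trace C" .
  have "expectation (\<lambda>\<omega>. ?w \<omega> \<bullet> (C *v ?w \<omega>)) \<le> expectation (\<lambda>_. binary_opt C)"
  proof (rule integral_mono_AE)
    show "integrable P (\<lambda>\<omega>. ?w \<omega> \<bullet> (C *v ?w \<omega>))"
      using e trace_C_pos not_integrable_integral_eq by fastforce
    show "AE \<omega> in P. ?w \<omega> \<bullet> (C *v ?w \<omega>) \<le> binary_opt C"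
      using sample_binary[of "\<lambda>_. 0" 0] by eventually_elim (rule binary_opt_ge)
  qed simp
  then show ?thesis using e by (simp add: prob_space)
qed

lemma binary_opt_le: "binary_opt C \<le> 2 * trace C"
proof -
  obtain x where x: "x \<in> binary_vectors" "binary_opt C = x \<bullet> (C *v x)" using binary_opt_attained by blast
  have "rank_one x $ i $ i \<le> 1" for i by (simp add: rank_one_def binary_vectors_square[OF x(1)])
  from inner_le_diag_bound[OF C S_simps(2) M_pos psd_rank_one this] show ?thesis
    using x(2) by (simp add: inner_rank_one)
qed

text \<open>An optimal binary vector gives a competitor with diagonal 1, whose penalty is
  \<open>\<beta> * phi M 0 = \<epsilon> * trace C\<close>. Hence \<open>C \<bullet> X\<close> is at
  least \<open>b\<close> plus the penalty at \<open>X\<close>. If \<open>dmax\<close> exceeds 1,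
  that penalty is at least \<open>\<beta> * (dmax - 1)\<close>, and
  \<open>\<beta> = 4 * trace C\<close> dominates \<open>b\<close> because the optimum is at most
  \<open>2 * trace C\<close>; so division by \<open>dmax\<close> still leaves
  \<open>b\<close>.\<close>

lemma optimal_ratio:
  assumes opt: "delta_optimal (fw_objective S) feasible (\<epsilon> * trace C) (fwX S r t)"
  shows "(1 - 2 * \<epsilon>) * binary_opt C \<le> C \<bullet> fwX S r t / dmax r t"
proof -
  let ?X = "fwX S r t" and ?v = "diag_vec (fwX S r t) - 1"
  define b where "b = (1 - 2 * \<epsilon>) * binary_opt C"
  have b: "0 < b" using eps trace_C_pos trace_le_binary_opt by (simp add: b_def)
  have b4: "b \<le> 4 * trace C"
  proof -
    have "b \<le> 1 * binary_opt C" unfolding b_def using eps trace_C_pos trace_le_binary_opt by (intro mult_right_mono) auto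
    then show ?thesis using binary_opt_le trace_C_pos by linarith
  qed
  obtain x where x: "x \<in> binary_vectors" "binary_opt C = x \<bullet> (C *v x)" using binary_opt_attained by blast
  note sq = binary_vectors_square[OF x(1)]
  have dx: "diag_vec (rank_one x) = 1" by (simp add: diag_vec_def rank_one_def sq vec_eq_iff)
  have "rank_one x \<in> feasible" by (simp add: feasible_def psd_rank_one trace_rank_one inner_vec_def sq)
  then have "obj C \<beta> M (rank_one x) - \<epsilon> * trace C \<le> obj C \<beta> M ?X"
    using opt by (simp add: delta_optimal_def fw_objective_eq)
  moreover have "obj C \<beta> M (rank_one x) = binary_opt C - \<epsilon> * trace C"
  proof -
    have "\<beta> * phi M (0 :: real^'n) = \<epsilon> * trace C"
      unfolding phi_zero n[symmetric] using eps ln_2n_pos by (simp add: S_simps)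
    then show ?thesis by (simp add: obj_eq inner_rank_one x(2) dx)
  qed
  ultimately have "binary_opt C - 2 * (\<epsilon> * trace C) \<le> C \<bullet> ?X - \<beta> * phi M ?v" by (simp add: obj_eq)
  moreover have "\<epsilon> * trace C \<le> \<epsilon> * binary_opt C" using eps trace_le_binary_opt by (intro mult_left_mono) auto
  ultimately have lower: "b + \<beta> * phi M ?v \<le> C \<bullet> ?X" by (simp add: b_def algebra_simps)
  have "dmax r t \<in> range (\<lambda>i. ?X $ i $ i)" unfolding dmax_def by (rule Max_in) auto
  then obtain i where i: "?X $ i $ i = dmax r t" by force
  have phi: "dmax r t - 1 \<le> phi M ?v" "0 \<le> phi M ?v"
    using phi_ge_abs[OF M_pos, of ?v i] i by (auto simp: diag_vec_def)
  \<comment> \<open>A vanishing diagonal would force \<open>C \<bullet> X \<le> 0\<close>, against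
    the positive lower bound.\<close>
  have dpos: "0 < dmax r t"
  proof (rule ccontr)
    assume "\<not> 0 < dmax r t"
    then have z: "?X $ k $ k \<le> 0" for k using dmax_ge[of r t k] by linarith
    have "C \<bullet> ?X \<le> 2 * 0 * trace C" by (rule inner_le_diag_bound[OF C S_simps(2) M_pos fwX_psd z])
    moreover have "0 \<le> \<beta> * phi M ?v" using beta_nonneg phi(2) by (rule mult_nonneg_nonneg)
    ultimately show False using lower b by simp
  qed
  have "b * dmax r t \<le> C \<bullet> ?X"
  proof (cases "dmax r t \<le> 1")
    case True
    have "b * dmax r t \<le> b" using True b by (simp add: mult_left_le)
    moreover have "0 \<le> \<beta> * phi M ?v" using beta_nonneg phi by simp
    ultimately show ?thesis using lower by linarith
  next
    case False
    have "b * (dmax r t - 1) \<le> \<beta> * (dmax r t - 1)" using b4 False by (intro mult_right_mono) (auto simp: S_simps(2))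
    also have "\<dots> \<le> \<beta> * phi M ?v" using phi beta_nonneg by (intro mult_left_mono)
    finally show ?thesis using lower by (simp add: algebra_simps)
  qed
  then show ?thesis unfolding b_def[symmetric] using dpos by (simp add: pos_le_divide_eq)
qed

end

section \<open>Measurability of a run\<close>

lemma borel_measurable_vec:
  fixes f :: "'a \<Rightarrow> real^'n"
  assumes "\<And>i. (\<lambda>x. f x $ i) \<in> borel_measurable M"
  shows "f \<in> borel_measurable M"
  unfolding borel_measurable_euclidean_space[of f M] using assms
  by (auto simp: Basis_vec_def inner_axis)

lemma borel_measurable_vec_nth: "(\<lambda>x::'b::topological_space^'n. x $ i) \<in> borel_measurable borel"
  by (intro borel_measurable_continuous_onI continuous_intros)

lemma borel_measurable_snd: "(snd :: 'a::topological_space \<times> 'b::topological_space \<Rightarrow> 'b) \<in> borel_measurable borel"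
  by (intro borel_measurable_continuous_onI continuous_intros)

lemma borel_measurable_matrix_vector_mult [measurable (raw)]:
  fixes A :: "'a \<Rightarrow> real^'n^'m" and x :: "'a \<Rightarrow> real^'n"
  assumes [measurable]: "A \<in> borel_measurable M" "x \<in> borel_measurable M"
  shows "(\<lambda>w. A w *v x w) \<in> borel_measurable M"
proof -
  note [measurable] = measurable_compose[OF measurable_compose[OF assms(1) borel_measurable_vec_nth] borel_measurable_vec_nth]
    measurable_compose[OF assms(2) borel_measurable_vec_nth]
  show ?thesis by (rule borel_measurable_vec) (simp add: matrix_vector_mult_def)
qed

lemma borel_measurable_generate_sample:
  fixes z v \<xi> :: "'a \<Rightarrow> real^'n"
  assumes z: "z \<in> borel_measurable M" and v: "v \<in> borel_measurable M" and xi: "\<xi> \<in> borel_measurable M"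
  shows "(\<lambda>w. generate_sample (z w) (v w) (\<xi> w)) \<in> borel_measurable M"
proof -
  note [measurable] = measurable_compose[OF z borel_measurable_vec_nth] measurable_compose[OF v borel_measurable_vec_nth]
    measurable_compose[OF xi borel_measurable_vec_nth]
  have [measurable]: "(\<lambda>w. Max (range (\<lambda>i. v w $ i))) \<in> borel_measurable M"
    by (rule borel_measurable_Max) simp_all
  show ?thesis
    unfolding generate_sample_def Let_def by (rule borel_measurable_vec) simp
qed

context max_cut_frank_wolfe
begin

abbreviation "RM \<equiv> PiM UNIV (\<lambda>_. borel) :: ('n source \<Rightarrow> real) measure"

lemma continuous_gibbs_nth: "continuous_on UNIV (\<lambda>v::real^'n. gibbs M (v - 1) $ i)"
proof -
  have nz: "(\<Sum>j\<in>UNIV. cosh (M * (v - 1) $ j)) \<noteq> 0" for v :: "real^'n"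
    using sum_cosh_pos[of "\<lambda>j. M * (v - 1) $ j"] by simp
  show ?thesis unfolding gibbs_def vec_lambda_beta
    by (intro continuous_intros ballI nz)
qed

lemma continuous_Jmat: "continuous_on UNIV (Jmat C \<beta> M)"
proof -
  have "continuous_on UNIV (\<lambda>v::real^'n. (if i = j then gibbs M (v - 1) $ i else 0))" for i j
    using continuous_gibbs_nth by (cases "i = j") auto
  then show ?thesis unfolding Jmat_def diag_matrix_def by (intro continuous_intros)
qed

lemma gibbs_measurable: "(\<lambda>v::real^'n. gibbs M (v - 1)) \<in> borel_measurable borel"
  by (intro borel_measurable_vec borel_measurable_continuous_onI continuous_gibbs_nth)

lemma fw_J_measurable: "(\<lambda>V. fw_J S V) \<in> borel_measurable borel"
  unfolding fw_J_eq[OF M_nz] S_simps(1)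
  by (rule measurable_compose[OF borel_measurable_snd borel_measurable_continuous_onI[OF continuous_Jmat]])

lemma lambda_measurable:
  "(\<lambda>V. lambda_max (fw_J S V)) \<in> borel_measurable borel"
  "(\<lambda>V. abs_eigenvalue_max (fw_J S V)) \<in> borel_measurable borel"
  unfolding fw_J_eq[OF M_nz] S_simps(1)
  using lambda_max_continuous[OF continuous_Jmat symmetric_Jmat[OF C(1)], THEN borel_measurable_continuous_onI]
  by (auto intro: measurable_compose[OF borel_measurable_snd])

lemma vec_source_measurable: "(\<lambda>r. \<chi> i. r (f i)) \<in> borel_measurable RM"
  by (rule borel_measurable_vec) (simp add: measurable_component_singleton)

text \<open>The number of iterations depends on \<open>V\<close>, so measurability is shown for each
  fixed number and then combined over the countably many values.\<close>

lemma lmo_vec_measurable: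
  assumes f: "f \<in> measurable N RM" and V: "V \<in> borel_measurable N"
  shows "(\<lambda>x. lmo_vec S t (f x) (V x)) \<in> borel_measurable N"
proof -
  note [measurable] = measurable_compose[OF V fw_J_measurable]
    measurable_compose[OF V lambda_measurable(2)] measurable_compose[OF f vec_source_measurable]
  have it: "(\<lambda>x. (power_step (fw_J S (V x)) ^^ k) (sgn (\<chi> i. f x (Seed t i)))) \<in> borel_measurable N" for k
  proof (induction k)
    case (Suc k)
    note [measurable] = Suc
    show ?case unfolding funpow.simps(2) comp_def power_step_def[of _ "(power_step _ ^^ k) _"] by measurable
  qed simp
  have k: "(\<lambda>x. power_count S t (fw_J S (V x))) \<in> measurable N (count_space UNIV)"
    unfolding power_count_def by measurable
  show ?thesis unfolding lmo_vec_def
    by (rule measurable_compose_countable[OF it k])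
qed

lemma fw_H_measurable:
  assumes [measurable]: "V \<in> borel_measurable RM" "w \<in> borel_measurable RM"
  shows "(\<lambda>r. B_op C (fw_H (fw_J S (V r)) (w r))) \<in> borel_measurable RM"
proof -
  note [measurable] = measurable_compose[OF assms(1) fw_J_measurable] measurable_compose[OF assms(2) borel_measurable_vec_nth]
  have d [measurable]: "(\<lambda>r. (\<chi> i. n * (w r $ i * w r $ i))) \<in> borel_measurable RM"
    by (rule borel_measurable_vec) simp
  have "B_op C (fw_H (fw_J S (V r)) (w r)) = (if 0 \<le> w r \<bullet> (fw_J S (V r) *v w r)
      then (n * (w r \<bullet> (C *v w r)), \<chi> i. n * (w r $ i * w r $ i)) else (0, 0))" for r
    by (simp add: fw_H_def B_op_def inner_rank_one n) (simp add: diag_vec_def rank_one_def vec_eq_iff)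
  then show ?thesis by simp
qed

lemma fwV_measurable: "(\<lambda>r. fwV S r t) \<in> borel_measurable RM"
proof (induction t)
  case (Suc t)
  note [measurable] = Suc fw_H_measurable[OF Suc lmo_vec_measurable[OF measurable_ident_sets[OF refl] Suc]]
  show ?case unfolding fwV.simps S_simps(1) by measurable
qed simp

lemma fww_measurable: "(\<lambda>r. fww S r t) \<in> borel_measurable RM"
  unfolding fww_def by (rule lmo_vec_measurable[OF measurable_ident_sets[OF refl] fwV_measurable])

lemma fw_gap_measurable: "(\<lambda>r. fw_gap S r t) \<in> borel_measurable RM"
proof -
  note [measurable] = fwV_measurable fw_H_measurable[OF fwV_measurable fww_measurable]
  have [measurable]: "(\<lambda>r. gibbs M (snd (fwV S r t) - 1)) \<in> borel_measurable RM"
    by (rule measurable_compose[OF measurable_compose[OF fwV_measurable borel_measurable_snd] gibbs_measurable])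
  show ?thesis unfolding fw_gap_def fw_grad_eq[OF M_nz] S_simps(1) by measurable
qed

lemma stop_time_measurable: "stop_time \<in> measurable RM (count_space UNIV)"
proof -
  note [measurable] = fw_gap_measurable
  show ?thesis unfolding stop_time_def[abs_def] by measurable
qed

text \<open>The success criterion with \<open>V\<close> and \<open>w\<close> as free arguments, so
  that the matrix and the start may come from different sources.\<close>

definition call_ok :: "nat \<Rightarrow> real \<times> (real^'n) \<Rightarrow> real^'n \<Rightarrow> bool" where
  "call_ok t V w \<longleftrightarrow> norm w = 1 \<and>
     real CARD('n) * (w \<bullet> (fw_J S V *v w)) \<ge> real CARD('n) * lambda_max (fw_J S V) - lmo_error S t"

lemma lmo_ok_call_ok: "lmo_ok r t \<longleftrightarrow> call_ok t (fwV S r t) (fww S r t)"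
  by (simp add: lmo_ok_def call_ok_def)

lemma call_ok_measurable:
  assumes V: "V \<in> borel_measurable N" and w [measurable]: "w \<in> borel_measurable N"
  shows "Measurable.pred N (\<lambda>x. call_ok t (V x) (w x))"
proof -
  note [measurable] = measurable_compose[OF V fw_J_measurable]
  have q: "(\<lambda>x. w x \<bullet> (fw_J S (V x) *v w x)) \<in> borel_measurable N" by measurable
  have l: "(\<lambda>x. real CARD('n) * lambda_max (fw_J S (V x)) - lmo_error S t) \<in> borel_measurable N"
    by (intro borel_measurable_diff borel_measurable_times borel_measurable_const
        measurable_compose[OF V lambda_measurable(1)])
  have "(\<lambda>x. real CARD('n) * (w x \<bullet> (fw_J S (V x) *v w x))) \<in> borel_measurable N"
    by (intro borel_measurable_times borel_measurable_const q)
  from borel_measurable_le[OF l this]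
  have [measurable]: "Measurable.pred N (\<lambda>x. real CARD('n) * lambda_max (fw_J S (V x)) - lmo_error S t
      \<le> real CARD('n) * (w x \<bullet> (fw_J S (V x) *v w x)))"
    by (simp only: pred_def)
  have [measurable]: "Measurable.pred N (\<lambda>x. norm (w x) = 1)"
    unfolding pred_def by (intro borel_measurable_eq) measurable
  show ?thesis unfolding call_ok_def by measurable
qed

lemma lmo_ok_measurable: "Measurable.pred RM (\<lambda>r. lmo_ok r t)"
  unfolding lmo_ok_call_ok by (rule call_ok_measurable[OF fwV_measurable fww_measurable])

lemma fwz_measurable: "(\<lambda>z. fwz S (fst z) (snd z) t) \<in> borel_measurable (RM \<Otimes>\<^sub>M RM)"
proof (induction t)
  case 0
  show ?case unfolding fwz.simps by (rule measurable_compose[OF measurable_snd vec_source_measurable])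
next
  case (Suc t)
  have [measurable]: "(\<lambda>r. fw_direction (fwJ S r t) (fww S r t)) \<in> borel_measurable RM"
  proof -
    note [measurable] = fww_measurable measurable_compose[OF fwV_measurable fw_J_measurable]
    show ?thesis unfolding fw_direction_def by measurable
  qed
  have [measurable]: "(\<lambda>z. snd z (Zeta t)) \<in> borel_measurable (RM \<Otimes>\<^sub>M RM)"
    by (rule measurable_compose[OF measurable_snd]) (simp add: measurable_component_singleton)
  note [measurable] = Suc
  show ?case unfolding fwz.simps by measurable
qed

lemma sample_measurable: "(\<lambda>z. sample S (fst z) (snd z) t) \<in> borel_measurable (RM \<Otimes>\<^sub>M RM)"
  unfolding sample_def
proof (rule borel_measurable_generate_sample[OF fwz_measurable])
  show "(\<lambda>z. snd (fwV S (fst z) t)) \<in> borel_measurable (RM \<Otimes>\<^sub>M RM)"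
    by (rule measurable_compose[OF measurable_compose[OF measurable_fst fwV_measurable] borel_measurable_snd])
  show "(\<lambda>z. \<chi> i. snd z (Round i)) \<in> borel_measurable (RM \<Otimes>\<^sub>M RM)"
    by (rule measurable_compose[OF measurable_snd vec_source_measurable])
qed

lemma sample_stop_measurable: "(\<lambda>z. sample S (fst z) (snd z) (stop_time (fst z))) \<in> borel_measurable (RM \<Otimes>\<^sub>M RM)"
  by (rule measurable_compose_countable[OF sample_measurable measurable_compose[OF measurable_fst stop_time_measurable]])

end

section \<open>Averaging over the sources\<close>

lemma lmo_vec_cong: "(\<And>i. r (Seed t i) = r' (Seed t i)) \<Longrightarrow> lmo_vec S t r V = lmo_vec S t r' V"
  by (simp add: lmo_vec_def)

text \<open>\<open>V_t\<close> reads only the starts of calls before \<open>t\<close>, which makes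
  it independent of the start of call \<open>t\<close>.\<close>

lemma fwV_cong: "(\<And>i j. i < t \<Longrightarrow> r (Seed i j) = r' (Seed i j)) \<Longrightarrow> fwV S r t = fwV S r' t"
proof (induction t)
  case (Suc t)
  then show ?case using lmo_vec_cong[of r t r'] by simp
qed simp

definition seeds :: "'n source set" where
  "seeds = {s. \<exists>t i. s = Seed t i}"

lemma mask_not_seeds:
  "mask_sources (- seeds) r (Init i) = r (Init i)" "mask_sources (- seeds) r (Zeta t) = r (Zeta t)"
  "mask_sources (- seeds) r (Round i) = r (Round i)"
  by (simp_all add: mask_sources_def seeds_def)

lemma fwV_seeds: "fwV S (mask_sources seeds r) t = fwV S r t"
  by (rule fwV_cong) (auto simp: mask_sources_def seeds_def)

lemma fww_seeds: "fww S (mask_sources seeds r) t = fww S r t"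
  unfolding fww_def fwV_seeds by (rule lmo_vec_cong) (auto simp: mask_sources_def seeds_def)

lemma fw_gap_seeds: "fw_gap S (mask_sources seeds r) t = fw_gap S r t"
  unfolding fw_gap_def fwV_seeds fww_seeds ..

lemma fwz_seeds: "fwz S (mask_sources seeds r) (mask_sources (- seeds) r') t = fwz S r r' t"
  by (induction t) (simp_all add: fwV_seeds fww_seeds mask_not_seeds del: fwV.simps)

lemma sample_seeds: "sample S (mask_sources seeds r) (mask_sources (- seeds) r') t = sample S r r' t"
  unfolding sample_def fwz_seeds fwV_seeds mask_not_seeds ..

context max_cut_run
begin

abbreviation "src \<omega> \<equiv> (\<lambda>s. G s \<omega>)"

lemma src_measurable: "src \<in> measurable P RM"
  by (rule measurable_PiM_single') (auto simp: G_measurable)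

lemma stop_time_seeds: "stop_time (mask_sources seeds r) = stop_time r"
  unfolding stop_time_def fw_gap_seeds ..

text \<open>The matrix is frozen through \<open>r\<close>, so its top eigenvector \<open>b\<close>
  is deterministic while the start is Gaussian; failure is then contained in the event of
  \<open>gaussian_start_bad\<close>.\<close>

lemma call_failure:
  "emeasure P {\<omega>\<in>space P. \<not> call_ok t (fwV S r t) (lmo_vec S t (src \<omega>) (fwV S r t))} \<le> ennreal (fw_p S)"
proof -
  let ?J = "fwJ S r t" and ?p = "fw_p S"
  define L where "L = ln (n / ?p\<^sup>2)"
  define \<xi> :: "'w \<Rightarrow> real^'n" where "\<xi> \<omega> = (\<chi> i. G (Seed t i) \<omega>)" for \<omega>
  define c where "c = ?p\<^sup>2 / (real CARD('n) * exp 1 * ln (real CARD('n) / ?p\<^sup>2))"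
  obtain b where b: "norm b = 1" "?J *v b = lambda_max ?J *\<^sub>R b" by (rule lambda_max_attained[OF symmetric_fwJ])
  have p: "0 < ?p" "?p \<le> 1 / 8" using p_bounds by auto
  have L: "1 < L" unfolding L_def by (rule small_ball_radius_bound(1)[OF p n_ge_1])
  have inj: "inj (Seed t :: 'n \<Rightarrow> 'n source)" by (simp add: inj_on_def)
  have err: "0 < lmo_error S t" using Cg_pos by (simp add: lmo_error_eq)
  have [measurable]: "\<xi> \<in> borel_measurable P"
    unfolding \<xi>_def by (rule borel_measurable_vec) (simp add: G_measurable)
  have "{\<omega>\<in>space P. \<not> call_ok t (fwV S r t) (lmo_vec S t (src \<omega>) (fwV S r t))}
     \<subseteq> {\<omega>\<in>space P. (b \<bullet> \<xi> \<omega>)\<^sup>2 \<le> c * (\<xi> \<omega> \<bullet> \<xi> \<omega>)}"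
  proof (intro Collect_mono impI, elim conjE, rule conjI, assumption, rule ccontr)
    fix \<omega> assume nok: "\<not> call_ok t (fwV S r t) (lmo_vec S t (src \<omega>) (fwV S r t))"
      and "\<not> (b \<bullet> \<xi> \<omega>)\<^sup>2 \<le> c * (\<xi> \<omega> \<bullet> \<xi> \<omega>)"
    \<comment> \<open>The choice of \<open>L\<close> makes \<open>exp (- L)\<close> equal to
      \<open>p^2 / n\<close>, so the threshold of the power method is exactly
      \<open>c\<close>.\<close>
    moreover have "exp (- L) / (exp 1 * L) = c"
    proof -
      have "exp (- L) = ?p\<^sup>2 / n" using n_ge_1 p by (simp add: L_def exp_minus)
      then show ?thesis by (simp add: c_def L_def n)
    qed
    ultimately have x: "exp (- L) / (exp 1 * L) * (\<xi> \<omega> \<bullet> \<xi> \<omega>) < (b \<bullet> \<xi> \<omega>)\<^sup>2" by simp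
    have k: "abs_eigenvalue_max ?J / (lmo_error S t / n) * L \<le> real (power_count S t ?J)"
      unfolding power_count_def L_def n by simp linarith
    have w: "lmo_vec S t (src \<omega>) (fwV S r t) = (power_step ?J ^^ power_count S t ?J) (sgn (\<xi> \<omega>))"
      by (simp add: lmo_vec_def \<xi>_def)
    have "0 < lmo_error S t / n" "0 < L" using err n_ge_1 L by simp_all
    note s = power_method_success[OF symmetric_fwJ b lambda_max_fwJ_pos this k x, folded w]
    have "n * (lambda_max ?J - lmo_error S t / n)
        \<le> n * (lmo_vec S t (src \<omega>) (fwV S r t) \<bullet> (?J *v lmo_vec S t (src \<omega>) (fwV S r t)))"
      using s(2) n_ge_1 by (intro mult_left_mono) auto
    then have "call_ok t (fwV S r t) (lmo_vec S t (src \<omega>) (fwV S r t))"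
      using s(1) n_ge_1 unfolding call_ok_def n[symmetric] by (simp add: right_diff_distrib)
    then show False using nok by blast
  qed
  then have "emeasure P {\<omega>\<in>space P. \<not> call_ok t (fwV S r t) (lmo_vec S t (src \<omega>) (fwV S r t))}
     \<le> emeasure P {\<omega>\<in>space P. (b \<bullet> \<xi> \<omega>)\<^sup>2 \<le> c * (\<xi> \<omega> \<bullet> \<xi> \<omega>)}"
    by (rule emeasure_mono) measurable
  also have "\<dots> \<le> ennreal ?p"
    using gaussian_start_bad[OF G_indep inj G_normal b(1) p] unfolding \<xi>_def c_def .
  finally show ?thesis .
qed

lemma lmo_ok_events: "{\<omega>\<in>space P. \<not> lmo_ok (src \<omega>) t} \<in> events"
proof -
  note [measurable] = measurable_compose[OF src_measurable lmo_ok_measurable]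
  show ?thesis by measurable
qed

text \<open>Decoupling with \<open>A\<close> the starts of the earlier calls: the matrix is built
  from \<open>A\<close>, the start lies outside, and \<open>call_failure\<close> bounds the inner
  integral uniformly.\<close>

lemma lmo_failure: "emeasure P {\<omega>\<in>space P. \<not> lmo_ok (src \<omega>) t} \<le> ennreal (fw_p S)"
proof -
  define A :: "'n source set" where "A = {s. \<exists>i j. i < t \<and> s = Seed i j}"
  define F :: "('n source \<Rightarrow> real) \<times> ('n source \<Rightarrow> real) \<Rightarrow> ennreal" where
    "F z = (if call_ok t (fwV S (fst z) t) (lmo_vec S t (snd z) (fwV S (fst z) t)) then 0 else 1)" for z
  have V: "(\<lambda>z. fwV S (fst z) t) \<in> borel_measurable (RM \<Otimes>\<^sub>M RM)"
    by (rule measurable_compose[OF measurable_fst fwV_measurable])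
  note [measurable] = call_ok_measurable[OF V lmo_vec_measurable[OF measurable_snd V]]
  have F: "F \<in> borel_measurable (RM \<Otimes>\<^sub>M RM)" unfolding F_def by measurable
  have dep: "F (r, r') = F (mask_sources A r, mask_sources (- A) r')" for r r'
  proof -
    have "fwV S (mask_sources A r) t = fwV S r t" by (rule fwV_cong) (auto simp: mask_sources_def A_def)
    moreover have "lmo_vec S t (mask_sources (- A) r') V = lmo_vec S t r' V" for V
      by (rule lmo_vec_cong) (auto simp: mask_sources_def A_def)
    ultimately show ?thesis by (simp add: F_def)
  qed
  have "emeasure P {\<omega>\<in>space P. \<not> lmo_ok (src \<omega>) t} = (\<integral>\<^sup>+\<omega>. indicator {\<omega>\<in>space P. \<not> lmo_ok (src \<omega>) t} \<omega> \<partial>P)"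
    using lmo_ok_events by simp
  also have "\<dots> = (\<integral>\<^sup>+\<omega>. F (src \<omega>, src \<omega>) \<partial>P)"
    by (rule nn_integral_cong) (simp add: F_def lmo_ok_call_ok fww_def)
  also have "\<dots> = (\<integral>\<^sup>+\<omega>. \<integral>\<^sup>+\<omega>'. F (src \<omega>, src \<omega>') \<partial>P \<partial>P)"
    by (rule nn_integral_split_sources[OF G_indep F dep])
  also have "\<dots> \<le> (\<integral>\<^sup>+\<omega>. ennreal (fw_p S) \<partial>P)"
  proof (rule nn_integral_mono)
    fix \<omega> assume "\<omega> \<in> space P"
    let ?r = "src \<omega>"
    have "Measurable.pred P (\<lambda>\<omega>'. call_ok t (fwV S ?r t) (lmo_vec S t (src \<omega>') (fwV S ?r t)))"
      by (intro call_ok_measurable lmo_vec_measurable src_measurable borel_measurable_const)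
    then have ev: "{\<omega>'\<in>space P. \<not> call_ok t (fwV S ?r t) (lmo_vec S t (src \<omega>') (fwV S ?r t))} \<in> events"
      by measurable
    have "(\<integral>\<^sup>+\<omega>'. F (?r, src \<omega>') \<partial>P)
        = (\<integral>\<^sup>+\<omega>'. indicator {\<omega>'\<in>space P. \<not> call_ok t (fwV S ?r t) (lmo_vec S t (src \<omega>') (fwV S ?r t))} \<omega>' \<partial>P)"
      by (rule nn_integral_cong) (simp add: F_def)
    also have "\<dots> = emeasure P {\<omega>'\<in>space P. \<not> call_ok t (fwV S ?r t) (lmo_vec S t (src \<omega>') (fwV S ?r t))}"
      using ev by simp
    finally show "(\<integral>\<^sup>+\<omega>'. F (?r, src \<omega>') \<partial>P) \<le> ennreal (fw_p S)" using call_failure by simp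
  qed
  also have "\<dots> = ennreal (fw_p S)" by (simp add: emeasure_space_1)
  finally show ?thesis .
qed

lemma lmo_success_stop_time: "lmo_success S r \<longleftrightarrow> (\<forall>t\<le>stop_time r. lmo_ok r t)"
  unfolding lmo_ok_def by (rule lmo_success_iff[OF stop_time_stops stop_time_nonstop])

lemma stop_time_bound:
  assumes "\<And>t. t < nat \<lfloor>T\<rfloor> \<Longrightarrow> lmo_ok r t"
  shows "stop_time r < nat \<lfloor>T\<rfloor>"
  using success_stops[OF assms] stop_time_le by (meson le_less_trans)

lemma success_stop_time_bound:
  assumes "lmo_success S r"
  shows "real (Suc (stop_time r)) \<le> T"
proof -
  have "stop_time r < nat \<lfloor>T\<rfloor>"
  \<comment> \<open>If the stop came later, the first \<open>nat \<lfloor>T\<rfloor>\<close> calls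
    would all have been made and succeeded, which already forces an earlier stop.\<close>
  proof (rule ccontr)
    assume a: "\<not> stop_time r < nat \<lfloor>T\<rfloor>"
    then have "lmo_ok r t" if "t < nat \<lfloor>T\<rfloor>" for t using assms that by (simp add: lmo_success_stop_time)
    from stop_time_bound[OF this] a show False by blast
  qed
  then show ?thesis using T_ge_399 by linarith
qed

lemma lmo_success_events: "{\<omega>\<in>space P. lmo_success S (src \<omega>)} \<in> events"
proof -
  have [measurable]: "Measurable.pred P (\<lambda>\<omega>. lmo_ok (src \<omega>) t)" for t
    by (rule measurable_compose[OF src_measurable lmo_ok_measurable])
  have [measurable]: "(\<lambda>\<omega>. stop_time (src \<omega>)) \<in> measurable P (count_space UNIV)"
    by (rule measurable_compose[OF src_measurable stop_time_measurable])
  show ?thesis unfolding lmo_success_stop_time by measurable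
qed

text \<open>A union bound over the first \<open>nat \<lfloor>T\<rfloor>\<close> calls suffices: if
  they all succeed, the run stops among them and makes no further call. Calls beyond the stop are
  included, which the recursion without stopping test permits.\<close>

lemma lmo_success_probability: "1 - T * fw_p S \<le> measure P {\<omega>\<in>space P. lmo_success S (src \<omega>)}"
proof -
  let ?A = "{\<omega>\<in>space P. lmo_success S (src \<omega>)}" and ?B = "\<lambda>t. {\<omega>\<in>space P. \<not> lmo_ok (src \<omega>) t}"
  have "1 - measure P ?A = measure P (space P - ?A)" using prob_compl[OF lmo_success_events] by simp
  also have "\<dots> \<le> measure P (\<Union>t<nat \<lfloor>T\<rfloor>. ?B t)"
  proof (rule finite_measure_mono)
    show "space P - ?A \<subseteq> (\<Union>t<nat \<lfloor>T\<rfloor>. ?B t)"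
    proof (rule subsetI, rule ccontr)
      fix \<omega> assume w: "\<omega> \<in> space P - ?A" "\<omega> \<notin> (\<Union>t<nat \<lfloor>T\<rfloor>. ?B t)"
      then have ok: "lmo_ok (src \<omega>) t" if "t < nat \<lfloor>T\<rfloor>" for t using that by auto
      from stop_time_bound[OF this] ok have "lmo_success S (src \<omega>)" by (simp add: lmo_success_stop_time)
      then show False using w(1) by simp
    qed
    show "(\<Union>t<nat \<lfloor>T\<rfloor>. ?B t) \<in> events" using lmo_ok_events by auto
  qed
  also have "\<dots> \<le> (\<Sum>t<nat \<lfloor>T\<rfloor>. measure P (?B t))"
    using lmo_ok_events by (intro finite_measure_subadditive_finite) auto
  also have "\<dots> \<le> (\<Sum>t<nat \<lfloor>T\<rfloor>. fw_p S)"
    using lmo_failure p_bounds(1) by (intro sum_mono) (simp add: emeasure_eq_measure)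
  also have "\<dots> = real (nat \<lfloor>T\<rfloor>) * fw_p S" by simp
  also have "\<dots> \<le> T * fw_p S" using T_ge_399 p_bounds(1) by (intro mult_right_mono) auto
  finally show ?thesis by linarith
qed

lemma fw_output_sample: "fw_output S r = sample S r r (stop_time r)"
  unfolding sample_def by (rule fw_output_eq[OF stop_time_stops stop_time_nonstop])

lemma fw_output_measurable: "(\<lambda>\<omega>. fw_output S (src \<omega>)) \<in> borel_measurable P"
  using measurable_compose[OF measurable_Pair[OF src_measurable src_measurable] sample_stop_measurable]
  by (simp add: fw_output_sample)

text \<open>The stopping time and all coefficients read the starts, whereas the Gaussian vector and
  the rounding noise read the remaining sources; so the starts can be integrated last.\<close>

lemma nn_integral_fw_output:
  assumes f: "f \<in> borel_measurable borel"
  shows "(\<integral>\<^sup>+\<omega>. f (fw_output S (src \<omega>)) \<partial>P)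
    = (\<integral>\<^sup>+\<omega>. \<integral>\<^sup>+\<omega>'. f (sample S (src \<omega>) (src \<omega>') (stop_time (src \<omega>))) \<partial>P \<partial>P)"
proof -
  let ?F = "\<lambda>z. f (sample S (fst z) (snd z) (stop_time (fst z)))"
  have "(\<integral>\<^sup>+\<omega>. ?F (src \<omega>, src \<omega>) \<partial>P) = (\<integral>\<^sup>+\<omega>. \<integral>\<^sup>+\<omega>'. ?F (src \<omega>, src \<omega>') \<partial>P \<partial>P)"
  proof (rule nn_integral_split_sources[OF G_indep measurable_compose[OF sample_stop_measurable f]])
    show "?F (r, r') = ?F (mask_sources seeds r, mask_sources (- seeds) r')" for r r'
      by (simp add: sample_seeds stop_time_seeds)
  qed
  then show ?thesis by (simp add: fw_output_sample)
qed

lemma fw_output_binary: "AE \<omega> in P. fw_output S (src \<omega>) \<in> binary_vectors"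
proof -
  define f :: "real^'n \<Rightarrow> ennreal" where "f = indicator (- binary_vectors)"
  have "closed (binary_vectors :: (real^'n) set)" using finite_binary_vectors by (rule finite_imp_closed)
  then have f: "f \<in> borel_measurable borel" unfolding f_def by (intro borel_measurable_indicator) auto
  have "(\<integral>\<^sup>+\<omega>'. f (sample S r (src \<omega>') t) \<partial>P) = 0" for r t
  proof -
    have "(\<integral>\<^sup>+\<omega>'. f (sample S r (src \<omega>') t) \<partial>P) = (\<integral>\<^sup>+\<omega>'. 0 \<partial>P)"
      using sample_binary[of r t] by (intro nn_integral_cong_AE) (auto simp: f_def elim: eventually_mono)
    then show ?thesis by simp
  qed
  then have "(\<integral>\<^sup>+\<omega>. f (fw_output S (src \<omega>)) \<partial>P) = 0" by (simp add: nn_integral_fw_output[OF f])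
  then have "AE \<omega> in P. f (fw_output S (src \<omega>)) = 0"
    using measurable_compose[OF fw_output_measurable f] by (simp add: nn_integral_0_iff_AE)
  then show ?thesis by eventually_elim (simp add: f_def indicator_def split: if_splits)
qed

section \<open>Expected value of the output\<close>

abbreviation "val x \<equiv> x \<bullet> (C *v x)"

lemma val_measurable: "(\<lambda>x. val x) \<in> borel_measurable borel"
  by measurable

lemma integrable_fw_output: "integrable P (\<lambda>\<omega>. val (fw_output S (src \<omega>)))"
proof (rule integrable_const_bound)
  show "AE \<omega> in P. norm (val (fw_output S (src \<omega>))) \<le> binary_opt C"
    using fw_output_binary
  proof eventually_elim
    case (elim \<omega>)
    show ?case using quadratic_nonneg[of "fw_output S (src \<omega>)"] binary_opt_ge[OF elim, of C] by simp
  qed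
  show "(\<lambda>\<omega>. val (fw_output S (src \<omega>))) \<in> borel_measurable P"
    by (rule measurable_compose[OF fw_output_measurable val_measurable])
qed

lemma fw_output_le: "expectation (\<lambda>\<omega>. val (fw_output S (src \<omega>))) \<le> binary_opt C"
proof -
  have "expectation (\<lambda>\<omega>. val (fw_output S (src \<omega>))) \<le> expectation (\<lambda>_. binary_opt C)"
    using fw_output_binary by (intro integral_mono_AE integrable_fw_output) (auto elim!: eventually_mono binary_opt_ge)
  then show ?thesis by (simp add: prob_space)
qed

lemma fw_output_ge:
  assumes opt: "1 - T * fw_p S \<le> measure P {\<omega>\<in>space P. \<exists>t X. fw_stops S (src \<omega>) t X \<and>
      delta_optimal (fw_objective S) feasible (\<epsilon> * trace C) X}"
    (is "_ \<le> measure P ?A")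
  shows "alpha_GW * (1 - 3 * \<epsilon>) * binary_opt C \<le> expectation (\<lambda>\<omega>. val (fw_output S (src \<omega>)))"
proof -
  have pe: "1 - \<epsilon> \<le> measure P ?A" using opt p_bounds(3) by simp
  \<comment> \<open>The premise itself gives measurability: a set that is not an event has
    \<open>measure\<close> 0, which is less than \<open>1 - \<epsilon>\<close>.\<close>
  then have A: "?A \<in> events" using eps measure_notin_sets[of ?A P] by force
  define a where "a = alpha_GW * ((1 - 2 * \<epsilon>) * binary_opt C)"
  have b0: "0 \<le> binary_opt C" using trace_le_binary_opt trace_C_pos by linarith
  have a0: "0 \<le> a" unfolding a_def using b0 eps alpha_GW_nonneg by simp
  have inner: "ennreal a * indicator ?A \<omega>
      \<le> (\<integral>\<^sup>+\<omega>'. ennreal (val (sample S (src \<omega>) (src \<omega>') (stop_time (src \<omega>)))) \<partial>P)" for \<omega>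
  proof (cases "\<omega> \<in> ?A")
    case True
    let ?r = "src \<omega>" and ?\<tau> = "stop_time (src \<omega>)"
    let ?v = "\<lambda>\<omega>'. val (sample S ?r (src \<omega>') ?\<tau>)"
    have "delta_optimal (fw_objective S) feasible (\<epsilon> * trace C) (fwX S ?r ?\<tau>)"
      using True fw_stops_iff[OF stop_time_stops[of ?r] stop_time_nonstop] by auto
    from mult_left_mono[OF optimal_ratio[OF this] alpha_GW_nonneg]
    have "a \<le> alpha_GW * (C \<bullet> fwX S ?r ?\<tau> / dmax ?r ?\<tau>)" by (simp only: a_def)
    also have "\<dots> \<le> expectation ?v" by (rule expectation_sample_ge)
    finally have e: "a \<le> expectation ?v" .
    have m: "?v \<in> borel_measurable P"
      using measurable_compose[OF measurable_compose[OF measurable_Pair[OF measurable_const src_measurable] sample_measurable] val_measurable]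
      by (simp add: space_PiM)
    have i: "integrable P ?v"
    proof (rule integrable_const_bound[OF _ m])
      show "AE \<omega>' in P. norm (?v \<omega>') \<le> binary_opt C"
        using sample_binary[of ?r ?\<tau>]
      proof eventually_elim
        case (elim \<omega>')
        show ?case using quadratic_nonneg[of "sample S ?r (src \<omega>') ?\<tau>"] binary_opt_ge[OF elim, of C] by simp
      qed
    qed
    have "ennreal a \<le> ennreal (expectation ?v)" using e by (rule ennreal_leI)
    also have "\<dots> = (\<integral>\<^sup>+\<omega>'. ennreal (?v \<omega>') \<partial>P)"
      using i quadratic_nonneg by (intro nn_integral_eq_integral[symmetric]) auto
    finally show ?thesis using True by simp
  qed simp
  have f: "(\<lambda>x. ennreal (val x)) \<in> borel_measurable borel" using val_measurable by measurable
  have "ennreal (a * measure P ?A) = (\<integral>\<^sup>+\<omega>. ennreal a * indicator ?A \<omega> \<partial>P)"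
    using A a0 by (simp add: nn_integral_cmult_indicator emeasure_eq_measure ennreal_mult)
  also have "\<dots> \<le> (\<integral>\<^sup>+\<omega>. \<integral>\<^sup>+\<omega>'. ennreal (val (sample S (src \<omega>) (src \<omega>') (stop_time (src \<omega>)))) \<partial>P \<partial>P)"
    by (intro nn_integral_mono inner)
  also have "\<dots> = (\<integral>\<^sup>+\<omega>. ennreal (val (fw_output S (src \<omega>))) \<partial>P)"
    by (rule nn_integral_fw_output[OF f, symmetric])
  also have "\<dots> = ennreal (expectation (\<lambda>\<omega>. val (fw_output S (src \<omega>))))"
    using integrable_fw_output quadratic_nonneg by (intro nn_integral_eq_integral) auto
  finally have "a * measure P ?A \<le> expectation (\<lambda>\<omega>. val (fw_output S (src \<omega>)))"
    using quadratic_nonneg by (subst (asm) ennreal_le_iff) (auto intro!: integral_nonneg_AE)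
  moreover have "alpha_GW * (1 - 3 * \<epsilon>) * binary_opt C \<le> a * (1 - \<epsilon>)"
  proof -
    have "1 - 3 * \<epsilon> \<le> (1 - 2 * \<epsilon>) * (1 - \<epsilon>)" by (simp add: algebra_simps)
    then have "(alpha_GW * binary_opt C) * (1 - 3 * \<epsilon>) \<le> (alpha_GW * binary_opt C) * ((1 - 2 * \<epsilon>) * (1 - \<epsilon>))"
      using alpha_GW_nonneg b0 by (intro mult_left_mono) auto
    then show ?thesis by (simp only: a_def mult_ac)
  qed
  moreover have "a * (1 - \<epsilon>) \<le> a * measure P ?A" using pe a0 by (rule mult_left_mono)
  ultimately show ?thesis by linarith
qed

end

theorem theorem4p1:
  fixes C :: "real^'n::finite^'n"
    and \<epsilon> n T :: real
    and extra :: "nat \<Rightarrow> nat"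
    and P :: "'w measure"
    and G :: "'n source \<Rightarrow> 'w \<Rightarrow> real"
    and S :: "'n fw_param"
  assumes eps: "0 < \<epsilon>" "\<epsilon> < 1 / 3"
    and C: "symmetric_matrix C" "diagonally_dominant C" "\<And>i. C $ i $ i > 0"
    and n: "n = real CARD('n)"
    and T: "T = 64 * (ln (2 * n) * n\<^sup>2 / \<epsilon>\<^sup>2)"
    and S: "S = \<lparr> fw_cost = C, fw_beta = 4 * trace C, fw_M = 4 * (ln (2 * n) / \<epsilon>),
                  fw_curv = 16 * (trace C * ln (2 * n) * n\<^sup>2 / \<epsilon>), fw_tol = \<epsilon> * trace C,
                  fw_eta = 1, fw_p = \<epsilon> / T, fw_extra = extra \<rparr>"
    and P: "prob_space P"
    and G_indep: "prob_space.indep_vars P (\<lambda>_. borel) G UNIV"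
    and G_normal: "\<And>s. distributed P lborel (G s) std_normal_density"
  shows
    "(AE \<omega> in P. fw_output S (\<lambda>s. G s \<omega>) \<in> binary_vectors) \<and>
     integrable P (\<lambda>\<omega>. fw_output S (\<lambda>s. G s \<omega>) \<bullet> (C *v fw_output S (\<lambda>s. G s \<omega>))) \<and>
     (measure P {\<omega> \<in> space P. \<exists>t X. fw_stops S (\<lambda>s. G s \<omega>) t X \<and>
                   delta_optimal (fw_objective S) feasible (\<epsilon> * trace C) X}
        \<ge> 1 - T * fw_p S
      \<longrightarrow> alpha_GW * (1 - 3 * \<epsilon>) * binary_opt C
          \<le> (\<integral>\<omega>. fw_output S (\<lambda>s. G s \<omega>) \<bullet> (C *v fw_output S (\<lambda>s. G s \<omega>)) \<partial>P)) \<and>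
     (\<integral>\<omega>. fw_output S (\<lambda>s. G s \<omega>) \<bullet> (C *v fw_output S (\<lambda>s. G s \<omega>)) \<partial>P) \<le> binary_opt C \<and>
     measure P {\<omega> \<in> space P. lmo_success S (\<lambda>s. G s \<omega>)} \<ge> 1 - T * fw_p S \<and>
     (\<forall>\<omega>\<in>space P.
        (\<exists>t X. fw_stops S (\<lambda>s. G s \<omega>) t X) \<and>
        (lmo_success S (\<lambda>s. G s \<omega>) \<longrightarrow>
           (\<exists>t X. fw_stops S (\<lambda>s. G s \<omega>) t X \<and> real (Suc t) \<le> T)) \<and>
        (\<forall>t k. real (Suc t) \<le> T \<longrightarrow>
           real (fw_matvecs S (\<lambda>s. G s \<omega>) t k)
             \<le> 240 * (n / \<epsilon>) * ln (4 * n / \<epsilon>) + real (extra t)) \<and>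
        (\<forall>k. real (working_memory (fst (fw_run S (\<lambda>s. G s \<omega>) k))) \<le> 3 * n))"
proof -
  interpret max_cut_run C \<epsilon> n T extra S P G
    using assms unfolding max_cut_run_def max_cut_run_axioms_def max_cut_frank_wolfe_def by blast
  have run: "(\<exists>t X. fw_stops S (src \<omega>) t X) \<and>
        (lmo_success S (src \<omega>) \<longrightarrow> (\<exists>t X. fw_stops S (src \<omega>) t X \<and> real (Suc t) \<le> T)) \<and>
        (\<forall>t k. real (Suc t) \<le> T \<longrightarrow>
           real (fw_matvecs S (src \<omega>) t k) \<le> 240 * (n / \<epsilon>) * ln (4 * n / \<epsilon>) + real (extra t)) \<and>
        (\<forall>k. real (working_memory (fst (fw_run S (src \<omega>) k))) \<le> 3 * n)" for \<omega>
  proof (intro conjI impI allI)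
    let ?\<tau> = "stop_time (src \<omega>)"
    have s: "fw_stops S (src \<omega>) ?\<tau> (fwX S (src \<omega>) ?\<tau>)"
      using fw_stops_iff[OF stop_time_stops[of "src \<omega>"] stop_time_nonstop] by blast
    then show "\<exists>t X. fw_stops S (src \<omega>) t X" by blast
    show "\<exists>t X. fw_stops S (src \<omega>) t X \<and> real (Suc t) \<le> T" if "lmo_success S (src \<omega>)"
      using s success_stop_time_bound[OF that] by blast
    show "real (fw_matvecs S (src \<omega>) t k) \<le> 240 * (n / \<epsilon>) * ln (4 * n / \<epsilon>) + real (extra t)"
      if "real (Suc t) \<le> T" for t k
    proof -
      have "fw_matvecs S (src \<omega>) t k \<le> call_count S (src \<omega>) t + 1"
        by (rule fw_matvecs_le[OF stop_time_stops stop_time_nonstop])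
      then show ?thesis using matvec_count_bound[OF that, of "src \<omega>"] by linarith
    qed
    show "real (working_memory (fst (fw_run S (src \<omega>) k))) \<le> 3 * n" for k
      unfolding n by (rule working_memory_le)
  qed
  show ?thesis
    using fw_output_binary integrable_fw_output fw_output_ge fw_output_le lmo_success_probability run by blast
qed

end
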